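(* For every odd integer $n \ge 7$, there is (up to isomorphism) a unique transmission irregular (TI) tree $T^*$ of order $n$ that attains the maximum Wiener index among all TI trees of order $n$, with (i) $T^* \cong S\left( \frac{n - 1}{2}, \frac{n - 3}{2}, 1 \right)$, if $\{n - 2,n - 1\}\cap \mathcal{PS}=\emptyset$; (ii) $T^* \cong S\left( \frac{n - 1}{2}, \frac{n - 5}{2}, 2\right)$, if $\{n - 2,n - 1\}\cap \mathcal{PS}\neq\emptyset$ and $\{2n - 6, 2n - 2\}\cap\mathcal{PS}=\emptyset$; (iii) $T^* \cong C_{n - 2}\left( \frac{n - 1}{2}, \frac{n - 3}{2} + \sqrt{n - 2} \right)$, if $n - 2\in \mathcal{PS}$ and $\{2n - 6, 2n - 2\}\cap\mathcal{PS}\neq\emptyset$; (iv) $T^* \cong C_{n - 2}\left( \frac{n + 1}{2}, \frac{n - 3}{2} + \sqrt{n - 1} \right)$, if $n - 1\in\mathcal{PS}$ and $2n - 6\in\mathcal{PS}$.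
   Context: All graphs are simple, undirected and connected; the order of a graph is its number of vertices. The transmission of a vertex $v$ in a graph $G$ is $\mathrm{Tr}_G(v)=\sum_{u\in V(G)\setminus\{v\}} d_G(v,u)$, where $d_G$ is the graph distance. $G$ is transmission irregular (TI) if $|G|>1$ and all vertices of $G$ have pairwise different transmissions. The Wiener index $W(G)$ is the sum of $d_G(u,v)$ over all unordered pairs of vertices. $\mathcal{PS}$ is the set of perfect square integers. $S(a_1,a_2,\ldots,a_k)$ ($k\ge 3$) is the starlike tree: a single vertex with $k$ pendent paths of lengths (numbers of edges) $a_1,\ldots,a_k$ attached to it; its order is $1+\sum_i a_i$. $C_m(a_1,\ldots,a_k)$ (with $m\ge 3$, $k\ge 2$, $2\le a_i\le m-1$) is the tree of order $m+k$ obtained from the path $P_m=v_1v_2\cdots v_m$ by attaching a leaf to each of the vertices $v_{a_1},\ldots,v_{a_k}$. *)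

theory Defs
  imports
    "Graph_Theory.Graph_Theory"
    "HOL-Library.Discrete_Functions"
    "HOL-Computational_Algebra.Nth_Powers"
begin

text \<open>
  Finite simple undirected graphs are the \<open>pair_graph\<close>s of the Graph Theory library, that is
  finite, loop-free, symmetric digraphs whose arcs are ordered pairs of vertices.
\<close>

text \<open>
  In a symmetric digraph every edge \<open>uv\<close> yields the directed cycle \<open>u, v, u\<close> of length 2, so the
  predicate \<open>tree\<close> of the library excludes all undirected graphs with an edge. The cycles of the
  underlying undirected graph are the directed cycles of length at least 3.
\<close>

definition undirected_tree :: "'a pair_pre_digraph \<Rightarrow> bool" where
  "undirected_tree G \<longleftrightarrow> pair_graph G \<and> Digraph_Component.connected (with_proj G) \<and>
     \<not> (\<exists>p. pre_digraph.cycle (with_proj G) p \<and> 3 \<le> length p)"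

definition graph_iso :: "'a pair_pre_digraph \<Rightarrow> 'b pair_pre_digraph \<Rightarrow> bool" where
  "graph_iso G H \<longleftrightarrow> digraph_iso (with_proj G) (with_proj H)"

definition gdist :: "'a pair_pre_digraph \<Rightarrow> 'a \<Rightarrow> 'a \<Rightarrow> nat" where
  "gdist G u v = (INF p \<in> {p. pre_digraph.awalk (with_proj G) u p v}. length p)"

text \<open>
  On \<open>nat\<close> the infimum of a nonempty set is its least element; for vertices joined by a walk, the
  distance is the library's shortest-path distance \<open>\<mu>\<close> for unit arc weights.
\<close>

lemma gdist_eq_mu:
  assumes wf: "wf_digraph (with_proj G)" and w: "pre_digraph.awalk (with_proj G) u q v"
  shows "ereal (real (gdist G u v)) = wf_digraph.\<mu> (with_proj G) (\<lambda>_. 1) u v"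
proof -
  interpret W: wf_digraph "with_proj G" by (fact wf)
  let ?P = "{p. W.awalk u p v}"
  have cost: "W.awalk_cost (\<lambda>_. 1) p = real (length p)" for p
    by (induction p) auto
  have "gdist G u v \<in> length ` ?P"
    unfolding gdist_def using w by (intro Inf_nat_def1) auto
  then obtain p where p: "p \<in> ?P" "length p = gdist G u v" by auto
  have le: "gdist G u v \<le> length r" if "r \<in> ?P" for r
    unfolding gdist_def using that by (intro cINF_lower) auto
  have "(INF r \<in> ?P. ereal (W.awalk_cost (\<lambda>_. 1) r)) = ereal (real (gdist G u v))"
  proof (rule INF_eqI)
    show "ereal (real (gdist G u v)) \<le> ereal (W.awalk_cost (\<lambda>_. 1) r)" if "r \<in> ?P" for r
      using le[OF that] by (simp add: cost)
    show "y \<le> ereal (real (gdist G u v))"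
      if "\<And>r. r \<in> ?P \<Longrightarrow> y \<le> ereal (W.awalk_cost (\<lambda>_. 1) r)" for y
      using that[OF p(1)] by (simp add: cost p(2))
  qed
  then show ?thesis by (simp add: W.\<mu>_def)
qed

definition transmission :: "'a pair_pre_digraph \<Rightarrow> 'a \<Rightarrow> nat" where
  "transmission G v = (\<Sum>u \<in> pverts G - {v}. gdist G v u)"

definition transmission_irregular :: "'a pair_pre_digraph \<Rightarrow> bool" where
  "transmission_irregular G \<longleftrightarrow> 1 < card (pverts G) \<and> inj_on (transmission G) (pverts G)"

text \<open>
  The sum ranges over the two-element sets of vertices; the description is well-defined because the
  distance in an undirected graph is symmetric.
\<close>

definition wiener_index :: "'a pair_pre_digraph \<Rightarrow> nat" where
  "wiener_index G =
     (\<Sum>e | e \<subseteq> pverts G \<and> card e = 2. THE d. \<exists>u v. e = {u, v} \<and> d = gdist G u v)"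

definition TI_tree :: "nat \<Rightarrow> 'a pair_pre_digraph \<Rightarrow> bool" where
  "TI_tree n G \<longleftrightarrow>
     undirected_tree G \<and> transmission_irregular G \<and> card (pverts G) = n"

definition PS :: "nat set" where
  "PS = {m. is_square m}"

definition sym_graph :: "'a set \<Rightarrow> 'a rel \<Rightarrow> 'a pair_pre_digraph" where
  "sym_graph V E = \<lparr> pverts = V, parcs = E \<union> E\<inverse> \<rparr>"

text \<open>
  \<open>None\<close> is the centre, \<open>Some (i, j)\<close> the vertex at distance \<open>j\<close> from it on the \<open>i\<close>-th pendent
  path (\<open>i\<close> counted from 0), which has \<open>as ! i\<close> edges.
\<close>

definition starlike :: "nat list \<Rightarrow> (nat \<times> nat) option pair_pre_digraph" where
  "starlike as = sym_graph
     (insert None {Some (i, j) | i j. i < length as \<and> 1 \<le> j \<and> j \<le> as ! i})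
     ({(None, Some (i, 1)) | i. i < length as \<and> 1 \<le> as ! i} \<union>
      {(Some (i, j), Some (i, Suc j)) | i j. i < length as \<and> 1 \<le> j \<and> j < as ! i})"

text \<open>
  \<open>Inl j\<close> is the path vertex \<open>v\<^sub>j\<close> (\<open>1 \<le> j \<le> m\<close>), \<open>Inr i\<close> the leaf attached to \<open>v\<^bsub>as ! i\<^esub>\<close>.
\<close>

definition leafed_path :: "nat \<Rightarrow> nat list \<Rightarrow> (nat + nat) pair_pre_digraph" where
  "leafed_path m as = sym_graph
     (Inl ` {1..m} \<union> Inr ` {..<length as})
     ({(Inl j, Inl (Suc j)) | j. 1 \<le> j \<and> j < m} \<union>
      {(Inl (as ! i), Inr i) | i. i < length as})"

end

theory Submission
  imports Defs
begin

text \<open>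
  Let \<open>T\<close> be a tree of odd order \<open>n = 2 * h + 1\<close>, rooted at a vertex of minimum transmission, and
  let \<open>s v\<close> be the number of vertices in the subtree below \<open>v\<close>. The edge above \<open>v\<close> separates
  \<open>s v\<close> vertices from \<open>n - s v\<close>. Hence the Wiener index is the sum of the products
  \<open>s v * (n - s v)\<close>, and stepping down that edge changes the transmission by \<open>n - 2 * s v\<close>. Both
  the Wiener index and the differences of transmissions are therefore determined by the rooted tree
  up to isomorphism, here called its shape, and the whole extremal problem is solved for shapes.
  By the choice of the root every branch has at most \<open>h\<close> vertices, and if \<open>T\<close> is transmission
  irregular then siblings have different subtree sizes.

  On \<open>{0..h}\<close> the product \<open>s * (n - s)\<close> is strictly increasing in \<open>s\<close>, so its partial sums are
  convex. Among branches of a given size the path is the unique best one, and a large sum of branch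
  values wants branch sizes that are as unequal as possible. Equal siblings are excluded, so the best
  sizes at the root are \<open>h, h - 1, 1\<close>, the next ones are \<open>h, h - 2, 2\<close>, and all others are much
  worse (\<open>root_classification\<close>). With paths as branches these are the two starlike trees.

  On a path of size \<open>h\<close> below the root the transmissions exceed that of the root by the squares
  \<open>1, 4, 9, \<dots>\<close>, on a path of size \<open>h - 1\<close> by the squares minus 1, and on a single leaf by
  \<open>n - 2\<close>. So the first starlike tree is transmission irregular unless \<open>n - 2\<close> or \<open>n - 1\<close> is a
  square \<open>k\<^sup>2\<close>. In that case a tree with branch sizes \<open>h, h - 1, 1\<close> has to avoid the collision
  by forking the offending branch before depth \<open>k\<close> or \<open>k - 1\<close>, respectively
  (\<open>early_branching\<close>). The cheapest way is a leaf attached at the last possible place, and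
  this costs slightly more than passing to sizes \<open>h, h - 2, 2\<close>. The second starlike tree fails only
  if \<open>2 * n - 6\<close> or \<open>2 * n - 2\<close> is a square, and then the forked tree is the best one left. That the
  forked tree has no collisions is a matter of gaps between squares and of squares modulo 4.

  The bridge to graphs is the locale \<open>rooted_tree\<close>, in which a tree is given by a parent
  function. Undirected trees are exactly the graphs of this form, and rooted trees of equal shape are
  isomorphic, so the equality case for shapes yields uniqueness up to isomorphism.
\<close>

section \<open>Convexity of sums of edge contributions\<close>

text \<open>
  The contribution to the Wiener index of an edge that cuts a tree of order \<open>n\<close> into
  parts of sizes \<open>s\<close> and \<open>n - s\<close>.
\<close>

definition edge_weight :: "nat \<Rightarrow> nat \<Rightarrow> int" where
  "edge_weight n s = int s * (int n - int s)"

lemma edge_weight_mono: "i \<le> j \<Longrightarrow> j \<le> h \<Longrightarrow> edge_weight (2 * h + 1) i \<le> edge_weight (2 * h + 1) j"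
proof -
  assume a: "i \<le> j" "j \<le> h"
  have "edge_weight (2 * h + 1) j - edge_weight (2 * h + 1) i = (int j - int i) * (2 * int h + 1 - int i - int j)"
    by (simp add: edge_weight_def algebra_simps)
  moreover have "0 \<le> (int j - int i) * (2 * int h + 1 - int i - int j)"
    using a by (intro mult_nonneg_nonneg) auto
  ultimately show ?thesis by linarith
qed

lemma edge_weight_strict_mono: "i < j \<Longrightarrow> j \<le> h \<Longrightarrow> edge_weight (2 * h + 1) i < edge_weight (2 * h + 1) j"
proof -
  assume a: "i < j" "j \<le> h"
  have "edge_weight (2 * h + 1) j - edge_weight (2 * h + 1) i = (int j - int i) * (2 * int h + 1 - int i - int j)"
    by (simp add: edge_weight_def algebra_simps)
  moreover have "0 < (int j - int i) * (2 * int h + 1 - int i - int j)"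
    using a by (intro mult_pos_pos) auto
  ultimately show ?thesis by linarith
qed

text \<open>
  For \<open>s \<le> h\<close> this is the contribution of a pendent path with \<open>s\<close>
  vertices, including the edge that attaches it. The weights increase only up to \<open>h\<close>;
  freezing them there makes the function convex on all of \<open>nat\<close>, so that the
  inequalities below need no bound on the arguments.
\<close>

definition path_value :: "nat \<Rightarrow> nat \<Rightarrow> int" where
  "path_value h s = (\<Sum>i=1..s. edge_weight (2 * h + 1) (min i h))"

lemma path_value_0 [simp]: "path_value h 0 = 0"
  by (simp add: path_value_def)

lemma path_value_Suc: "path_value h (Suc s) = path_value h s + edge_weight (2 * h + 1) (min (Suc s) h)"
  by (simp add: path_value_def)

lemma path_value_Suc_le: "Suc s \<le> h \<Longrightarrow> path_value h (Suc s) = path_value h s + edge_weight (2 * h + 1) (Suc s)"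
  by (simp add: path_value_Suc min_def)

lemma path_value_pred: "1 \<le> s \<Longrightarrow> s \<le> h \<Longrightarrow> path_value h s = path_value h (s - 1) + edge_weight (2 * h + 1) s"
  using path_value_Suc_le[of "s - 1" h] by simp

text \<open>
  Convexity: increments over a fixed distance grow with the starting point, since the summands do.
\<close>

lemma path_value_shift: "a \<le> b \<Longrightarrow> path_value h (a + d) - path_value h a \<le> path_value h (b + d) - path_value h b"
proof (induction d)
  case (Suc d)
  have "edge_weight (2 * h + 1) (min (Suc (a + d)) h) \<le> edge_weight (2 * h + 1) (min (Suc (b + d)) h)"
    using Suc.prems by (intro edge_weight_mono) auto
  then show ?case using Suc by (simp add: path_value_Suc)
qed simp

lemma path_value_superadd: "path_value h x + path_value h y \<le> path_value h (x + y)"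
  using path_value_shift[of 0 x h y] by simp

text \<open>
  Convexity in the form in which it is used: two sizes are moved apart, with their total fixed,
  until the larger one is \<open>B\<close>.
\<close>

lemma path_value_spread:
  assumes "x \<le> B" "y \<le> B" "B \<le> x + y"
  shows "path_value h x + path_value h y \<le> path_value h B + path_value h (x + y - B)"
proof -
  have "x + y - B \<le> x" using assms by simp
  from path_value_shift[OF this, of h "B - x"] show ?thesis using assms by simp
qed

text \<open>
  The strictness comes from the last summand: \<open>edge_weight\<close> at \<open>x + y - 1 \<le>
  h\<close> against the one at \<open>y\<close>.
\<close>

lemma path_value_spread_strict:
  assumes "2 \<le> x" "2 \<le> y" "x + y \<le> Suc h"
  shows "path_value h x + path_value h y < path_value h (x + y - 1) + path_value h 1"
proof -
  obtain y' where y': "y = Suc y'" "1 \<le> y'" using assms by (cases y) auto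
  have "path_value h (Suc 0 + (y' - 1)) - path_value h (Suc 0) \<le> path_value h (x + (y' - 1)) - path_value h x"
    using assms by (intro path_value_shift) auto
  then have "path_value h y' - path_value h 1 \<le> path_value h (x + y' - 1) - path_value h x"
    using y' by simp
  moreover have "path_value h (x + y') = path_value h (x + y' - 1) + edge_weight (2 * h + 1) (x + y')"
    using path_value_Suc_le[of "x + y' - 1" h] assms y' by simp
  moreover have "path_value h y = path_value h y' + edge_weight (2 * h + 1) y"
    using path_value_Suc_le[of y' h] assms y' by simp
  moreover have "edge_weight (2 * h + 1) y < edge_weight (2 * h + 1) (x + y')"
    using assms y' by (intro edge_weight_strict_mono) auto
  ultimately show ?thesis using y' by simp
qed

text \<open>
  Repeated spreading: with all parts at most \<open>B\<close>, the sum is bounded by that of one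
  part of size \<open>B\<close> and one part with the rest. The rest may exceed \<open>B\<close>,
  where superadditivity of \<open>path_value\<close> takes over.
\<close>

lemma path_value_capped:
  assumes "\<forall>x\<in>#N. x \<le> B"
  shows "(\<Sum>x\<in>#N. path_value h x) \<le> path_value h (min B (\<Sum>\<^sub># N)) + path_value h (\<Sum>\<^sub># N - B)"
  using assms
proof (induction N)
  case (add x N)
  let ?S = "\<Sum>\<^sub># N"
  have IH: "(\<Sum>x\<in>#N. path_value h x) \<le> path_value h (min B ?S) + path_value h (?S - B)" and xB: "x \<le> B"
    using add by auto
  consider "x + ?S \<le> B" | "?S \<le> B" "B < x + ?S" | "B < ?S" by linarith
  then have "path_value h x + (path_value h (min B ?S) + path_value h (?S - B))
      \<le> path_value h (min B (x + ?S)) + path_value h (x + ?S - B)"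
  proof cases
    case 1
    then show ?thesis using path_value_superadd[of h x ?S] by (simp add: min_def)
  next
    case 2
    then show ?thesis using path_value_spread[of x B ?S h] xB by (simp add: min_def)
  next
    case 3
    then show ?thesis using path_value_superadd[of h x "?S - B"] by (simp add: min_def)
  qed
  then show ?case using IH by simp
qed simp

lemma sum_mset_pos: "\<forall>x\<in>#N. 1 \<le> x \<Longrightarrow> size N \<le> \<Sum>\<^sub># (N :: nat multiset)"
  by (induction N) auto

text \<open>
  Among the splittings into at least two parts, cutting off a single vertex is the best one, being
  the most unequal.
\<close>

lemma path_value_two_parts:
  assumes pos: "\<forall>x\<in>#N. 1 \<le> x" and two: "2 \<le> size N" and cap: "\<Sum>\<^sub># N \<le> h"
  shows "(\<Sum>x\<in>#N. path_value h x) \<le> path_value h (\<Sum>\<^sub># N - 1) + path_value h 1"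
    and "(\<Sum>x\<in>#N. path_value h x) = path_value h (\<Sum>\<^sub># N - 1) + path_value h 1 \<Longrightarrow> N = {#\<Sum>\<^sub># N - 1, 1#}"
proof -
  let ?S = "\<Sum>\<^sub># N"
  have split: "\<exists>N'. N = add_mset x N' \<and> 1 \<le> size N' \<and> size N' \<le> \<Sum>\<^sub># N'" if x: "x \<in># N" for x
  proof -
    obtain N' where N': "N = add_mset x N'" using multi_member_split[OF x] by blast
    have "1 \<le> size N'" using two unfolding N' by simp
    moreover have "size N' \<le> \<Sum>\<^sub># N'" using pos unfolding N' by (intro sum_mset_pos) simp
    ultimately show ?thesis using N' by blast
  qed
  have le: "x \<le> ?S - 1" if x: "x \<in># N" for x
  proof -
    obtain N' where "N = add_mset x N'" "1 \<le> size N'" "size N' \<le> \<Sum>\<^sub># N'"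
      using split[OF x] by blast
    then show ?thesis by simp
  qed
  have S2: "2 \<le> ?S" using sum_mset_pos[OF pos] two by simp
  show *: "(\<Sum>x\<in>#N. path_value h x) \<le> path_value h (?S - 1) + path_value h 1"
    using path_value_capped[of N "?S - 1" h] le S2 by (simp add: min_def)
  assume eq: "(\<Sum>x\<in>#N. path_value h x) = path_value h (?S - 1) + path_value h 1"
  have bound: "(\<Sum>x\<in>#N'. path_value h x) \<le> path_value h (\<Sum>\<^sub># N')" for N'
  proof (induction N')
    case (add y N')
    then show ?case using path_value_superadd[of h y "\<Sum>\<^sub># N'"] by simp
  qed simp
  show "N = {#?S - 1, 1#}"
  proof (cases "\<exists>x\<in>#N. 2 \<le> x")
    case True
    then obtain x where x: "x \<in># N" "2 \<le> x" by auto
    then obtain N' where N': "N = add_mset x N'" "1 \<le> size N'" "size N' \<le> \<Sum>\<^sub># N'"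
      using split by blast
    have "\<not> 2 \<le> \<Sum>\<^sub># N'"
    proof
      assume "2 \<le> \<Sum>\<^sub># N'"
      then have "path_value h x + path_value h (\<Sum>\<^sub># N') < path_value h (?S - 1) + path_value h 1"
        using path_value_spread_strict[of x "\<Sum>\<^sub># N'" h] x cap N' by simp
      then show False using eq bound[of N'] N' by simp
    qed
    then have s: "\<Sum>\<^sub># N' = 1" "size N' = 1" using N' by auto
    then obtain z where "N' = {#z#}" by (metis size_1_singleton_mset)
    then show ?thesis using s N' by simp
  next
    case False
    obtain x where x: "x \<in># N" using two by (metis multiset_nonemptyE not_numeral_le_zero size_empty)
    then obtain N' where N': "N = add_mset x N'" "1 \<le> size N'" using split by blast
    obtain y N'' where N'': "N' = add_mset y N''" using N' by (metis One_nat_def Suc_le_D size_eq_Suc_imp_eq_union)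
    have xy: "x = 1" "y = 1" using False pos N' N'' by force+
    show ?thesis
    proof (cases "N'' = {#}")
      case False
      then have "1 \<le> size N''" by (cases "size N''") auto
      moreover have "size N'' \<le> \<Sum>\<^sub># N''"
        using pos unfolding N'(1) N'' by (intro sum_mset_pos) simp
      ultimately have "1 \<le> \<Sum>\<^sub># N''" by simp
      then have "edge_weight (2 * h + 1) 1 < edge_weight (2 * h + 1) (?S - 1)"
        using xy N' N'' cap by (intro edge_weight_strict_mono) auto
      moreover have "path_value h (?S - 1) = path_value h (\<Sum>\<^sub># N'') + edge_weight (2 * h + 1) (?S - 1)"
        using path_value_Suc_le[of "\<Sum>\<^sub># N''" h] xy N' N'' cap by simp
      moreover have "path_value h 1 = edge_weight (2 * h + 1) 1"
        using path_value_Suc_le[of 0 h] S2 cap by simp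
      ultimately have False using eq bound[of N''] xy N' N'' by simp
      then show ?thesis ..
    qed (use xy N' N'' in simp)
  qed
qed

section \<open>Shapes of rooted trees and the value of a branch\<close>

text \<open>
  A rooted tree up to isomorphism. The multiset of children forgets their order and their names,
  so equality of shapes is isomorphism of rooted trees.
\<close>

datatype shape = Node (kids: "shape multiset")

primrec vol :: "shape \<Rightarrow> nat" where
  "vol (Node M) = Suc (\<Sum>\<^sub># (image_mset vol M))"

text \<open>
  The Wiener index of a tree of order \<open>n\<close> with this shape. The order is a separate
  argument because the recursion descends into proper subtrees while the weights refer to the
  whole tree.
\<close>

primrec wien :: "nat \<Rightarrow> shape \<Rightarrow> int" where
  "wien n (Node M) = (\<Sum>t\<in>#M. edge_weight n (vol t) + wien n t)"

text \<open>
  What a branch adds to the Wiener index: the edges inside it and the edge by which it hangs on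
  its parent.
\<close>

abbreviation branch_value :: "nat \<Rightarrow> shape \<Rightarrow> int" where
  "branch_value n t \<equiv> edge_weight n (vol t) + wien n t"

primrec stem :: "nat \<Rightarrow> shape \<Rightarrow> shape" where
  "stem 0 t = t"
| "stem (Suc j) t = Node {#stem j t#}"

text \<open>
  The path with \<open>s\<close> vertices, rooted at an end. The value at 0 is a default, equal to
  that at 1.
\<close>

definition path_shape :: "nat \<Rightarrow> shape" where
  "path_shape s = stem (s - 1) (Node {#})"

lemma path_shape_1 [simp]: "path_shape (Suc 0) = Node {#}"
  by (simp add: path_shape_def)

lemma path_shape_Suc: "1 \<le> s \<Longrightarrow> path_shape (Suc s) = Node {#path_shape s#}"
  by (cases s) (simp_all add: path_shape_def)

lemma vol_pos: "1 \<le> vol t"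
  by (cases t) simp

lemma vol_stem [simp]: "vol (stem j t) = j + vol t"
  by (induction j) auto

lemma vol_path_shape: "1 \<le> s \<Longrightarrow> vol (path_shape s) = s"
  by (simp add: path_shape_def)

text \<open>
  Follow the only child as long as there is exactly one. The end of the stem is a leaf or the
  first branching vertex, so \<open>j\<close> is the depth at which the tree stops looking like a
  path.
\<close>

lemma stem_decomposition: "\<exists>j M. t = stem j (Node M) \<and> size M \<noteq> 1"
proof (induction t)
  case (Node M)
  show ?case
  proof (cases "size M = 1")
    case True
    then obtain u where u: "M = {#u#}" by (metis size_1_singleton_mset)
    then obtain j M' where "u = stem j (Node M')" "size M' \<noteq> 1" using Node[of u] by auto
    then show ?thesis using u by (intro exI[of _ "Suc j"] exI[of _ M']) simp
  next
    case False
    then show ?thesis by (intro exI[of _ 0] exI[of _ M]) simp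
  qed
qed

lemma sum_mset_eq_pointwise:
  fixes f g :: "'b \<Rightarrow> int"
  assumes "\<forall>x\<in>#M. f x \<le> g x" "(\<Sum>x\<in>#M. g x) \<le> (\<Sum>x\<in>#M. f x)" "x \<in># M"
  shows "f x = g x"
proof -
  obtain M' where M': "M = add_mset x M'" using multi_member_split[OF assms(3)] by blast
  have "(\<Sum>y\<in>#M'. f y) \<le> (\<Sum>y\<in>#M'. g y)"
    using assms(1) M' by (intro sum_mset_mono) auto
  then show ?thesis using assms M' by force
qed

lemma vol_kids_pos: "\<forall>x\<in>#image_mset vol M. 1 \<le> x"
  using vol_pos by auto

text \<open>
  Paths are the unique best branches: by convexity it never pays to split the vertices below a
  vertex among several children.
\<close>

lemma branch_value_le_path_value:
  "vol t \<le> h \<Longrightarrow> branch_value (2 * h + 1) t \<le> path_value h (vol t) \<and>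
     (branch_value (2 * h + 1) t = path_value h (vol t) \<longrightarrow> t = path_shape (vol t))"
proof (induction t)
  case (Node M)
  let ?n = "2 * h + 1" and ?N = "image_mset vol M"
  let ?S = "\<Sum>\<^sub># ?N"
  have cap: "Suc ?S \<le> h" using Node.prems by simp
  have kid: "vol t \<le> ?S" if "t \<in># M" for t
    using multi_member_split[OF that] by auto
  have le: "\<forall>t\<in>#M. branch_value ?n t \<le> path_value h (vol t)"
    using Node.IH kid cap by fastforce
  have s1: "(\<Sum>t\<in>#M. branch_value ?n t) \<le> (\<Sum>t\<in>#M. path_value h (vol t))"
    using le by (intro sum_mset_mono) auto
  have s2: "(\<Sum>t\<in>#M. path_value h (vol t)) \<le> path_value h ?S"
    using path_value_capped[of ?N ?S h] kid by (auto simp: image_mset.compositionality comp_def)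
  have last: "path_value h (Suc ?S) = path_value h ?S + edge_weight ?n (Suc ?S)"
    using path_value_Suc_le[OF cap] .
  have "t = path_shape (vol t)" if eq: "branch_value ?n t = path_value h (vol t)" and t: "t = Node M" for t
  proof -
    have eq1: "(\<Sum>t\<in>#M. path_value h (vol t)) \<le> (\<Sum>t\<in>#M. branch_value ?n t)"
      and eq2: "(\<Sum>t\<in>#M. path_value h (vol t)) = path_value h ?S"
      using eq s1 s2 last unfolding t by simp_all
    have "size M < 2"
    proof (rule ccontr)
      assume "\<not> size M < 2"
      then have two: "2 \<le> size ?N" by simp
      have S2: "2 \<le> ?S" using sum_mset_pos[OF vol_kids_pos[of M]] two by simp
      have "(\<Sum>t\<in>#M. path_value h (vol t)) \<le> path_value h (?S - 1) + path_value h 1"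
        using path_value_two_parts(1)[OF vol_kids_pos two] cap
        by (simp add: image_mset.compositionality comp_def)
      also have "\<dots> < path_value h ?S"
        using path_value_Suc_le[of "?S - 1" h] path_value_Suc_le[of 0 h] cap S2
          edge_weight_strict_mono[of 1 ?S h] by simp
      finally show False using eq2 by simp
    qed
    then consider "M = {#}" | u where "M = {#u#}"
      by (metis One_nat_def less_2_cases size_1_singleton_mset size_eq_0_iff_empty)
    then show ?thesis
    proof cases
      case (2 u)
      then have "u = path_shape (vol u)" using Node.IH[of u] kid[of u] cap eq1 le by auto
      then show ?thesis unfolding t using 2 path_shape_Suc[of "vol u"] vol_pos[of u] by simp
    qed (simp add: t)
  qed
  then show ?case using s1 s2 last by auto
qed

lemma path_shape_if_max:
  assumes "vol t \<le> h" "path_value h (vol t) \<le> branch_value (2 * h + 1) t"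
  shows "t = path_shape (vol t)"
proof -
  have "branch_value (2 * h + 1) t = path_value h (vol t)"
    using branch_value_le_path_value[OF assms(1)] assms(2) by linarith
  then show ?thesis using branch_value_le_path_value[OF assms(1)] by (elim conjE) (rule mp)
qed

text \<open>
  Compared with a path of the same size, branching at a vertex with \<open>x\<close> vertices
  below it (itself included) loses at least the edge that cuts off \<open>x - 1\<close> vertices
  and gains a pendent edge in return. Equality holds only if a single leaf is split off and the
  rest is a path.
\<close>

lemma branch_value_branching_le:
  assumes "size M \<ge> 2" "vol (stem j (Node M)) \<le> h"
  defines "x \<equiv> vol (Node M)"
  shows "branch_value (2 * h + 1) (stem j (Node M))
      \<le> path_value h (j + x) - (edge_weight (2 * h + 1) (x - 1) - edge_weight (2 * h + 1) 1) \<and>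
    (branch_value (2 * h + 1) (stem j (Node M))
      = path_value h (j + x) - (edge_weight (2 * h + 1) (x - 1) - edge_weight (2 * h + 1) 1)
      \<longrightarrow> M = {#path_shape (x - 2), path_shape 1#})"
  using assms(2)
proof (induction j)
  case 0
  let ?n = "2 * h + 1" and ?N = "image_mset vol M"
  let ?S = "\<Sum>\<^sub># ?N"
  have x: "x = Suc ?S" by (simp add: x_def)
  have cap: "Suc ?S \<le> h" using 0 by simp
  have two: "2 \<le> size ?N" using assms(1) by simp
  have S2: "2 \<le> ?S" using sum_mset_pos[OF vol_kids_pos[of M]] two by simp
  have kid: "vol t \<le> ?S" if "t \<in># M" for t
    using multi_member_split[OF that] by auto
  have le: "\<forall>t\<in>#M. branch_value ?n t \<le> path_value h (vol t)"
    using branch_value_le_path_value kid cap by fastforce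
  have s1: "(\<Sum>t\<in>#M. branch_value ?n t) \<le> (\<Sum>t\<in>#M. path_value h (vol t))"
    using le by (intro sum_mset_mono) auto
  have s2: "(\<Sum>t\<in>#M. path_value h (vol t)) \<le> path_value h (?S - 1) + path_value h 1"
    using path_value_two_parts(1)[OF vol_kids_pos two] cap
    by (simp add: image_mset.compositionality comp_def)
  have p: "path_value h (Suc ?S) = path_value h (?S - 1) + edge_weight ?n ?S + edge_weight ?n (Suc ?S)" "path_value h 1 = edge_weight ?n 1"
    using path_value_Suc_le[of "?S - 1" h] path_value_Suc_le[of ?S h] path_value_Suc_le[of 0 h] cap S2 by simp_all
  have "M = {#path_shape (x - 2), path_shape 1#}"
    if eq: "branch_value ?n (Node M) = path_value h x - (edge_weight ?n (x - 1) - edge_weight ?n 1)"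
  proof -
    have eq1: "(\<Sum>t\<in>#M. path_value h (vol t)) \<le> (\<Sum>t\<in>#M. branch_value ?n t)"
      and eq2: "(\<Sum>t\<in>#M. path_value h (vol t)) = path_value h (?S - 1) + path_value h 1"
      using eq s1 s2 p unfolding x by simp_all
    have "?N = {#?S - 1, 1#}"
      using path_value_two_parts(2)[OF vol_kids_pos two, of h] cap eq2
      by (simp add: image_mset.compositionality comp_def)
    then obtain a M' where a: "M = add_mset a M'" "vol a = ?S - 1" "image_mset vol M' = {#1#}"
      using msed_map_invR[of vol M "?S - 1" "{#1#}"] by auto
    then obtain b where b: "M' = {#b#}" "vol b = 1"
      using msed_map_invR[of vol M' 1 "{#}"] by auto
    note ab = a(1,2) b
    have "a \<in># M" "b \<in># M" using ab by auto
    then have "branch_value ?n a = path_value h (vol a)" "branch_value ?n b = path_value h (vol b)" "vol a \<le> h" "vol b \<le> h"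
      using sum_mset_eq_pointwise[OF le eq1] kid[of a] kid[of b] cap by (blast, blast, linarith+)
    then have a': "a = path_shape (vol a)" and b': "b = path_shape (vol b)"
      by (intro path_shape_if_max[of _ h]; linarith)+
    have "a = path_shape (?S - 1)" using a' unfolding ab(2) .
    moreover have "b = path_shape 1" using b' unfolding ab(4) .
    moreover have "x - 2 = ?S - 1" using x by linarith
    ultimately show ?thesis using ab(1,3) by metis
  qed
  then show ?case using s1 s2 p unfolding x by auto
next
  case (Suc j)
  have "vol (stem (Suc j) (Node M)) = Suc (j + x)" by (simp add: x_def)
  then show ?case using Suc path_value_Suc_le[of "j + x" h] by simp
qed

section \<open>Transmission offsets\<close>

text \<open>
  The transmissions of the vertices of a subtree of this shape, in a tree of order
  \<open>n\<close> in which the root of the subtree has transmission \<open>a\<close>: descending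
  into a subtree with \<open>s\<close> vertices brings \<open>s\<close> vertices nearer and takes
  \<open>n - s\<close> further away.
\<close>

primrec offsets :: "nat \<Rightarrow> shape \<Rightarrow> int \<Rightarrow> int multiset" where
  "offsets n (Node M) =
     (\<lambda>a. add_mset a (\<Sum>t\<in>#M. offsets n t (a + int n - 2 * int (vol t))))"

text \<open>
  Here \<open>a\<close> is the value at the parent of the root of the branch.
\<close>

abbreviation branch_offsets :: "nat \<Rightarrow> shape \<Rightarrow> int \<Rightarrow> int multiset" where
  "branch_offsets n t a \<equiv> offsets n t (a + int n - 2 * int (vol t))"

definition no_repeats :: "'b multiset \<Rightarrow> bool" where
  "no_repeats N \<longleftrightarrow> (\<forall>x. count N x \<le> 1)"

lemma no_repeats_union: "no_repeats (A + B) \<longleftrightarrow> no_repeats A \<and> no_repeats B \<and> set_mset A \<inter> set_mset B = {}"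
proof
  assume u: "no_repeats (A + B)"
  have c: "count A x + count B x \<le> 1" for x using u by (simp add: no_repeats_def)
  have "count A x \<le> 1" "count B x \<le> 1" for x using c[of x] by linarith+
  moreover have "\<not> (x \<in># A \<and> x \<in># B)" for x
    using c[of x] by (auto simp flip: count_greater_zero_iff)
  ultimately show "no_repeats A \<and> no_repeats B \<and> set_mset A \<inter> set_mset B = {}" by (auto simp: no_repeats_def)
next
  assume u: "no_repeats A \<and> no_repeats B \<and> set_mset A \<inter> set_mset B = {}"
  have "count A x = 0 \<or> count B x = 0" for x
    using u by (auto simp: count_eq_zero_iff)
  then have "count A x + count B x \<le> 1" for x
    using u by (metis no_repeats_def add_0 add.right_neutral)
  then show "no_repeats (A + B)" by (simp add: no_repeats_def)
qed

lemma no_repeats_empty [simp]: "no_repeats {#}"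
  by (simp add: no_repeats_def)

lemma no_repeats_single [simp]: "no_repeats {#x#}"
  by (simp add: no_repeats_def)

lemma no_repeats_add_mset: "no_repeats (add_mset x B) \<longleftrightarrow> no_repeats B \<and> x \<notin># B"
  using no_repeats_union[of "{#x#}" B] by auto

lemma no_repeats_image_mset_set:
  assumes "finite S"
  shows "no_repeats (image_mset f (mset_set S)) \<longleftrightarrow> inj_on f S"
  using assms
proof (induction S rule: finite_induct)
  case (insert x S)
  then show ?case by (auto simp: no_repeats_add_mset)
qed (simp add: no_repeats_def)

lemma offset_root: "a \<in># offsets n t a"
  by (cases t) simp

text \<open>
  Along a stem the subtree size drops by one at each step, so the increments form an arithmetic
  progression and the offset at depth \<open>i\<close> is a quadratic polynomial in
  \<open>i\<close>.
\<close>

lemma stem_offset: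
  "1 \<le> i \<Longrightarrow> i \<le> Suc j \<Longrightarrow>
   a + int i * (int n - 2 * int (vol (stem j u))) + int i * (int i - 1) \<in># branch_offsets n (stem j u) a"
proof (induction j arbitrary: i a)
  case 0
  then have "i = 1" by simp
  then show ?case using offset_root by (simp add: algebra_simps)
next
  case (Suc j)
  let ?a = "a + int n - 2 * int (vol (stem (Suc j) u))"
  have eq: "branch_offsets n (stem (Suc j) u) a = add_mset ?a (branch_offsets n (stem j u) ?a)"
    by simp
  show ?case
  proof (cases "i = 1")
    case True
    then show ?thesis unfolding eq by simp
  next
    case False
    then obtain i' where i': "i = Suc i'" "1 \<le> i'" "i' \<le> Suc j"
      using Suc.prems by (cases i) auto
    have "?a + int i' * (int n - 2 * int (vol (stem j u))) + int i' * (int i' - 1)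
        = a + int i * (int n - 2 * int (vol (stem (Suc j) u))) + int i * (int i - 1)"
      unfolding i' by (simp add: algebra_simps)
    then have "a + int i * (int n - 2 * int (vol (stem (Suc j) u))) + int i * (int i - 1)
        \<in># branch_offsets n (stem j u) ?a"
      using Suc.IH[OF i'(2,3), of ?a] by (simp only:)
    then show ?thesis unfolding eq set_mset_add_mset_insert by blast
  qed
qed

lemma path_shape_offset:
  "1 \<le> i \<Longrightarrow> i \<le> s \<Longrightarrow>
   a + int i * (int n - 2 * int s) + int i * (int i - 1) \<in># branch_offsets n (path_shape s) a"
  using stem_offset[of i "s - 1" a n "Node {#}"] by (simp add: path_shape_def)

lemma branch_offsets_stem:
  "branch_offsets n (stem j u) a =
     image_mset (\<lambda>i. a + int i * (int n - 2 * int (j + vol u)) + int i * (int i - 1)) (mset_set {1..j})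
     + branch_offsets n u (a + int j * (int n - 2 * int (j + vol u)) + int j * (int j - 1))"
proof (induction j arbitrary: a)
  case (Suc j)
  let ?a = "a + int n - 2 * int (Suc j + vol u)"
  have e: "{1..Suc j} = insert 1 (Suc ` {1..j})" by (auto simp: image_iff Bex_def; presburger)
  have s: "mset_set {1..Suc j} = add_mset 1 (image_mset Suc (mset_set {1..j}))"
    unfolding e by (subst mset_set.insert) (auto simp: image_mset_mset_set)
  let ?f = "\<lambda>b m i. b + int i * (int n - 2 * int (m + vol u)) + int i * (int i - 1)"
  have shift: "?f ?a j i = ?f a (Suc j) (Suc i)" for i
    by (simp add: algebra_simps)
  have "branch_offsets n (stem (Suc j) u) a = add_mset ?a (branch_offsets n (stem j u) ?a)"
    by simp
  moreover have "branch_offsets n (stem j u) ?a =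
      image_mset (?f ?a j) (mset_set {1..j}) + branch_offsets n u (?f ?a j j)"
    by (rule Suc.IH)
  moreover have "image_mset (?f ?a j) (mset_set {1..j})
      = image_mset (?f a (Suc j)) (image_mset Suc (mset_set {1..j}))"
    unfolding multiset.map_comp comp_def by (intro image_mset_cong shift)
  moreover have "?f a (Suc j) 1 = ?a" by simp
  ultimately show ?case unfolding s shift[of j] by simp
qed simp

lemma branch_offsets_path_shape:
  assumes "1 \<le> s"
  shows "branch_offsets n (path_shape s) a =
     image_mset (\<lambda>i. a + int i * (int n - 2 * int s) + int i * (int i - 1)) (mset_set {1..s})"
proof -
  obtain j where s: "s = Suc j" using assms by (cases s) auto
  have e: "{1..Suc j} = insert (Suc j) {1..j}" by auto
  have m: "mset_set {1..Suc j} = add_mset (Suc j) (mset_set {1..j})"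
    unfolding e by (subst mset_set.insert) auto
  show ?thesis
    unfolding s path_shape_def m using branch_offsets_stem[of n j "Node {#}" a] by (simp add: algebra_simps)
qed

section \<open>Possible branch sizes at the root\<close>

text \<open>
  The shapes that transmission irregular trees of order \<open>2 * h + 1\<close> have when they
  are rooted at a vertex of minimum transmission. Minimality is reflected in the bound on the
  branches, as the step into a branch of size \<open>s\<close> adds \<open>2 * h + 1 - 2 *
  s\<close>.
\<close>

definition ti_shape :: "nat \<Rightarrow> shape \<Rightarrow> bool" where
  "ti_shape h t \<longleftrightarrow> vol t = 2 * h + 1 \<and> no_repeats (offsets (2 * h + 1) t 0) \<and> (\<forall>u\<in>#kids t. vol u \<le> h)"

lemma siblings_offsets_disjoint:
  assumes "no_repeats (offsets n (Node M) a)" "add_mset A (add_mset B M') = M"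
  shows "set_mset (branch_offsets n A a) \<inter> set_mset (branch_offsets n B a) = {}"
  using assms by (auto simp: no_repeats_add_mset no_repeats_union)

text \<open>
  Roots of sibling subtrees of equal size would have the same transmission.
\<close>

lemma siblings_vol_neq:
  assumes "no_repeats (offsets n (Node M) a)" "add_mset A (add_mset B M') = M"
  shows "vol A \<noteq> vol B"
  using siblings_offsets_disjoint[OF assms] offset_root by (metis disjoint_iff)

lemma largest_kid:
  assumes "M \<noteq> {#}"
  obtains A M' where "M = add_mset A M'" "\<forall>u\<in>#M'. vol u \<le> vol A"
proof -
  have "finite (vol ` set_mset M)" "vol ` set_mset M \<noteq> {}" using assms by auto
  from Max_in[OF this] Max_ge[OF this(1)]
  obtain A where A: "A \<in># M" "\<forall>u\<in>#M. vol u \<le> vol A" by (smt (verit) image_iff)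
  from multi_member_split[OF A(1)] obtain M' where "M = add_mset A M'" by blast
  then show thesis using A that by auto
qed

lemma path_value_sum_capped:
  assumes "\<forall>u\<in>#N. vol u \<le> B" "\<forall>u\<in>#N. vol u \<le> h"
  shows "(\<Sum>u\<in>#N. branch_value (2 * h + 1) u)
    \<le> path_value h (min B (\<Sum>u\<in>#N. vol u)) + path_value h ((\<Sum>u\<in>#N. vol u) - B)"
proof -
  have "(\<Sum>u\<in>#N. branch_value (2 * h + 1) u) \<le> (\<Sum>u\<in>#N. path_value h (vol u))"
    using assms(2) branch_value_le_path_value by (intro sum_mset_mono) auto
  also have "\<dots> \<le> path_value h (min B (\<Sum>u\<in>#N. vol u)) + path_value h ((\<Sum>u\<in>#N. vol u) - B)"
    using path_value_capped[of "image_mset vol N" B h] assms(1)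
    by (simp add: multiset.map_comp comp_def)
  finally show ?thesis .
qed

text \<open>
  The Wiener index of the starlike tree with legs \<open>h, h - 1, 1\<close>. For \<open>h \<ge>
  3\<close> it is the maximum over all trees of order \<open>2 * h + 1\<close> that have a vertex
  with pairwise different branch sizes of at most \<open>h\<close>.
\<close>

definition wmax :: "nat \<Rightarrow> int" where
  "wmax h = path_value h h + path_value h (h - 1) + path_value h 1"

text \<open>
  The sizes at the root are distinct, at most \<open>h\<close>, and sum to \<open>2 * h\<close>,
  so there are at least three of them. If the two largest are not \<open>h, h - 1\<close> or
  \<open>h, h - 2\<close>, then capping the second largest by \<open>h - 3\<close>, or the two
  largest by \<open>h - 1\<close> and \<open>h - 2\<close>, already loses two large edge weights
  and gains only the weights of two small ones.
\<close>

lemma root_classification: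
  assumes ti_shape: "ti_shape h (Node M)" and h: "3 \<le> h"
  obtains (1) A B C where "M = {#A, B, C#}" "vol A = h" "vol B = h - 1" "vol C = 1"
  | (2) A B C where "M = {#A, B, C#}" "4 \<le> h" "vol A = h" "vol B = h - 2" "vol C = 2"
  | (3) "6 \<le> h" "wien (2 * h + 1) (Node M) \<le> wmax h - (2 * int h * int h - 8 * int h)"
  | (4) "4 \<le> h" "wien (2 * h + 1) (Node M) \<le> wmax h - (2 * int h * int h - 8 * int h + 6)"
proof -
  let ?n = "2 * h + 1"
  have U: "no_repeats (offsets ?n (Node M) 0)" and tot: "(\<Sum>u\<in>#M. vol u) = 2 * h"
    and cap: "\<forall>u\<in>#M. vol u \<le> h"
    using ti_shape by (auto simp: ti_shape_def)
  have "M \<noteq> {#}" using tot h by auto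
  then obtain A M1 where A: "M = add_mset A M1" "\<forall>u\<in>#M1. vol u \<le> vol A" by (rule largest_kid)
  have Ah: "vol A \<le> h" using A cap by auto
  have "M1 \<noteq> {#}" using tot h A Ah by auto
  then obtain B M2 where B: "M1 = add_mset B M2" "\<forall>u\<in>#M2. vol u \<le> vol B" by (rule largest_kid)
  have AB: "vol B < vol A"
    using siblings_vol_neq[OF U, of A B M2] A B by fastforce
  have "M2 \<noteq> {#}" using tot A B Ah AB by auto
  then obtain C M3 where C: "M2 = add_mset C M3" "\<forall>u\<in>#M3. vol u \<le> vol C" by (rule largest_kid)
  have M: "M = add_mset A (add_mset B (add_mset C M3))" using A B C by simp
  have BC: "vol C < vol B"
    using siblings_vol_neq[OF U, of B C "add_mset A M3"] B C M by (simp add: add_mset_commute)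
  have tot': "vol A + vol B + vol C + (\<Sum>u\<in>#M3. vol u) = 2 * h" using tot M by simp
  have CD: "vol u < vol C" if u: "u \<in># M3" for u
  proof -
    obtain M4 where M4: "M3 = add_mset u M4" using multi_member_split[OF u] by blast
    then have "add_mset C (add_mset u (add_mset A (add_mset B M4))) = M"
      using M by (simp add: add_mset_commute)
    then show ?thesis using siblings_vol_neq[OF U] C(2) u by (metis le_neq_implies_less)
  qed
  have M3_empty: "M3 = {#}" if "vol C \<le> 1"
  proof (rule ccontr)
    assume "M3 \<noteq> {#}"
    then obtain u where "u \<in># M3" by (metis multiset_nonemptyE)
    then show False using CD[of u] that vol_pos[of u] by simp
  qed
  have bA: "branch_value ?n A \<le> path_value h (vol A)" using branch_value_le_path_value[of A h] Ah by simp
  have wien: "wien ?n (Node M) = branch_value ?n A + (\<Sum>u\<in>#M1. branch_value ?n u)" using A by simp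
  have M1h: "\<forall>u\<in>#M1. vol u \<le> h" using A cap by auto
  have M1t: "(\<Sum>u\<in>#M1. vol u) = 2 * h - vol A" using tot A by simp
  have p1: "path_value h 1 = edge_weight ?n 1" using path_value_Suc_le[of 0 h] h by simp
  have p2: "path_value h 2 = path_value h 1 + edge_weight ?n 2" using path_value_Suc_le[of 1 h] h by (simp add: numeral_2_eq_2)
  have p3: "path_value h 3 = path_value h 2 + edge_weight ?n 3" using path_value_Suc_le[of 2 h] h by (simp add: numeral_3_eq_3)
  have ph: "path_value h h = path_value h (h - 1) + edge_weight ?n h" using path_value_pred[of h h] h by simp
  have ph1: "path_value h (h - 1) = path_value h (h - 2) + edge_weight ?n (h - 1)"
    using path_value_pred[of "h - 1" h] h by (simp add: numeral_eq_Suc)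
  have ph2: "path_value h (h - 2) = path_value h (h - 3) + edge_weight ?n (h - 2)"
    using path_value_pred[of "h - 2" h] h by (simp add: numeral_eq_Suc)
  consider (a) "vol A = h" "vol B = h - 1" | (b) "vol A = h" "vol B = h - 2"
    | (c) "vol A = h" "vol B \<le> h - 3" | (d) "vol A \<le> h - 1" using Ah AB by linarith
  then show thesis
  proof cases
    case a
    then have "vol C = 1" using tot' vol_pos[of C] h by simp
    then show thesis using that(1)[of A B C] a M M3_empty by simp
  next
    case b
    have "4 \<le> h" using b(2) BC vol_pos[of C] by simp
    moreover have "vol C = 2"
    proof (rule ccontr)
      assume "vol C \<noteq> 2"
      then have "vol C = 1" using tot' vol_pos[of C] h b by simp
      then show False using M3_empty tot' b h by simp
    qed
    moreover from this have "M3 = {#}"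
    proof -
      have "(\<Sum>u\<in>#M3. vol u) = 0" using tot' b h \<open>vol C = 2\<close> by linarith
      then have "\<forall>u\<in>#M3. vol u = 0" by simp
      then show ?thesis using vol_pos by (metis multiset_nonemptyE not_one_le_zero)
    qed
    ultimately show thesis using that(2)[of A B C] b M by simp
  next
    case c
    have C2: "2 \<le> vol C"
    proof (rule ccontr)
      assume "\<not> 2 \<le> vol C"
      then show False using M3_empty tot' c h by simp
    qed
    then have h6: "6 \<le> h" using c BC by simp
    have "\<forall>u\<in>#M1. vol u \<le> h - 3" unfolding B(1) using B(2) c(2) by fastforce
    then have "(\<Sum>u\<in>#M1. branch_value ?n u) \<le> path_value h (min (h - 3) h) + path_value h (h - (h - 3))"
      using path_value_sum_capped[of M1 "h - 3" h] M1h M1t c(1) by simp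
    also have "\<dots> = path_value h (h - 3) + path_value h 3" using h by (simp add: min_def)
    finally have "wien ?n (Node M) \<le> path_value h h + path_value h (h - 3) + path_value h 3"
      using wien bA c by simp
    also have "\<dots> = wmax h - (edge_weight ?n (h - 1) + edge_weight ?n (h - 2) - edge_weight ?n 2 - edge_weight ?n 3)"
      unfolding wmax_def using p1 p2 p3 ph ph1 ph2 by simp
    also have "edge_weight ?n (h - 1) + edge_weight ?n (h - 2) - edge_weight ?n 2 - edge_weight ?n 3 = 2 * int h * int h - 8 * int h"
      using h by (simp add: edge_weight_def of_nat_diff algebra_simps)
    finally show thesis using that(3) h6 by simp
  next
    case d
    have A3: "3 \<le> vol A" using AB BC vol_pos[of C] by simp
    then have h4: "4 \<le> h" using d by simp
    have "vol B \<le> h - 2" using AB d by simp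
    then have "\<forall>u\<in>#M1. vol u \<le> h - 2" unfolding B(1) using B(2) by fastforce
    then have "(\<Sum>u\<in>#M1. branch_value ?n u) \<le> path_value h (min (h - 2) (2 * h - vol A)) + path_value h (2 * h - vol A - (h - 2))"
      using path_value_sum_capped[of M1 "h - 2" h] M1h M1t by simp
    also have "\<dots> = path_value h (h - 2) + path_value h (h + 2 - vol A)" using d h by (simp add: min_def)
    finally have "wien ?n (Node M) \<le> path_value h (vol A) + path_value h (h + 2 - vol A) + path_value h (h - 2)"
      using wien bA by simp
    also have "\<dots> \<le> path_value h (h - 1) + path_value h 3 + path_value h (h - 2)"
      using path_value_spread[of "vol A" "h - 1" "h + 2 - vol A" h] A3 d h by simp
    also have "\<dots> = wmax h - (edge_weight ?n h + edge_weight ?n (h - 1) - edge_weight ?n 2 - edge_weight ?n 3)"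
      unfolding wmax_def using p1 p2 p3 ph ph1 by simp
    also have "edge_weight ?n h + edge_weight ?n (h - 1) - edge_weight ?n 2 - edge_weight ?n 3 = 2 * int h * int h - 8 * int h + 6"
      using h by (simp add: edge_weight_def of_nat_diff algebra_simps)
    finally show thesis using that(4) h4 by simp
  qed
qed

section \<open>Upper bounds for the three extremal shapes\<close>

lemma branch_value_path_shape: "1 \<le> s \<Longrightarrow> s \<le> h \<Longrightarrow> branch_value (2 * h + 1) (path_shape s) = path_value h s"
proof (induction s)
  case (Suc s)
  show ?case
  proof (cases "s = 0")
    case True
    then show ?thesis using path_value_pred[of 1 h] Suc.prems by simp
  next
    case False
    then show ?thesis
      using Suc path_shape_Suc[of s] path_value_Suc_le[of s h] vol_path_shape[of s] by simp
  qed
qed simp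

text \<open>
  For \<open>x \<ge> 3\<close> the parameter is the total number of vertices.
\<close>

abbreviation fork :: "nat \<Rightarrow> shape" where
  "fork x \<equiv> Node {#path_shape (x - 2), path_shape 1#}"

lemma branch_value_stem_fork:
  assumes "3 \<le> x" "j + x \<le> h"
  shows "branch_value (2 * h + 1) (stem j (fork x))
    = path_value h (j + x) - (edge_weight (2 * h + 1) (x - 1) - edge_weight (2 * h + 1) 1)"
  using assms(2)
proof (induction j)
  case 0
  have "path_value h x = path_value h (x - 2) + edge_weight (2 * h + 1) (x - 1) + edge_weight (2 * h + 1) x"
    using path_value_pred[of x h] path_value_pred[of "x - 1" h] assms(1) 0 by (simp add: numeral_eq_Suc)
  moreover have "branch_value (2 * h + 1) (path_shape (x - 2)) = path_value h (x - 2)"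
    using assms(1) 0 by (intro branch_value_path_shape) auto
  moreover have "branch_value (2 * h + 1) (path_shape 1) = edge_weight (2 * h + 1) 1"
    by simp
  moreover have "wien (2 * h + 1) (fork x)
      = branch_value (2 * h + 1) (path_shape (x - 2)) + branch_value (2 * h + 1) (path_shape 1)"
    by simp
  moreover have "vol (fork x) = x" using vol_path_shape[of "x - 2"] assms(1) by simp
  ultimately show ?case unfolding stem.simps add_0 by presburger
next
  case (Suc j)
  have "vol (fork x) = x" using vol_path_shape[of "x - 2"] assms(1) by simp
  then have "vol (stem j (fork x)) = j + x" by simp
  then show ?case using Suc path_value_Suc_le[of "j + x" h] by simp
qed

text \<open>
  The offset in the assumption is the one that a branch has at depth \<open>i\<close> as long as
  it looks like a path up to there. If that value is forbidden, the branch has to branch strictly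
  above depth \<open>i\<close>, and by monotonicity of the weights the cheapest place for this is
  at depth \<open>i - 1\<close>.
\<close>

lemma early_branching:
  assumes h: "vol T \<le> h" and i: "1 \<le> i" "i \<le> vol T"
    and free: "int i * (int n - 2 * int (vol T)) + int i * (int i - 1) \<notin># branch_offsets n T 0"
  defines "loss \<equiv> edge_weight (2 * h + 1) (vol T - i + 1) - edge_weight (2 * h + 1) 1"
  shows "branch_value (2 * h + 1) T \<le> path_value h (vol T) - loss"
    and "branch_value (2 * h + 1) T = path_value h (vol T) - loss \<Longrightarrow> T = stem (i - 2) (fork (vol T - i + 2))"
proof -
  let ?n = "2 * h + 1"
  obtain j M where T: "T = stem j (Node M)" and M: "size M \<noteq> 1"
    using stem_decomposition by blast
  let ?x = "vol (Node M)"
  \<comment> \<open>The branching vertex has depth \<open>j + 1\<close>, and the stem offsets are valid up to and including it.\<close>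
  have V: "vol T = j + ?x" unfolding T by simp
  have j: "j + 2 \<le> i"
    using stem_offset[of i j 0 n "Node M"] free i(1) unfolding T by (cases "i \<le> Suc j") auto
  have "M \<noteq> {#}" using V i j by auto
  then have two: "2 \<le> size M" using M by (cases "size M") auto
  have bnd: "branch_value ?n T \<le> path_value h (vol T) - (edge_weight ?n (?x - 1) - edge_weight ?n 1)"
    and eqM: "branch_value ?n T = path_value h (vol T) - (edge_weight ?n (?x - 1) - edge_weight ?n 1)
      \<Longrightarrow> M = {#path_shape (?x - 2), path_shape 1#}"
    using branch_value_branching_le[OF two, of j h] h unfolding T by auto
  have le: "vol T - i + 1 \<le> ?x - 1" using V i j by simp
  have mono: "edge_weight ?n (vol T - i + 1) \<le> edge_weight ?n (?x - 1)"
    using edge_weight_mono[OF le] h V by simp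
  show "branch_value ?n T \<le> path_value h (vol T) - loss"
    using bnd mono unfolding loss_def by linarith
  assume eq: "branch_value ?n T = path_value h (vol T) - loss"
  have "\<not> vol T - i + 1 < ?x - 1"
  proof
    assume "vol T - i + 1 < ?x - 1"
    then have "edge_weight ?n (vol T - i + 1) < edge_weight ?n (?x - 1)"
      using h V by (intro edge_weight_strict_mono) auto
    then show False using eq bnd unfolding loss_def by linarith
  qed
  then have x: "vol T - i + 1 = ?x - 1" using le by linarith
  then have "M = {#path_shape (?x - 2), path_shape 1#}"
    using eqM eq unfolding loss_def by simp
  moreover have "?x = vol T - i + 2" "j = i - 2" using x V i j vol_pos[of "Node M"] by linarith+
  ultimately show "T = stem (i - 2) (fork (vol T - i + 2))" unfolding T by metis
qed

text \<open>
  A branching vertex has at least three vertices below it (itself included), so any branching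
  loses at least the difference between the weights at 2 and at 1.
\<close>

lemma not_path_shape_loss:
  assumes h: "vol T \<le> h" and T: "T \<noteq> path_shape (vol T)"
  shows "branch_value (2 * h + 1) T \<le> path_value h (vol T) - (2 * int h - 2)"
proof -
  let ?n = "2 * h + 1"
  obtain j M where T': "T = stem j (Node M)" and M: "size M \<noteq> 1"
    using stem_decomposition by blast
  let ?x = "vol (Node M)"
  have "M \<noteq> {#}" using T unfolding T' path_shape_def by auto
  then have two: "2 \<le> size M" using M by (cases "size M") auto
  have "2 \<le> ?x - 1" using sum_mset_pos[OF vol_kids_pos[of M]] two by simp
  then have "edge_weight ?n 2 \<le> edge_weight ?n (?x - 1)"
    using h unfolding T' by (intro edge_weight_mono) auto
  moreover have "edge_weight ?n 2 - edge_weight ?n 1 = 2 * int h - 2"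
    by (simp add: edge_weight_def)
  ultimately show ?thesis
    using branch_value_branching_le[OF two, of j h] h unfolding T' by auto
qed

definition spider1 :: "nat \<Rightarrow> shape" where
  "spider1 h = Node {#path_shape h, path_shape (h - 1), path_shape 1#}"

definition spider2 :: "nat \<Rightarrow> shape" where
  "spider2 h = Node {#path_shape h, path_shape (h - 2), path_shape 2#}"

text \<open>
  For \<open>k\<^sup>2 = 2 * h - 1\<close>, hence odd \<open>k\<close>, the leaf at the root
  collides with the vertex at depth \<open>k\<close> of the branch of size \<open>h\<close>, so
  that branch carries the fork.
\<close>

definition forked_odd :: "nat \<Rightarrow> nat \<Rightarrow> shape" where
  "forked_odd h k = Node {#stem (k - 2) (fork (h - k + 2)), path_shape (h - 1), path_shape 1#}"

text \<open>
  For \<open>k\<^sup>2 = 2 * h\<close>, hence even \<open>k\<close>, the leaf at the root collides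
  with the vertex at depth \<open>k - 1\<close> of the branch of size \<open>h - 1\<close>, so
  that branch carries the fork.
\<close>

definition forked_even :: "nat \<Rightarrow> nat \<Rightarrow> shape" where
  "forked_even h k = Node {#path_shape h, stem (k - 3) (fork (h - k + 2)), path_shape 1#}"

lemma wien_spider1: "3 \<le> h \<Longrightarrow> wien (2 * h + 1) (spider1 h) = wmax h"
  using branch_value_path_shape[of h h] branch_value_path_shape[of "h - 1" h] branch_value_path_shape[of 1 h]
  by (simp add: spider1_def wmax_def)

lemma wmax_spider2:
  assumes "4 \<le> h"
  shows "path_value h h + path_value h (h - 2) + path_value h 2 = wmax h - (int h * int h - 3 * int h)"
proof -
  have "path_value h (h - 1) = path_value h (h - 2) + edge_weight (2 * h + 1) (h - 1)"
    using path_value_pred[of "h - 1" h] assms by (simp add: numeral_eq_Suc)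
  moreover have "path_value h 2 = path_value h 1 + edge_weight (2 * h + 1) 2"
    using path_value_pred[of 2 h] assms by simp
  moreover have "edge_weight (2 * h + 1) (h - 1) - edge_weight (2 * h + 1) 2 = int h * int h - 3 * int h"
    using assms by (simp add: edge_weight_def of_nat_diff algebra_simps)
  ultimately show ?thesis unfolding wmax_def by linarith
qed

lemma wien_spider2:
  "4 \<le> h \<Longrightarrow> wien (2 * h + 1) (spider2 h) = wmax h - (int h * int h - 3 * int h)"
  using branch_value_path_shape[of h h] branch_value_path_shape[of "h - 2" h] branch_value_path_shape[of 2 h] wmax_spider2[of h]
  by (simp add: spider2_def)

lemma fork_loss:
  assumes "1 \<le> k" "k \<le> h"
  shows "edge_weight (2 * h + 1) (h - k + 1) - edge_weight (2 * h + 1) 1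
    = int h * int h - int h + int k - int k * int k"
  using assms by (simp add: edge_weight_def of_nat_diff algebra_simps)

lemma wien_forked_odd:
  assumes "3 \<le> k" "k + 1 \<le> h"
  shows "wien (2 * h + 1) (forked_odd h k) = wmax h - (int h * int h - int h + int k - int k * int k)"
proof -
  have e: "k - 2 + (h - k + 2) = h" "h - k + 2 - 1 = h - k + 1" using assms by linarith+
  have "branch_value (2 * h + 1) (stem (k - 2) (fork (h - k + 2)))
    = path_value h h - (int h * int h - int h + int k - int k * int k)"
    using branch_value_stem_fork[of "h - k + 2" "k - 2" h, unfolded e] fork_loss[of k h] assms by simp
  then show ?thesis
    using branch_value_path_shape[of "h - 1" h] branch_value_path_shape[of 1 h] assms
    by (simp add: forked_odd_def wmax_def)
qed

lemma wien_forked_even: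
  assumes "3 \<le> k" "k + 1 \<le> h"
  shows "wien (2 * h + 1) (forked_even h k) = wmax h - (int h * int h - int h + int k - int k * int k)"
proof -
  have e: "k - 3 + (h - k + 2) = h - 1" "h - k + 2 - 1 = h - k + 1" using assms by linarith+
  have "branch_value (2 * h + 1) (stem (k - 3) (fork (h - k + 2)))
    = path_value h (h - 1) - (int h * int h - int h + int k - int k * int k)"
    using branch_value_stem_fork[of "h - k + 2" "k - 3" h, unfolded e] fork_loss[of k h] assms by simp
  then show ?thesis
    using branch_value_path_shape[of h h] branch_value_path_shape[of 1 h] assms
    by (simp add: forked_even_def wmax_def)
qed

lemma wien_three:
  "wien n (Node {#A, B, C#}) = branch_value n A + branch_value n B + branch_value n C"
  by simp

lemma sqrt_bound:
  fixes h k :: nat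
  assumes "k * k \<le> 2 * h" "5 \<le> h"
  shows "k + 2 \<le> h"
proof (rule ccontr)
  assume "\<not> k + 2 \<le> h"
  then have "h \<le> k + 1" by simp
  then have "4 \<le> k" using assms by simp
  then have "4 * k \<le> k * k" by simp
  then show False using \<open>h \<le> k + 1\<close> \<open>4 \<le> k\<close> assms by linarith
qed

text \<open>
  For \<open>k\<^sup>2 = 2 * h - 1\<close> the left-hand side is the loss of the forked shape
  against \<open>wmax\<close>, and for \<open>k\<^sup>2 = 2 * h\<close> it is one more than that
  loss. The right-hand sides are the losses in the last two cases of
  \<open>root_classification\<close>.
\<close>

lemma third_level_gap:
  assumes "k * k \<le> 2 * h" "5 \<le> h"
  shows "int h * int h - 3 * int h + 1 + int k < 2 * int h * int h - 8 * int h + 6"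
    and "6 \<le> h \<Longrightarrow> int h * int h - 3 * int h + 1 + int k < 2 * int h * int h - 8 * int h"
proof -
  have k: "int k \<le> int h - 2" using sqrt_bound[OF assms] by linarith
  show "int h * int h - 3 * int h + 1 + int k < 2 * int h * int h - 8 * int h" if "6 \<le> h"
  proof -
    have "6 * int h \<le> int h * int h" using that by simp
    then show ?thesis using k by linarith
  qed
  have "5 * int h \<le> int h * int h" using assms(2) by simp
  moreover have "int k \<le> 3" if "h = 5"
  proof (rule ccontr)
    assume "\<not> int k \<le> 3"
    then have "4 * 4 \<le> k * k" by (intro mult_mono) auto
    then show False using assms(1) that by simp
  qed
  moreover have "6 * int h \<le> int h * int h" if "h \<noteq> 5"
    using that assms(2) by simp
  ultimately show "int h * int h - 3 * int h + 1 + int k < 2 * int h * int h - 8 * int h + 6"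
    using k by (cases "h = 5") (simp, linarith)
qed

lemma ti_shape_disjoint:
  assumes "ti_shape h (Node {#A, B, C#})"
  shows "set_mset (branch_offsets (2 * h + 1) A 0) \<inter> set_mset (branch_offsets (2 * h + 1) B 0) = {}"
    "set_mset (branch_offsets (2 * h + 1) A 0) \<inter> set_mset (branch_offsets (2 * h + 1) C 0) = {}"
    "set_mset (branch_offsets (2 * h + 1) B 0) \<inter> set_mset (branch_offsets (2 * h + 1) C 0) = {}"
  using assms by (auto simp: ti_shape_def no_repeats_add_mset no_repeats_union)

lemma ti_wien_le_spider1:
  assumes ti_shape: "ti_shape h t" and h: "3 \<le> h"
  shows "wien (2 * h + 1) t \<le> wmax h"
    and "wien (2 * h + 1) t = wmax h \<Longrightarrow> t = spider1 h"
proof -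
  obtain M where t: "t = Node M" by (cases t)
  have "wien (2 * h + 1) t \<le> wmax h \<and> (wien (2 * h + 1) t = wmax h \<longrightarrow> t = spider1 h)"
    using ti_shape[unfolded t] h
  proof (cases rule: root_classification)
    case (1 A B C)
    have b: "branch_value (2 * h + 1) A \<le> path_value h h" "branch_value (2 * h + 1) B \<le> path_value h (h - 1)"
      "branch_value (2 * h + 1) C \<le> path_value h 1"
      using branch_value_le_path_value[of A h] branch_value_le_path_value[of B h] branch_value_le_path_value[of C h] 1 h by auto
    have w: "wien (2 * h + 1) t = branch_value (2 * h + 1) A + branch_value (2 * h + 1) B + branch_value (2 * h + 1) C"
      unfolding t 1(1) by (rule wien_three)
    have "t = spider1 h" if "wien (2 * h + 1) t = wmax h"
    proof -
      have "path_value h h \<le> branch_value (2 * h + 1) A" "path_value h (h - 1) \<le> branch_value (2 * h + 1) B"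
        "path_value h 1 \<le> branch_value (2 * h + 1) C"
        using b w that unfolding wmax_def by linarith+
      then have "A = path_shape h" "B = path_shape (h - 1)" "C = path_shape 1"
        using path_shape_if_max[of A h] path_shape_if_max[of B h] path_shape_if_max[of C h] 1 h by auto
      then show ?thesis unfolding t 1(1) spider1_def by simp
    qed
    then show ?thesis using b w unfolding wmax_def by linarith
  next
    case (2 A B C)
    have b: "branch_value (2 * h + 1) A \<le> path_value h h" "branch_value (2 * h + 1) B \<le> path_value h (h - 2)"
      "branch_value (2 * h + 1) C \<le> path_value h 2"
      using branch_value_le_path_value[of A h] branch_value_le_path_value[of B h] branch_value_le_path_value[of C h] 2 h by auto
    have w: "wien (2 * h + 1) t = branch_value (2 * h + 1) A + branch_value (2 * h + 1) B + branch_value (2 * h + 1) C"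
      unfolding t 2(1) by (rule wien_three)
    have "4 * int h \<le> int h * int h" using 2 by simp
    then show ?thesis using b w wmax_spider2[OF 2(2)] 2(2) by linarith
  next
    case 3
    have "6 * int h \<le> int h * int h" using 3 by simp
    then have "wien (2 * h + 1) t < wmax h" using 3 h unfolding t by linarith
    then show ?thesis by simp
  next
    case 4
    have "4 * int h \<le> int h * int h" using 4 by simp
    then have "wien (2 * h + 1) t < wmax h" using 4 h unfolding t by linarith
    then show ?thesis by simp
  qed
  then show "wien (2 * h + 1) t \<le> wmax h" "wien (2 * h + 1) t = wmax h \<Longrightarrow> t = spider1 h"
    by auto
qed

text \<open>
  The leaf has offset \<open>2 * h - 1\<close>. If this is \<open>k\<^sup>2\<close>, it equals the
  path offset at depth \<open>k\<close> of the branch of size \<open>h\<close>; if it is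
  \<open>k\<^sup>2 - 1\<close>, it equals the path offset at depth \<open>k - 1\<close> of the
  branch of size \<open>h - 1\<close>. So \<open>early_branching\<close> applies to one of the two
  branches.
\<close>

lemma long_pair_wien_le:
  assumes ti_shape: "ti_shape h (Node {#A, B, C#})" and vols: "vol A = h" "vol B = h - 1" "vol C = 1"
    and h: "5 \<le> h" and k: "k * k = 2 * h - 1 \<or> k * k = 2 * h"
  defines "t \<equiv> Node {#A, B, C#}"
  shows "wien (2 * h + 1) t \<le> wmax h - (int h * int h - int h + int k - int k * int k)"
    and "wien (2 * h + 1) t = wmax h - (int h * int h - int h + int k - int k * int k)
      \<Longrightarrow> t = (if k * k = 2 * h then forked_even h k else forked_odd h k)"
proof -
  let ?n = "2 * h + 1" and ?L = "int h * int h - int h + int k - int k * int k"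
  have kh: "k + 2 \<le> h" using sqrt_bound[of k h] k h by auto
  have k3: "3 \<le> k"
  proof (rule ccontr)
    assume "\<not> 3 \<le> k"
    then have "k * k \<le> 2 * 2" by (intro mult_mono) auto
    then show False using k h by linarith
  qed
  have b: "branch_value ?n A \<le> path_value h h" "branch_value ?n B \<le> path_value h (h - 1)" "branch_value ?n C \<le> path_value h 1"
    using branch_value_le_path_value[of A h] branch_value_le_path_value[of B h] branch_value_le_path_value[of C h] vols h by auto
  have w: "wien ?n t = branch_value ?n A + branch_value ?n B + branch_value ?n C"
    unfolding t_def by (rule wien_three)
  have C: "2 * int h - 1 \<in># branch_offsets ?n C 0"
    using offset_root[of "2 * int h - 1" ?n C] vols by (simp add: algebra_simps)
  have "wien ?n t \<le> wmax h - ?L \<and> (wien ?n t = wmax h - ?L \<longrightarrow>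
      t = (if k * k = 2 * h then forked_even h k else forked_odd h k))"
  proof (cases "k * k = 2 * h")
    case True
    then have "int (k * k) = int (2 * h)" by simp
    then have ik: "int k * int k = 2 * int h" by simp
    let ?i = "k - 1"
    have "int ?i * (int ?n - 2 * int (vol B)) + int ?i * (int ?i - 1) = 2 * int h - 1"
      using ik k3 kh vols by (simp add: of_nat_diff algebra_simps)
    then have free: "int ?i * (int ?n - 2 * int (vol B)) + int ?i * (int ?i - 1) \<notin># branch_offsets ?n B 0"
      using ti_shape_disjoint(3)[OF ti_shape] C by auto
    have args: "vol B - ?i + 1 = h - k + 1" "vol B - ?i + 2 = h - k + 2" "?i - 2 = k - 3"
      using vols k3 kh by auto
    have "branch_value ?n B \<le> path_value h (h - 1) - ?L \<and>
        (branch_value ?n B = path_value h (h - 1) - ?L \<longrightarrow> B = stem (k - 3) (fork (h - k + 2)))"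
      using early_branching[of B h ?i ?n] free fork_loss[of k h] kh k3 vols
      unfolding args by simp
    then have B: "branch_value ?n B \<le> path_value h (h - 1) - ?L"
      and B': "branch_value ?n B = path_value h (h - 1) - ?L \<Longrightarrow> B = stem (k - 3) (fork (h - k + 2))"
      by auto
    have "t = forked_even h k" if "wien ?n t = wmax h - ?L"
    proof -
      have "path_value h h \<le> branch_value ?n A" "branch_value ?n B = path_value h (h - 1) - ?L" "path_value h 1 \<le> branch_value ?n C"
        using b B w that unfolding wmax_def by linarith+
      then have "A = path_shape h" "B = stem (k - 3) (fork (h - k + 2))" "C = path_shape 1"
        using path_shape_if_max[of A h] B' path_shape_if_max[of C h] vols h by auto
      then show ?thesis unfolding t_def forked_even_def by simp
    qed
    then show ?thesis using b B w True unfolding wmax_def by auto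
  next
    case False
    then have kk: "k * k + 1 = 2 * h" using k h by auto
    then have "int (k * k + 1) = int (2 * h)" by simp
    then have ik: "int k * int k = 2 * int h - 1" by simp
    have "int k * (int ?n - 2 * int (vol A)) + int k * (int k - 1) = 2 * int h - 1"
      using ik vols by (simp add: algebra_simps)
    then have free: "int k * (int ?n - 2 * int (vol A)) + int k * (int k - 1) \<notin># branch_offsets ?n A 0"
      using ti_shape_disjoint(2)[OF ti_shape] C by auto
    have args: "vol A - k + 1 = h - k + 1" "vol A - k + 2 = h - k + 2"
      using vols k3 kh by auto
    have "branch_value ?n A \<le> path_value h h - ?L \<and>
        (branch_value ?n A = path_value h h - ?L \<longrightarrow> A = stem (k - 2) (fork (h - k + 2)))"
      using early_branching[of A h k ?n] free fork_loss[of k h] kh k3 vols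
      unfolding args by simp
    then have A: "branch_value ?n A \<le> path_value h h - ?L"
      and A': "branch_value ?n A = path_value h h - ?L \<Longrightarrow> A = stem (k - 2) (fork (h - k + 2))"
      by auto
    have "t = forked_odd h k" if "wien ?n t = wmax h - ?L"
    proof -
      have "branch_value ?n A = path_value h h - ?L" "path_value h (h - 1) \<le> branch_value ?n B" "path_value h 1 \<le> branch_value ?n C"
        using b A w that unfolding wmax_def by linarith+
      then have "A = stem (k - 2) (fork (h - k + 2))" "B = path_shape (h - 1)" "C = path_shape 1"
        using path_shape_if_max[of B h] A' path_shape_if_max[of C h] vols h by auto
      then show ?thesis unfolding t_def forked_odd_def by simp
    qed
    then show ?thesis using b A w False unfolding wmax_def by auto
  qed
  then show "wien ?n t \<le> wmax h - ?L"
    "wien ?n t = wmax h - ?L \<Longrightarrow> t = (if k * k = 2 * h then forked_even h k else forked_odd h k)"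
    by auto
qed

text \<open>
  If \<open>2 * h - 1\<close> or \<open>2 * h\<close> is a square, the loss forced on branch sizes
  \<open>h, h - 1, 1\<close> exceeds the loss \<open>h\<^sup>2 - 3 * h\<close> of the sizes
  \<open>h, h - 2, 2\<close>, by \<open>k + 1\<close> or \<open>k\<close>.
\<close>

lemma ti_wien_le_spider2:
  assumes ti_shape: "ti_shape h t" and h: "5 \<le> h" and k: "k * k = 2 * h - 1 \<or> k * k = 2 * h"
  defines "W2 \<equiv> wmax h - (int h * int h - 3 * int h)"
  shows "wien (2 * h + 1) t \<le> W2"
    and "wien (2 * h + 1) t = W2 \<Longrightarrow> t = spider2 h"
proof -
  let ?n = "2 * h + 1"
  obtain M where t: "t = Node M" by (cases t)
  have k': "k * k \<le> 2 * h" using k by auto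
  have "int (k * k) \<le> int (2 * h)" using k' by (simp only: of_nat_le_iff)
  then have ik: "int k * int k \<le> 2 * int h" by simp
  have k1: "1 \<le> k" using k h by (cases k) auto
  note gap = third_level_gap[OF k' h]
  have h3: "3 \<le> h" using h by simp
  have "wien ?n t \<le> W2 \<and> (wien ?n t = W2 \<longrightarrow> t = spider2 h)"
    using ti_shape[unfolded t] h3
  proof (cases rule: root_classification)
    case (1 A B C)
    then show ?thesis
      using long_pair_wien_le(1)[of h A B C k] ti_shape h k ik k1 unfolding t W2_def by auto
  next
    case (2 A B C)
    have b: "branch_value ?n A \<le> path_value h h" "branch_value ?n B \<le> path_value h (h - 2)" "branch_value ?n C \<le> path_value h 2"
      using branch_value_le_path_value[of A h] branch_value_le_path_value[of B h] branch_value_le_path_value[of C h] 2 h by auto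
    have w: "wien ?n t = branch_value ?n A + branch_value ?n B + branch_value ?n C"
      unfolding t 2(1) by (rule wien_three)
    have "t = spider2 h" if "wien ?n t = W2"
    proof -
      have "path_value h h \<le> branch_value ?n A" "path_value h (h - 2) \<le> branch_value ?n B" "path_value h 2 \<le> branch_value ?n C"
        using b w that wmax_spider2[OF 2(2)] unfolding W2_def by linarith+
      then have "A = path_shape h" "B = path_shape (h - 2)" "C = path_shape 2"
        using path_shape_if_max[of A h] path_shape_if_max[of B h] path_shape_if_max[of C h] 2 h by auto
      then show ?thesis unfolding t 2(1) spider2_def by simp
    qed
    then show ?thesis using b w wmax_spider2[OF 2(2)] unfolding W2_def by auto
  next
    case 3
    then show ?thesis using gap unfolding t W2_def by auto
  next
    case 4
    then show ?thesis using gap unfolding t W2_def by auto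
  qed
  then show "wien ?n t \<le> W2" "wien ?n t = W2 \<Longrightarrow> t = spider2 h" by auto
qed

text \<open>
  With legs \<open>h, h - 2, 2\<close> the far vertex of the short leg has offset \<open>4 * h -
  4\<close>. It collides with depth \<open>q\<close> of the leg of length \<open>h\<close> if
  \<open>4 * h - 4 = q\<^sup>2\<close>, and with depth \<open>q - 2\<close> of the leg of length
  \<open>h - 2\<close> if \<open>4 * h = q\<^sup>2\<close>. Hence one of these branches is not a
  path, which costs at least \<open>2 * h - 2\<close> more, and this is worse than the forked
  shapes.
\<close>

lemma ti_wien_le_forked:
  assumes ti_shape: "ti_shape h t" and h: "5 \<le> h" and k: "k * k = 2 * h - 1 \<or> k * k = 2 * h"
    and q: "q * q = 4 * h - 4 \<or> q * q = 4 * h"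
  defines "W3 \<equiv> wmax h - (int h * int h - int h + int k - int k * int k)"
  shows "wien (2 * h + 1) t \<le> W3"
    and "wien (2 * h + 1) t = W3 \<Longrightarrow> t = (if k * k = 2 * h then forked_even h k else forked_odd h k)"
proof -
  let ?n = "2 * h + 1"
  obtain M where t: "t = Node M" by (cases t)
  have k': "k * k \<le> 2 * h" using k by auto
  have "2 * h \<le> k * k + 1" using k by auto
  then have "int (2 * h) \<le> int (k * k + 1)" by (simp only: of_nat_le_iff)
  then have ik: "2 * int h \<le> int k * int k + 1" by simp
  have kh: "k + 2 \<le> h" using sqrt_bound[OF k' h] .
  note gap = third_level_gap[OF k' h]
  have h3: "3 \<le> h" using h by simp
  have "wien ?n t \<le> W3 \<and>
      (wien ?n t = W3 \<longrightarrow> t = (if k * k = 2 * h then forked_even h k else forked_odd h k))"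
    using ti_shape[unfolded t] h3
  proof (cases rule: root_classification)
    case (1 A B C)
    then show ?thesis
      using long_pair_wien_le[of h A B C k] ti_shape h k unfolding t W3_def by auto
  next
    case (2 A B C)
    have b: "branch_value ?n A \<le> path_value h h" "branch_value ?n B \<le> path_value h (h - 2)" "branch_value ?n C \<le> path_value h 2"
      using branch_value_le_path_value[of A h] branch_value_le_path_value[of B h] branch_value_le_path_value[of C h] 2 h by auto
    have w: "wien ?n t = branch_value ?n A + branch_value ?n B + branch_value ?n C"
      unfolding t 2(1) by (rule wien_three)
    have "\<not> (A = path_shape h \<and> B = path_shape (h - 2) \<and> C = path_shape 2)"
    proof
      assume ABC: "A = path_shape h \<and> B = path_shape (h - 2) \<and> C = path_shape 2"
      have qh: "q \<le> h"
      proof (rule ccontr)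
        assume "\<not> q \<le> h"
        then have "Suc h * Suc h \<le> q * q" by (intro mult_mono) auto
        moreover have "Suc h * Suc h = h * h + 2 * h + 1" "5 * h \<le> h * h" using h by simp_all
        ultimately show False using q h by linarith
      qed
      have q3: "3 \<le> q"
      proof (rule ccontr)
        assume "\<not> 3 \<le> q"
        then have "q * q \<le> 2 * 2" by (intro mult_mono) auto
        then show False using q h by linarith
      qed
      have C4: "4 * int h - 4 \<in># branch_offsets ?n C 0"
        using path_shape_offset[of 2 2 0 ?n] vol_path_shape[of 2] ABC by (simp add: algebra_simps)
      from q show False
      proof
        assume "q * q = 4 * h - 4"
        then have "int (q * q + 4) = int (4 * h)" using h by simp
        then have iq: "int q * int q = 4 * int h - 4" by simp
        have "int q * (int ?n - 2 * int h) + int q * (int q - 1) \<in># branch_offsets ?n A 0"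
          using path_shape_offset[of q h 0 ?n] vol_path_shape[of h] ABC q3 qh h by simp
        moreover have "int q * (int ?n - 2 * int h) + int q * (int q - 1) = 4 * int h - 4"
          using iq by (simp add: algebra_simps)
        ultimately show False using ti_shape_disjoint(2)[of h A B C] ti_shape C4 unfolding t 2(1) by auto
      next
        assume "q * q = 4 * h"
        then have "int (q * q) = int (4 * h)" by simp
        then have iq: "int q * int q = 4 * int h" by simp
        let ?i = "q - 2"
        have "int ?i * (int ?n - 2 * int (h - 2)) + int ?i * (int ?i - 1) \<in># branch_offsets ?n B 0"
          using path_shape_offset[of ?i "h - 2" 0 ?n] vol_path_shape[of "h - 2"] ABC q3 qh h by simp
        moreover have "int ?i * (int ?n - 2 * int (h - 2)) + int ?i * (int ?i - 1) = 4 * int h - 4"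
          using iq q3 h by (simp add: of_nat_diff algebra_simps)
        ultimately show False using ti_shape_disjoint(3)[of h A B C] ti_shape C4 unfolding t 2(1) by auto
      qed
    qed
    then have "branch_value ?n A \<le> path_value h h - (2 * int h - 2) \<or> branch_value ?n B \<le> path_value h (h - 2) - (2 * int h - 2)
        \<or> branch_value ?n C \<le> path_value h 2 - (2 * int h - 2)"
      using not_path_shape_loss[of A h] not_path_shape_loss[of B h] not_path_shape_loss[of C h] 2 h
      by auto
    then have "wien ?n t \<le> wmax h - (int h * int h - 3 * int h) - (2 * int h - 2)"
      using b w wmax_spider2[OF 2(2)] by auto
    then have "wien ?n t < W3" using ik kh unfolding W3_def by linarith
    then show ?thesis by simp
  next
    case 3
    then have "wien ?n t < W3" using gap ik unfolding t W3_def by linarith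
    then show ?thesis by simp
  next
    case 4
    then have "wien ?n t < W3" using gap ik unfolding t W3_def by linarith
    then show ?thesis by simp
  qed
  then show "wien ?n t \<le> W3"
    "wien ?n t = W3 \<Longrightarrow> t = (if k * k = 2 * h then forked_even h k else forked_odd h k)" by auto
qed

section \<open>The extremal shapes are transmission irregular\<close>

lemma square_gap:
  fixes a b :: int
  assumes "0 \<le> a" "0 \<le> b" "a\<^sup>2 < b\<^sup>2"
  shows "a\<^sup>2 + 2 * a + 1 \<le> b\<^sup>2"
proof -
  have "a < b" using assms power_less_imp_less_base by blast
  then have "(a + 1)\<^sup>2 \<le> b\<^sup>2" using assms by (intro power_mono) auto
  then show ?thesis by (simp add: power2_eq_square algebra_simps)
qed

lemma square_mod_4: "(a :: int)\<^sup>2 mod 4 = 0 \<or> a\<^sup>2 mod 4 = 1"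
proof (cases "even a")
  case True
  then obtain b where "a = 2 * b" by blast
  then have "a\<^sup>2 = 4 * b\<^sup>2" by (simp add: power2_eq_square)
  then show ?thesis by simp
next
  case False
  then obtain b where "a = 2 * b + 1" by (elim oddE)
  then have "a\<^sup>2 = 4 * (b\<^sup>2 + b) + 1" by (simp add: power2_eq_square algebra_simps)
  then show ?thesis by presburger
qed

text \<open>
  On a path of size \<open>h - e\<close> the increments are \<open>2 * e + 1, 2 * e + 3,
  \<dots>\<close>, so the offsets are differences of squares.
\<close>

lemma path_shape_offsets:
  assumes "e < h"
  shows "branch_offsets (2 * h + 1) (path_shape (h - e)) 0
    = image_mset (\<lambda>i. (int i + int e)\<^sup>2 - (int e)\<^sup>2) (mset_set {1..h - e})"
proof -
  have "0 + int i * (int (2 * h + 1) - 2 * int (h - e)) + int i * (int i - 1)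
      = (int i + int e)\<^sup>2 - (int e)\<^sup>2" for i
    using assms by (simp add: of_nat_diff power2_eq_square algebra_simps)
  then show ?thesis using branch_offsets_path_shape[of "h - e" "2 * h + 1" 0] assms by simp
qed

lemma no_repeats_squares:
  "no_repeats (image_mset (\<lambda>i. (int i + int e)\<^sup>2 + c) (mset_set S))" if "finite S"
proof -
  have "inj_on (\<lambda>i. (int i + int e)\<^sup>2 + c) S"
    by (intro inj_onI) (auto simp: power2_eq_iff)
  then show ?thesis using no_repeats_image_mset_set[OF that] by blast
qed

lemma no_repeats_squares':
  "no_repeats (image_mset (\<lambda>i. (int i + int e)\<^sup>2 - c) (mset_set S))" if "finite S"
  using no_repeats_squares[OF that, of e "- c"] by simp

lemma squares_pos:
  assumes "x \<in># image_mset (\<lambda>i. (int i + int e)\<^sup>2 - (int e)\<^sup>2) (mset_set {1..s})"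
  shows "0 < x"
proof -
  obtain i where i: "1 \<le> i" "x = (int i + int e)\<^sup>2 - (int e)\<^sup>2" using assms by auto
  have "(int e)\<^sup>2 < (int i + int e)\<^sup>2" using i(1) by (intro power_strict_mono) auto
  then show ?thesis using i(2) by simp
qed

lemma ti_shape_threeI:
  assumes "vol A + vol B + vol C = 2 * h" "vol A \<le> h" "vol B \<le> h" "vol C \<le> h"
    and "no_repeats (branch_offsets (2 * h + 1) A 0)" "no_repeats (branch_offsets (2 * h + 1) B 0)" "no_repeats (branch_offsets (2 * h + 1) C 0)"
    and "set_mset (branch_offsets (2 * h + 1) A 0) \<inter> set_mset (branch_offsets (2 * h + 1) B 0) = {}" "set_mset (branch_offsets (2 * h + 1) A 0) \<inter> set_mset (branch_offsets (2 * h + 1) C 0) = {}"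
      "set_mset (branch_offsets (2 * h + 1) B 0) \<inter> set_mset (branch_offsets (2 * h + 1) C 0) = {}"
    and "0 \<notin># branch_offsets (2 * h + 1) A 0" "0 \<notin># branch_offsets (2 * h + 1) B 0" "0 \<notin># branch_offsets (2 * h + 1) C 0"
  shows "ti_shape h (Node {#A, B, C#})"
proof -
  have "offsets (2 * h + 1) (Node {#A, B, C#}) 0 = add_mset 0
      (branch_offsets (2 * h + 1) A 0 + branch_offsets (2 * h + 1) B 0 + branch_offsets (2 * h + 1) C 0)"
    by simp
  then have "no_repeats (offsets (2 * h + 1) (Node {#A, B, C#}) 0)"
    using assms(5-) by (simp add: no_repeats_add_mset no_repeats_union Int_Un_distrib Int_Un_distrib2)
  then show ?thesis using assms(1-4) by (simp add: ti_shape_def)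
qed

text \<open>
  Squares against squares minus 1 never collide, so the only possible collisions are with the
  leaf, at offset \<open>2 * h - 1\<close>.
\<close>

lemma ti_shape_spider1:
  assumes h: "3 \<le> h"
    and ns: "\<And>q. (int q)\<^sup>2 \<noteq> 2 * int h - 1" "\<And>q. (int q)\<^sup>2 \<noteq> 2 * int h"
  shows "ti_shape h (spider1 h)"
proof -
  let ?n = "2 * h + 1"
  let ?A = "branch_offsets ?n (path_shape h) 0" and ?B = "branch_offsets ?n (path_shape (h - 1)) 0"
  let ?C = "branch_offsets ?n (path_shape 1) 0"
  have v: "vol (path_shape h) = h" "vol (path_shape (h - 1)) = h - 1"
    using h by (simp_all add: vol_path_shape)
  have A: "?A = image_mset (\<lambda>i. (int i + int 0)\<^sup>2 - (int 0)\<^sup>2) (mset_set {1..h})"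
    using path_shape_offsets[of 0 h] h by simp
  have B: "?B = image_mset (\<lambda>i. (int i + int 1)\<^sup>2 - (int 1)\<^sup>2) (mset_set {1..h - 1})"
    using path_shape_offsets[of 1 h] h by simp
  have C: "?C = {#2 * int h - 1#}" by simp
  have u: "no_repeats ?A" "no_repeats ?B" unfolding A B by (intro no_repeats_squares' finite_atLeastAtMost)+
  have AB: "set_mset ?A \<inter> set_mset ?B = {}"
  proof -
    have False if "1 \<le> i" "(int i)\<^sup>2 = (int j + 1)\<^sup>2 - 1" for i j
      using square_gap[of "int i" "int j + 1"] that by linarith
    then show ?thesis unfolding A B by fastforce
  qed
  have AC: "set_mset ?A \<inter> set_mset ?C = {}"
  proof -
    have False if "(int i)\<^sup>2 = 2 * int h - 1" for i
      using ns(1) that by blast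
    then show ?thesis unfolding A C by fastforce
  qed
  have BC: "set_mset ?B \<inter> set_mset ?C = {}"
  proof -
    have False if "(int j + 1)\<^sup>2 - 1 = 2 * int h - 1" for j
      using ns(2)[of "j + 1"] that by (simp add: add.commute)
    then show ?thesis unfolding B C by fastforce
  qed
  have z: "0 \<notin># ?A" "0 \<notin># ?B"
    unfolding A B using squares_pos less_irrefl by blast+
  have zC: "0 \<notin># ?C" unfolding C using h by simp
  have uC: "no_repeats ?C" unfolding C by simp
  show ?thesis unfolding spider1_def
    by (rule ti_shape_threeI) (use u uC AB AC BC z zC v h in simp_all)
qed

text \<open>
  The near vertex of the short leg causes no collision because \<open>2 * h - 3\<close> and
  \<open>2 * h + 1\<close> are too close to the square \<open>k\<^sup>2\<close> to be squares
  themselves. So only its far vertex, at offset \<open>4 * h - 4\<close>, matters.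
\<close>

lemma ti_shape_spider2:
  assumes h: "5 \<le> h" and k: "(int k)\<^sup>2 = 2 * int h - 1 \<or> (int k)\<^sup>2 = 2 * int h"
    and ns: "\<And>q. (int q)\<^sup>2 \<noteq> 4 * int h - 4" "\<And>q. (int q)\<^sup>2 \<noteq> 4 * int h"
  shows "ti_shape h (spider2 h)"
proof -
  let ?n = "2 * h + 1"
  let ?A = "branch_offsets ?n (path_shape h) 0" and ?B = "branch_offsets ?n (path_shape (h - 2)) 0"
  let ?C = "branch_offsets ?n (path_shape 2) 0"
  have v: "vol (path_shape h) = h" "vol (path_shape (h - 2)) = h - 2" "vol (path_shape 2) = 2"
    using h by (simp_all add: vol_path_shape)
  have A: "?A = image_mset (\<lambda>i. (int i + int 0)\<^sup>2 - (int 0)\<^sup>2) (mset_set {1..h})"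
    using path_shape_offsets[of 0 h] h by simp
  have B: "?B = image_mset (\<lambda>i. (int i + int 2)\<^sup>2 - (int 2)\<^sup>2) (mset_set {1..h - 2})"
    using path_shape_offsets[of 2 h] h by simp
  have C: "?C = {#2 * int h - 3, 4 * int h - 4#}"
    using path_shape_Suc[of 1] by (simp add: numeral_2_eq_2)
  have u: "no_repeats ?A" "no_repeats ?B" unfolding A B by (intro no_repeats_squares' finite_atLeastAtMost)+
  have "2 \<le> k"
  proof (rule ccontr)
    assume "\<not> 2 \<le> k"
    then have "k = 0 \<or> k = 1" by auto
    then show False using k h by auto
  qed
  have AB: "set_mset ?A \<inter> set_mset ?B = {}"
  proof -
    have False if "1 \<le> i" "1 \<le> j" "(int i)\<^sup>2 = (int j + 2)\<^sup>2 - 4" for i j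
    proof -
      have g: "(int i)\<^sup>2 + 2 * int i + 1 \<le> (int j + 2)\<^sup>2"
        using square_gap[of "int i" "int j + 2"] that by linarith
      then have "i = 1" using that by linarith
      then have "(int j + 2)\<^sup>2 mod 4 = 5 mod 4" using that by simp
      moreover have "(int j + 2)\<^sup>2 = 5" using that \<open>i = 1\<close> by simp
      moreover have "9 \<le> (int j + 2)\<^sup>2"
        using power_mono[of 3 "int j + 2" 2] that by simp
      ultimately show False by linarith
    qed
    then show ?thesis unfolding A B by fastforce
  qed
  have AC: "set_mset ?A \<inter> set_mset ?C = {}"
  proof -
    have False if "(int i)\<^sup>2 = 2 * int h - 3" "1 \<le> i" for i
    proof -
      have "(int i)\<^sup>2 + 2 * int i + 1 \<le> (int k)\<^sup>2"
        using square_gap[of "int i" "int k"] that k by linarith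
      then have "i = 1" using that k by linarith
      then show False using that h by simp
    qed
    moreover have False if "(int i)\<^sup>2 = 4 * int h - 4" for i
      using ns(1) that by blast
    ultimately show ?thesis unfolding A C by fastforce
  qed
  have BC: "set_mset ?B \<inter> set_mset ?C = {}"
  proof -
    have False if "(int j + 2)\<^sup>2 - 4 = 2 * int h - 3" for j
      using square_gap[of "int k" "int j + 2"] that k \<open>2 \<le> k\<close> by linarith
    moreover have False if "(int j + 2)\<^sup>2 - 4 = 4 * int h - 4" for j
      using ns(2)[of "j + 2"] that by (simp add: add.commute)
    ultimately show ?thesis unfolding B C by fastforce
  qed
  have z: "0 \<notin># ?A" "0 \<notin># ?B"
    unfolding A B using squares_pos less_irrefl by blast+
  have zC: "0 \<notin># ?C" unfolding C using h by simp
  have uC: "no_repeats ?C" unfolding C using h by (simp add: no_repeats_add_mset)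
  show ?thesis unfolding spider2_def
    by (rule ti_shape_threeI) (use u uC AB AC BC z zC v h in simp_all)
qed

text \<open>
  Above the fork the branch has the offsets of a path. The fork itself has offset \<open>(k -
  1)\<^sup>2 - e\<^sup>2\<close>; below it every subtree is one smaller than on the unforked path,
  which shifts the remaining squares to \<open>a\<^sup>2 - 2 * k + 1 - e\<^sup>2\<close> with
  \<open>a > k\<close>.
\<close>

lemma fork_branch_offsets:
  assumes "3 \<le> k" "k < h" "e \<le> 1"
  shows "branch_offsets (2 * h + 1) (stem (k - 2 - e) (fork (h - k + 2))) 0
    = image_mset (\<lambda>i. (int i + int e)\<^sup>2 - (int e)\<^sup>2) (mset_set {1..k - 2 - e})
      + add_mset ((int k - 1)\<^sup>2 - (int e)\<^sup>2)
        (image_mset (\<lambda>i. (int i + int k)\<^sup>2 - (2 * int k - 1 + (int e)\<^sup>2)) (mset_set {1..h - k})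
         + {#(int k - 1)\<^sup>2 - (int e)\<^sup>2 + 2 * int h - 1#})"
proof -
  let ?n = "2 * h + 1" and ?x = "h - k + 2" and ?j = "k - 2 - e"
  let ?b = "(int k - 1)\<^sup>2 - (int e)\<^sup>2"
  have v: "vol (fork ?x) = ?x" using vol_path_shape[of "h - k"] assms by simp
  have f1: "0 + int i * (int ?n - 2 * int (?j + vol (fork ?x))) + int i * (int i - 1)
      = (int i + int e)\<^sup>2 - (int e)\<^sup>2" for i
    unfolding v using assms by (simp add: of_nat_diff power2_eq_square algebra_simps)
  have b: "(int ?j + int e)\<^sup>2 - (int e)\<^sup>2 + int ?n - 2 * int (vol (fork ?x)) = ?b"
    unfolding v using assms by (simp add: of_nat_diff power2_eq_square algebra_simps)
  have f2: "?b + int i * (int ?n - 2 * int (h - k)) + int i * (int i - 1)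
      = (int i + int k)\<^sup>2 - (2 * int k - 1 + (int e)\<^sup>2)" for i
    using assms by (simp add: of_nat_diff power2_eq_square algebra_simps)
  have p: "branch_offsets ?n (path_shape (h - k)) ?b
      = image_mset (\<lambda>i. (int i + int k)\<^sup>2 - (2 * int k - 1 + (int e)\<^sup>2)) (mset_set {1..h - k})"
    using branch_offsets_path_shape[of "h - k" ?n ?b] assms unfolding f2 by simp
  have "offsets ?n (fork ?x) ?b
      = add_mset ?b (branch_offsets ?n (path_shape (h - k)) ?b + {#?b + 2 * int h - 1#})"
    using assms by simp
  then show ?thesis
    unfolding branch_offsets_stem f1 b p by simp
qed

text \<open>
  Both forked shapes at once: \<open>e = 0\<close> puts the fork on the branch of size
  \<open>h\<close> and \<open>e = 1\<close> on that of size \<open>h - 1\<close>. In both cases it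
  sits at depth \<open>k - 1 - e\<close>. All offsets except that of the new leaf lie near
  squares, and consecutive squares are too far apart for a collision. The new leaf is handled
  modulo 4, using that \<open>k\<close> is odd for \<open>e = 0\<close> and even for \<open>e =
  1\<close>.
\<close>

lemma ti_shape_fork:
  assumes h: "5 \<le> h" and e: "e = 0 \<or> e = 1" and k: "(int k)\<^sup>2 = 2 * int h - 1 + int e"
  shows "ti_shape h (Node {#stem (k - 2 - e) (fork (h - k + 2)), path_shape (h - (1 - e)), path_shape 1#})"
proof -
  let ?n = "2 * h + 1"
  have kk: "int (k * k) = 2 * int h - 1 + int e" using k by (simp add: power2_eq_square)
  have kh: "k + 2 \<le> h" using sqrt_bound[of k h] kk h e by linarith
  have k3: "3 \<le> k"
  proof (rule ccontr)
    assume "\<not> 3 \<le> k"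
    then have "k * k \<le> 2 * 2" by (intro mult_mono) auto
    then show False using kk h by linarith
  qed
  have par: "k mod 2 = 1 - e"
  proof -
    have "int ((k * k) mod 2) = (2 * int h - 1 + int e) mod 2" unfolding zmod_int kk by simp
    then have "int ((k * k) mod 2) = int (1 - e)" using e by (auto simp: mod_simps; presburger)
    then have "(k * k) mod 2 = 1 - e" by simp
    then show ?thesis using e by (metis mod_mult_self1_is_0 even_mult_iff odd_iff_mod_2_eq_one even_iff_mod_2_eq_zero diff_zero diff_self_eq_0)
  qed
  let ?A = "branch_offsets ?n (stem (k - 2 - e) (fork (h - k + 2))) 0"
  let ?B = "branch_offsets ?n (path_shape (h - (1 - e))) 0" and ?C = "branch_offsets ?n (path_shape 1) 0"
  let ?A1 = "image_mset (\<lambda>i. (int i + int e)\<^sup>2 - (int e)\<^sup>2) (mset_set {1..k - 2 - e})"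
  let ?b = "(int k - 1)\<^sup>2 - (int e)\<^sup>2"
  let ?A2 = "image_mset (\<lambda>i. (int i + int k)\<^sup>2 - (2 * int k - 1 + (int e)\<^sup>2)) (mset_set {1..h - k})"
  have A: "?A = ?A1 + add_mset ?b (?A2 + {#?b + 2 * int h - 1#})"
    by (rule fork_branch_offsets) (use k3 kh e in auto)
  have B: "?B = image_mset (\<lambda>i. (int i + int (1 - e))\<^sup>2 - (int (1 - e))\<^sup>2) (mset_set {1..h - (1 - e)})"
    using path_shape_offsets[of "1 - e" h] h by simp
  have C: "?C = {#2 * int h - 1#}" by simp
  have k2: "(int k - 1)\<^sup>2 = (int k)\<^sup>2 - 2 * int k + 1" "(int k + 1)\<^sup>2 = (int k)\<^sup>2 + 2 * int k + 1"
    by (simp_all add: power2_eq_square algebra_simps)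
  have e2: "(int e)\<^sup>2 = int e" "(int (1 - e))\<^sup>2 = 1 - int e" using e by auto
  have A1: "\<exists>c. 1 + int e \<le> c \<and> c \<le> int k - 2 \<and> x = c\<^sup>2 - int e" if x: "x \<in># ?A1" for x
  proof -
    obtain i where "1 \<le> i" "i \<le> k - 2 - e" "x = (int i + int e)\<^sup>2 - int e"
      using x unfolding e2 by auto
    then show ?thesis using e k3 by (intro exI[of _ "int i + int e"]) auto
  qed
  have A2: "\<exists>c. int k + 1 \<le> c \<and> x = c\<^sup>2 - 2 * int k + 1 - int e" if x: "x \<in># ?A2" for x
  proof -
    obtain i where "1 \<le> i" "x = (int i + int k)\<^sup>2 - (2 * int k - 1 + int e)"
      using x unfolding e2 by auto
    then show ?thesis by (intro exI[of _ "int i + int k"]) auto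
  qed
  have Bm: "\<exists>c. 2 - int e \<le> c \<and> x = c\<^sup>2 - (1 - int e)" if x: "x \<in># ?B" for x
  proof -
    obtain i where "1 \<le> i" "x = (int i + int (1 - e))\<^sup>2 - (1 - int e)"
      using x unfolding B e2 by auto
    then show ?thesis using e by (intro exI[of _ "int i + int (1 - e)"]) auto
  qed
  have small: "c\<^sup>2 \<le> (int k - 2)\<^sup>2" "(int k - 2)\<^sup>2 < (int k - 1)\<^sup>2" if "0 \<le> c" "c \<le> int k - 2" for c
    using that k3 by (auto intro!: power_mono power_strict_mono)
  have big: "(int k + 1)\<^sup>2 \<le> c\<^sup>2" if "int k + 1 \<le> c" for c
    using that by (intro power_mono) auto
  \<comment> \<open>The two equations that would make the new leaf collide with the lower part of its own branch
    or with the other long branch; modulo 4 the right-hand sides are 2 or 3.\<close>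
  have two_squares: "(a::int)\<^sup>2 \<noteq> (int k)\<^sup>2 + 2 * int h - 1"
    "(a::int)\<^sup>2 \<noteq> (int k - 1)\<^sup>2 + 2 * int h - 2 * int e" for a
  proof -
    have not_23: "a\<^sup>2 \<noteq> 4 * c + 2" "a\<^sup>2 \<noteq> 4 * c + 3" for c
      using square_mod_4[of a] by presburger+
    obtain m where m: "int k = 2 * m + (1 - int e)"
    proof -
      have "k = 2 * (k div 2) + (1 - e)" using par mult_div_mod_eq[of 2 k] by simp
      then have "int k = int (2 * (k div 2) + (1 - e))" by simp
      then show thesis using that[of "int (k div 2)"] e by auto
    qed
    from e have "a\<^sup>2 \<noteq> (int k)\<^sup>2 + 2 * int h - 1 \<and> a\<^sup>2 \<noteq> (int k - 1)\<^sup>2 + 2 * int h - 2 * int e"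
    proof
      assume e0: "e = 0"
      have "(int k)\<^sup>2 = 4 * (m * m + m) + 1" "(int k - 1)\<^sup>2 = 4 * (m * m)"
        unfolding m e0 by (simp_all add: power2_eq_square algebra_simps)
      then have "(int k)\<^sup>2 + 2 * int h - 1 = 4 * (2 * (m * m) + 2 * m) + 2"
        "(int k - 1)\<^sup>2 + 2 * int h - 2 * int e = 4 * (2 * (m * m) + m) + 2"
        using k e0 by simp_all
      then show ?thesis using not_23(1) by metis
    next
      assume e1: "e = 1"
      have "(int k)\<^sup>2 = 4 * (m * m)" "(int k - 1)\<^sup>2 = 4 * (m * m - m) + 1"
        unfolding m e1 by (simp_all add: power2_eq_square algebra_simps)
      then have "(int k)\<^sup>2 + 2 * int h - 1 = 4 * (2 * (m * m) - 1) + 3"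
        "(int k - 1)\<^sup>2 + 2 * int h - 2 * int e = 4 * (2 * (m * m) - m - 1) + 3"
        using k e1 by simp_all
      then show ?thesis using not_23(2) by metis
    qed
    then show "a\<^sup>2 \<noteq> (int k)\<^sup>2 + 2 * int h - 1"
      "a\<^sup>2 \<noteq> (int k - 1)\<^sup>2 + 2 * int h - 2 * int e" by auto
  qed
  have uA: "no_repeats ?A"
  proof -
    have u: "no_repeats ?A1" "no_repeats ?A2" by (intro no_repeats_squares' finite_atLeastAtMost)+
    have 1: "x < ?b" if x: "x \<in># ?A1" for x
    proof -
      obtain c where "1 + int e \<le> c" "c \<le> int k - 2" "x = c\<^sup>2 - int e" using A1[OF x] by blast
      then show ?thesis using small[of c] e2 by linarith
    qed
    have 2: "?b < x" if x: "x \<in># ?A2" for x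
    proof -
      obtain c where c: "int k + 1 \<le> c" "x = c\<^sup>2 - 2 * int k + 1 - int e" using A2[OF x] by blast
      then show ?thesis using big[OF c(1)] k2 e2 k3 by linarith
    qed
    have 3: "?b + 2 * int h - 1 \<notin># ?A2"
    proof
      assume "?b + 2 * int h - 1 \<in># ?A2"
      then obtain c where c: "?b + 2 * int h - 1 = c\<^sup>2 - 2 * int k + 1 - int e" using A2 by blast
      then show False using two_squares(1)[of c] k2 e2 by linarith
    qed
    have "set_mset ?A1 \<inter> set_mset (add_mset ?b (?A2 + {#?b + 2 * int h - 1#})) = {}"
      using 1 2 h by fastforce
    moreover have "no_repeats (add_mset ?b (?A2 + {#?b + 2 * int h - 1#}))"
      using u 2 3 h by (auto simp: no_repeats_add_mset no_repeats_union)
    ultimately show ?thesis unfolding A no_repeats_union using u(1) by blast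
  qed
  have uB: "no_repeats ?B" unfolding B by (intro no_repeats_squares' finite_atLeastAtMost)
  have AB: "set_mset ?A \<inter> set_mset ?B = {}"
  proof -
    have False if xA: "x \<in># ?A" and xB: "x \<in># ?B" for x
    proof -
      obtain d where d: "2 - int e \<le> d" "x = d\<^sup>2 - (1 - int e)" using Bm[OF xB] by blast
      have d0: "0 \<le> d" using d e by auto
      have low: False if "1 + int e \<le> c" "x = c\<^sup>2 - int e" for c
        using e
      proof
        assume "e = 0"
        then show False using square_gap[of c d] d d0 that by auto
      next
        assume "e = 1"
        then show False using square_gap[of d c] d d0 that by auto
      qed
      from xA consider "x \<in># ?A1" | "x = ?b" | "x \<in># ?A2" | "x = ?b + 2 * int h - 1"
        unfolding A by auto
      then show False
      proof cases
        case 1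
        then show False using A1[OF 1] low by blast
      next
        case 2
        then show False using low[of "int k - 1"] k3 e e2 by auto
      next
        case 3
        then obtain c where c: "int k + 1 \<le> c" "x = c\<^sup>2 - 2 * int k + 1 - int e" using A2 by blast
        then have "d\<^sup>2 < c\<^sup>2" using d k3 e by auto
        then have g: "d\<^sup>2 + 2 * d + 1 \<le> c\<^sup>2" using square_gap[of d c] d0 c k3 by auto
        have "c - 1 \<le> d"
        proof (rule ccontr)
          assume "\<not> c - 1 \<le> d"
          then have "d\<^sup>2 \<le> (c - 2)\<^sup>2" using d0 by (intro power_mono) auto
          moreover have "(c - 2)\<^sup>2 = c\<^sup>2 - 4 * c + 4" by (simp add: power2_eq_square algebra_simps)
          ultimately show False using c d e k3 by auto
        qed
        then show False using g c d e k3 by auto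
      next
        case 4
        then show False using two_squares(2)[of d] d e2 by auto
      qed
    qed
    then show ?thesis by blast
  qed
  have AC: "set_mset ?A \<inter> set_mset ?C = {}"
  proof -
    have False if "2 * int h - 1 \<in># ?A"
    proof -
      have q: "2 * int h - 1 = (int k)\<^sup>2 - int e" using k by linarith
      from that consider "2 * int h - 1 \<in># ?A1" | "2 * int h - 1 = ?b" | "2 * int h - 1 \<in># ?A2"
        | "2 * int h - 1 = ?b + 2 * int h - 1"
        unfolding A by auto
      then show False
      proof cases
        case 1
        then obtain c where "1 + int e \<le> c" "c \<le> int k - 2" "(int k)\<^sup>2 - int e = c\<^sup>2 - int e"
          using A1 unfolding q by blast
        then show False using small[of c] k2 k3 by auto
      next
        case 2
        then show False using q k2 e2 k3 by linarith
      next
        case 3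
        then obtain c where "int k + 1 \<le> c" "(int k)\<^sup>2 - int e = c\<^sup>2 - 2 * int k + 1 - int e"
          using A2 unfolding q by blast
        then show False using big[of c] k2 by linarith
      next
        case 4
        have "(2::int)\<^sup>2 \<le> (int k - 1)\<^sup>2" using k3 by (intro power_mono) auto
        then show False using 4 e2 e by auto
      qed
    qed
    then show ?thesis unfolding C by auto
  qed
  have BC: "set_mset ?B \<inter> set_mset ?C = {}"
  proof -
    have False if x: "2 * int h - 1 \<in># ?B"
    proof -
      obtain d where d: "2 - int e \<le> d" "2 * int h - 1 = d\<^sup>2 - (1 - int e)" using Bm[OF x] by blast
      from e show False
      proof
        assume "e = 0"
        then show False using square_gap[of "int k" d] d k k3 by auto
      next
        assume "e = 1"
        then show False using square_gap[of d "int k"] d k k3 by auto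
      qed
    qed
    then show ?thesis unfolding C by auto
  qed
  have zA: "0 \<notin># ?A"
  proof -
    have "(2::int)\<^sup>2 \<le> (int k - 1)\<^sup>2" using k3 by (intro power_mono) auto
    then have "0 \<noteq> ?b" "0 \<noteq> ?b + 2 * int h - 1" using e2 e h by auto
    moreover have "0 \<notin># ?A1" using squares_pos less_irrefl by blast
    moreover have False if x: "0 \<in># ?A2"
    proof -
      obtain c where "int k + 1 \<le> c" "0 = c\<^sup>2 - 2 * int k + 1 - int e" using A2[OF x] by blast
      moreover have "int e \<le> 1" using e by auto
      ultimately show False using big[of c] k2(2) zero_le_power2[of "int k"] by linarith
    qed
    ultimately show ?thesis
      unfolding A set_mset_union set_mset_add_mset_insert set_mset_empty by blast
  qed
  have zB: "0 \<notin># ?B"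
  proof
    assume "0 \<in># ?B"
    then obtain d where "2 - int e \<le> d" "0 = d\<^sup>2 - (1 - int e)" using Bm by blast
    then show False using e power_mono[of "2 - int e" d 2] by auto
  qed
  have "vol (fork (h - k + 2)) = h - k + 2" using vol_path_shape[of "h - k"] kh by simp
  then have vA: "vol (stem (k - 2 - e) (fork (h - k + 2))) = h - e" using kh k3 e by auto
  have vB: "vol (path_shape (h - (1 - e))) = h - (1 - e)" using h by (intro vol_path_shape) auto
  have zC: "0 \<notin># ?C" and uC: "no_repeats ?C" unfolding C using h by simp_all
  show ?thesis
    by (rule ti_shape_threeI; (fact uA uB uC AB AC BC zA zB zC)?) (use vA vB h e in auto)
qed

lemma ti_shape_forked_odd: "5 \<le> h \<Longrightarrow> (int k)\<^sup>2 = 2 * int h - 1 \<Longrightarrow> ti_shape h (forked_odd h k)"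
  using ti_shape_fork[of h 0 k] by (simp add: forked_odd_def)

lemma ti_shape_forked_even: "5 \<le> h \<Longrightarrow> (int k)\<^sup>2 = 2 * int h \<Longrightarrow> ti_shape h (forked_even h k)"
  using ti_shape_fork[of h 1 k] by (simp add: forked_even_def add_mset_commute numeral_eq_Suc)

section \<open>Trees given by a parent function\<close>

abbreviation walk :: "'a pair_pre_digraph \<Rightarrow> 'a \<Rightarrow> ('a \<times> 'a) list \<Rightarrow> 'a \<Rightarrow> bool" where
  "walk G \<equiv> pre_digraph.awalk (with_proj G)"

definition tree_graph :: "'a set \<Rightarrow> 'a \<Rightarrow> ('a \<Rightarrow> 'a) \<Rightarrow> 'a pair_pre_digraph" where
  "tree_graph V c par = sym_graph V {(par v, v) | v. v \<in> V \<and> v \<noteq> c}"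

lemma sum_singletons: "(\<Sum>x\<in>A. {#f x#}) = image_mset f (mset_set A)"
  by (induction A rule: infinite_finite_induct) auto

text \<open>
  The measure \<open>dep\<close> decreases towards the root and thereby excludes cycles of
  parents; the distance to the root is one choice for it.
\<close>

locale rooted_tree =
  fixes V :: "'a set" and c :: 'a and par :: "'a \<Rightarrow> 'a" and dep :: "'a \<Rightarrow> nat"
  assumes finite_V: "finite V" and root_in: "c \<in> V"
    and par_in: "\<And>v. v \<in> V \<Longrightarrow> v \<noteq> c \<Longrightarrow> par v \<in> V"
    and dep_par: "\<And>v. v \<in> V \<Longrightarrow> v \<noteq> c \<Longrightarrow> dep (par v) < dep v"
begin

abbreviation "G \<equiv> tree_graph V c par"

definition children :: "'a \<Rightarrow> 'a set" where
  "children v = {w \<in> V. w \<noteq> c \<and> par w = v}"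

definition below :: "('a \<times> 'a) set" where
  "below = {(par w, w) | w. w \<in> V \<and> w \<noteq> c}"

definition subtree :: "'a \<Rightarrow> 'a set" where
  "subtree v = {w. (v, w) \<in> below\<^sup>*}"

lemma finite_children [simp]: "finite (children v)"
  using finite_V by (simp add: children_def)

lemma sub_self [simp]: "v \<in> subtree v"
  by (simp add: subtree_def)

lemma sub_in_V: "w \<in> subtree v \<Longrightarrow> v \<in> V \<Longrightarrow> w \<in> V"
  unfolding subtree_def mem_Collect_eq by (induction rule: rtrancl_induct) (auto simp: below_def)

lemma finite_sub [simp]: "v \<in> V \<Longrightarrow> finite (subtree v)"
  using finite_V sub_in_V by (meson finite_subset subsetI)

lemma dep_sub: "w \<in> subtree v \<Longrightarrow> w = v \<or> dep v < dep w"
  unfolding subtree_def mem_Collect_eq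
  by (induction rule: rtrancl_induct) (auto simp: below_def dest: dep_par)

text \<open>
  A subtree is left and entered only through the edge above its root. All cut arguments below rest
  on this fact.
\<close>

lemma par_in_sub_iff:
  assumes "w \<in> V" "w \<noteq> c" "w \<noteq> v"
  shows "par w \<in> subtree v \<longleftrightarrow> w \<in> subtree v"
proof
  assume "par w \<in> subtree v"
  then show "w \<in> subtree v" using assms
    unfolding subtree_def below_def by (auto intro: rtrancl_into_rtrancl)
next
  assume "w \<in> subtree v"
  then have "(v, w) \<in> below\<^sup>*" by (simp add: subtree_def)
  then show "par w \<in> subtree v" using assms(3)
    by (cases rule: rtranclE) (auto simp: below_def subtree_def)
qed

lemma par_notin_sub: "v \<in> V \<Longrightarrow> v \<noteq> c \<Longrightarrow> par v \<notin> subtree v"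
  using dep_sub[of "par v" v] dep_par[of v] by (metis less_irrefl less_trans)

lemma dep_induct [consumes 1, case_names root child]:
  assumes "v \<in> V" and "P c" and "\<And>v. v \<in> V \<Longrightarrow> v \<noteq> c \<Longrightarrow> P (par v) \<Longrightarrow> P v"
  shows "P v"
  using assms(1)
proof (induction "dep v" arbitrary: v rule: less_induct)
  case less
  then show ?case using assms(2,3) dep_par par_in by (cases "v = c") auto
qed

lemma sub_root: "subtree c = V"
proof
  show "subtree c \<subseteq> V" using sub_in_V root_in by blast
  have "v \<in> subtree c" if "v \<in> V" for v
    using that by (induction rule: dep_induct) (auto simp: par_in_sub_iff)
  then show "V \<subseteq> subtree c" by blast
qed

lemma sub_unfold: "subtree v = insert v (\<Union>w\<in>children v. subtree w)"
proof (intro set_eqI iffI)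
  fix x assume "x \<in> subtree v"
  then have "(v, x) \<in> below\<^sup>*" by (simp add: subtree_def)
  then show "x \<in> insert v (\<Union>w\<in>children v. subtree w)"
    by (cases rule: converse_rtranclE) (auto simp: below_def children_def subtree_def)
next
  fix x assume "x \<in> insert v (\<Union>w\<in>children v. subtree w)"
  then show "x \<in> subtree v"
    by (auto simp: children_def subtree_def below_def intro: converse_rtrancl_into_rtrancl)
qed

lemma parent_notin_sub_child: "w \<in> children v \<Longrightarrow> v \<notin> subtree w"
  using par_notin_sub by (auto simp: children_def)

lemma sub_children_disjoint:
  assumes "w1 \<in> children v" "w2 \<in> children v" "w1 \<noteq> w2"
  shows "subtree w1 \<inter> subtree w2 = {}"
proof -
  have w: "w1 \<in> V" "w1 \<noteq> c" "par w1 = v" "w2 \<in> V" "w2 \<noteq> c" "par w2 = v"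
    using assms by (auto simp: children_def)
  have n: "w1 \<notin> subtree w2" "w2 \<notin> subtree w1"
    using par_in_sub_iff[of w1 w2] par_in_sub_iff[of w2 w1] parent_notin_sub_child assms w by auto
  have "x \<in> subtree w1 \<longrightarrow> x \<notin> subtree w2" if "x \<in> V" for x
    using that
  proof (induction rule: dep_induct)
    case root
    then show ?case using dep_sub[of c w1] dep_sub[of w1 c] sub_root w by fastforce
  next
    case (child x)
    then show ?case using par_in_sub_iff[of x w1] par_in_sub_iff[of x w2] n by blast
  qed
  then show ?thesis using sub_in_V w by blast
qed

text \<open>
  Recursion for sums over a subtree. It is used with integers, with cardinalities and with
  multisets of transmissions.
\<close>

lemma sum_sub:
  fixes g :: "'a \<Rightarrow> 'b :: comm_monoid_add"
  assumes "v \<in> V"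
  shows "sum g (subtree v) = g v + (\<Sum>w\<in>children v. sum g (subtree w))"
proof -
  have ch: "w \<in> V" if "w \<in> children v" for w using that by (simp add: children_def)
  have "sum g (subtree v) = g v + sum g (\<Union>w\<in>children v. subtree w)"
    using parent_notin_sub_child ch by (subst sub_unfold, subst sum.insert) auto
  also have "sum g (\<Union>w\<in>children v. subtree w) = (\<Sum>w\<in>children v. sum g (subtree w))"
    using ch sub_children_disjoint by (intro sum.UNION_disjoint) auto
  finally show ?thesis .
qed

lemma graph: "pair_graph G"
proof -
  have "finite {(par v, v) | v. v \<in> V \<and> v \<noteq> c}"
    using finite_V by (auto intro: finite_subset[of _ "(\<lambda>v. (par v, v)) ` V"])
  moreover have "par v \<noteq> v" "v \<noteq> par v" if "v \<in> V" "v \<noteq> c" for v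
    using dep_par[OF that] by auto
  ultimately show ?thesis
    unfolding tree_graph_def sym_graph_def
    by unfold_locales (auto simp: finite_V par_in symmetric_def sym_def)
qed

sublocale pair_graph G
  by (rule graph)

lemma verts_G: "pverts G = V"
  by (simp add: tree_graph_def sym_graph_def)

lemma arcs_G: "(x, y) \<in> parcs G \<longleftrightarrow> (y \<in> V \<and> y \<noteq> c \<and> x = par y) \<or> (x \<in> V \<and> x \<noteq> c \<and> y = par x)"
  by (auto simp: tree_graph_def sym_graph_def)

lemma walk_root: "v \<in> V \<Longrightarrow> \<exists>p. walk G c p v"
proof (induction rule: dep_induct)
  case root
  then show ?case using root_in by (intro exI[of _ "[]"]) (simp add: awalk_Nil_iff verts_G)
next
  case (child v)
  then obtain p where "walk G c p (par v)" by blast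
  moreover have "walk G (par v) [(par v, v)] v"
    using child by (simp add: awalk_simps arcs_G verts_G par_in)
  ultimately show ?case using awalk_appendI by blast
qed

lemma walk_ex: "u \<in> V \<Longrightarrow> v \<in> V \<Longrightarrow> \<exists>p. walk G u p v"
  using walk_root awalk_appendI awalk_rev_path by metis

lemma gdist_le: "walk G u p v \<Longrightarrow> gdist G u v \<le> length p"
  unfolding gdist_def by (intro cINF_lower) auto

lemma gdist_walk:
  assumes "u \<in> V" "v \<in> V"
  obtains p where "walk G u p v" "length p = gdist G u v"
proof -
  have "gdist G u v \<in> length ` {p. walk G u p v}"
    unfolding gdist_def using walk_ex[OF assms] by (intro Inf_nat_def1) auto
  then show thesis using that by auto
qed

lemma gdist_self: "u \<in> V \<Longrightarrow> gdist G u u = 0"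
  using gdist_le[of u "[]" u] by (simp add: awalk_Nil_iff verts_G)

text \<open>
  Cutting the walk at its first arc into \<open>X\<close>, which can only be the arc from
  \<open>u\<close> to \<open>v\<close>, leaves an initial part that ends in \<open>u\<close>.
\<close>

lemma crossing:
  assumes "\<And>x y. (x, y) \<in> parcs G \<Longrightarrow> x \<notin> X \<Longrightarrow> y \<in> X \<Longrightarrow> x = u \<and> y = v"
    and "walk G a p b" "a \<notin> X" "b \<in> X"
  shows "(u, v) \<in> set p \<and> (\<exists>q. walk G a q u \<and> length q < length p)"
  using assms(2,3)
proof (induction p arbitrary: a)
  case Nil
  then show ?case using assms(4) by (simp add: awalk_Nil_iff)
next
  case (Cons e p)
  obtain y where e: "e = (a, y)" "(a, y) \<in> parcs G" and w: "walk G y p b"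
    using Cons.prems(1) by (cases e) (auto simp: awalk_Cons_iff)
  show ?case
  proof (cases "y \<in> X")
    case True
    then have "a = u" "y = v" using assms(1)[OF e(2) Cons.prems(2)] by auto
    moreover have "walk G a [] a" using e(2) by (auto simp: awalk_Nil_iff dest: in_arcsD1)
    ultimately show ?thesis using e by auto
  next
    case False
    then obtain q where "(u, v) \<in> set p" "walk G y q u" "length q < length p"
      using Cons.IH[OF w] by blast
    then show ?thesis using e by (auto simp: awalk_Cons_iff intro!: exI[of _ "e # q"])
  qed
qed

lemma cut_down:
  assumes "(x, y) \<in> parcs G" "x \<notin> subtree v" "y \<in> subtree v" "v \<in> V" "v \<noteq> c"
  shows "x = par v \<and> y = v"
  using assms par_in_sub_iff[of x v] par_in_sub_iff[of y v] par_notin_sub[of v] sub_self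
  unfolding arcs_G by metis

lemma arcs_G_sym: "(x, y) \<in> parcs G \<Longrightarrow> (y, x) \<in> parcs G"
  unfolding arcs_G by auto

text \<open>
  Every walk between \<open>x\<close> and the endpoint of the edge on the other side has to use
  this edge.
\<close>

lemma gdist_step:
  assumes x: "x \<in> V" and v: "v \<in> V" "v \<noteq> c"
  shows "x \<in> subtree v \<Longrightarrow> gdist G x (par v) = gdist G x v + 1"
    and "x \<notin> subtree v \<Longrightarrow> gdist G x v = gdist G x (par v) + 1"
proof -
  have e: "walk G (par v) [(par v, v)] v" "walk G v [(v, par v)] (par v)"
    using v by (simp_all add: awalk_simps arcs_G verts_G par_in)
  obtain p where p: "walk G x p v" "length p = gdist G x v" using gdist_walk x v by blast
  obtain q where q: "walk G x q (par v)" "length q = gdist G x (par v)"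
    using gdist_walk x v par_in by blast
  have le: "gdist G x (par v) \<le> gdist G x v + 1" "gdist G x v \<le> gdist G x (par v) + 1"
    using gdist_le[OF awalk_appendI[OF p(1) e(2)]] gdist_le[OF awalk_appendI[OF q(1) e(1)]] p q
    by simp_all
  show "gdist G x (par v) = gdist G x v + 1" if "x \<in> subtree v"
  proof -
    have "\<exists>r. walk G x r v \<and> length r < length q"
      using crossing[of "- subtree v" v "par v" x q "par v"] cut_down[of _ _ v] arcs_G_sym q(1) that
        par_notin_sub v by blast
    then show ?thesis using gdist_le le q(2) by fastforce
  qed
  show "gdist G x v = gdist G x (par v) + 1" if "x \<notin> subtree v"
  proof -
    have "\<exists>r. walk G x r (par v) \<and> length r < length p"
      using crossing[of "subtree v" "par v" v x p v] cut_down[of _ _ v] p(1) that v sub_self by blast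
    then show ?thesis using gdist_le le p(2) by fastforce
  qed
qed

text \<open>
  The edges (named by their lower ends) that separate \<open>x\<close> from \<open>y\<close>.
\<close>

definition separators :: "'a \<Rightarrow> 'a \<Rightarrow> 'a set" where
  "separators x y = {v \<in> V - {c}. (x \<in> subtree v) \<noteq> (y \<in> subtree v)}"

text \<open>
  Both sides change by the same amount along each edge of the tree, and they agree for \<open>y =
  x\<close>.
\<close>

lemma gdist_eq_separators:
  assumes "x \<in> V" "y \<in> V"
  shows "gdist G x y = card (separators x y)"
proof -
  have fin: "finite (separators x y)" for y using finite_V by (simp add: separators_def)
  have "int (gdist G x y) - int (card (separators x y))
      = int (gdist G x c) - int (card (separators x c))" if "y \<in> V" for y
    using that
  proof (induction rule: dep_induct)
    case (child v)
    have same: "u \<in> separators x (par v) \<longleftrightarrow> u \<in> separators x v" if u: "u \<noteq> v" for u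
      using par_in_sub_iff[OF child(1,2)] u by (simp add: separators_def)
    show ?case
    proof (cases "x \<in> subtree v")
      case True
      have "v \<in> separators x (par v)" "v \<notin> separators x v"
        using True child par_notin_sub[of v] by (simp_all add: separators_def)
      moreover from this have "separators x (par v) = insert v (separators x v)"
        by (intro set_eqI, rename_tac u, case_tac "u = v") (simp_all add: same)
      ultimately show ?thesis using gdist_step(1)[OF assms(1) child(1,2) True] child fin by simp
    next
      case False
      have "v \<in> separators x v" "v \<notin> separators x (par v)"
        using False child par_notin_sub[of v] by (simp_all add: separators_def)
      moreover from this have "separators x v = insert v (separators x (par v))"
        by (intro set_eqI, rename_tac u, case_tac "u = v") (simp_all add: same)
      ultimately show ?thesis using gdist_step(2)[OF assms(1) child(1,2) False] child fin by simp
    qed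
  qed simp
  from this[OF assms(2)] this[OF assms(1)] show ?thesis
    using gdist_self[OF assms(1)] by (simp add: separators_def)
qed

lemma gdist_sym: "x \<in> V \<Longrightarrow> y \<in> V \<Longrightarrow> gdist G x y = gdist G y x"
proof -
  have "separators x y = separators y x" unfolding separators_def by blast
  then show "x \<in> V \<Longrightarrow> y \<in> V \<Longrightarrow> gdist G x y = gdist G y x"
    by (simp only: gdist_eq_separators)
qed

abbreviation n :: nat where "n \<equiv> card V"

lemma transmission_sum: "x \<in> V \<Longrightarrow> transmission G x = (\<Sum>u\<in>V. gdist G u x)"
proof -
  assume x: "x \<in> V"
  have "(\<Sum>u\<in>V. gdist G u x) = (\<Sum>u\<in>V. gdist G x u)"
    using gdist_sym x by (intro sum.cong) auto
  also have "\<dots> = gdist G x x + (\<Sum>u\<in>V - {x}. gdist G x u)"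
    using finite_V x by (rule sum.remove)
  finally show ?thesis using gdist_self[OF x] by (simp add: transmission_def verts_G)
qed

text \<open>
  Moving down to \<open>v\<close> decreases the distance to the vertices below \<open>v\<close>
  and increases that to all others, by one each.
\<close>

lemma transmission_step:
  assumes v: "v \<in> V" "v \<noteq> c"
  shows "int (transmission G v) = int (transmission G (par v)) + int n - 2 * int (card (subtree v))"
proof -
  have subV: "subtree v \<subseteq> V" using sub_in_V v by blast
  have "int (transmission G v) - int (transmission G (par v))
      = (\<Sum>u\<in>V. int (gdist G u v) - int (gdist G u (par v)))"
    using v par_in by (simp add: transmission_sum sum_subtractf)
  also have "\<dots> = (\<Sum>u\<in>V. if u \<in> subtree v then - 1 else 1)"
    using gdist_step v by (intro sum.cong) auto
  also have "\<dots> = (\<Sum>u\<in>subtree v. - 1) + (\<Sum>u\<in>V - subtree v. 1)"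
    using subV finite_V by (subst sum.If_cases) (auto simp: Int_absorb1 Diff_eq)
  also have "\<dots> = int n - 2 * int (card (subtree v))"
    using subV finite_V card_mono[OF finite_V subV] finite_subset[OF subV finite_V]
    by (simp add: card_Diff_subset of_nat_diff)
  finally show ?thesis by simp
qed

lemma card_filter:
  "finite A \<Longrightarrow> (\<Sum>x\<in>A. if P x then 1 else 0) = card {x \<in> A. P x}"
  using sum.inter_filter[of A "\<lambda>_. 1 :: nat" P] by simp

text \<open>
  Double counting: the edge above \<open>v\<close> is a separator of exactly those pairs that have
  one vertex in the subtree below \<open>v\<close>.
\<close>

lemma wiener_eq: "int (wiener_index G) = (\<Sum>v\<in>V - {c}. edge_weight n (card (subtree v)))"
proof -
  let ?E = "{e. e \<subseteq> V \<and> card e = 2}"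
  have finE: "finite ?E" using finite_V by (auto intro: finite_subset[of _ "Pow V"])
  have "(THE d. \<exists>u v. e = {u, v} \<and> d = gdist G u v)
      = (\<Sum>v\<in>V - {c}. if e \<inter> subtree v \<noteq> {} \<and> \<not> e \<subseteq> subtree v then 1 else 0)" if e: "e \<in> ?E" for e
  proof -
    obtain x y where xy: "e = {x, y}" "x \<noteq> y" using e by (auto simp: card_2_iff)
    have V: "x \<in> V" "y \<in> V" using e xy by auto
    have "(THE d. \<exists>u v. e = {u, v} \<and> d = gdist G u v) = gdist G x y"
      using gdist_sym[OF V] by (intro the_equality) (auto simp: xy doubleton_eq_iff)
    also have "\<dots> = (\<Sum>v\<in>V - {c}. if (x \<in> subtree v) \<noteq> (y \<in> subtree v) then 1 else 0)"
      unfolding gdist_eq_separators[OF V] separators_def using finite_V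
      by (intro card_filter[symmetric]) simp
    also have "\<dots> = (\<Sum>v\<in>V - {c}. if e \<inter> subtree v \<noteq> {} \<and> \<not> e \<subseteq> subtree v then 1 else 0)"
      by (intro sum.cong) (auto simp: xy)
    finally show ?thesis .
  qed
  then have "wiener_index G
      = (\<Sum>e\<in>?E. \<Sum>v\<in>V - {c}. if e \<inter> subtree v \<noteq> {} \<and> \<not> e \<subseteq> subtree v then 1 else 0)"
    unfolding wiener_index_def verts_G by (intro sum.cong) auto
  also have "\<dots> = (\<Sum>v\<in>V - {c}. \<Sum>e\<in>?E. if e \<inter> subtree v \<noteq> {} \<and> \<not> e \<subseteq> subtree v then 1 else 0)"
    by (rule sum.swap)
  also have "\<dots> = (\<Sum>v\<in>V - {c}. card (subtree v) * (n - card (subtree v)))"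
  proof (intro sum.cong refl)
    fix v assume "v \<in> V - {c}"
    then have subV: "subtree v \<subseteq> V" using sub_in_V by blast
    have "(\<Sum>e\<in>?E. if e \<inter> subtree v \<noteq> {} \<and> \<not> e \<subseteq> subtree v then 1 else 0)
        = card {e \<in> ?E. e \<inter> subtree v \<noteq> {} \<and> \<not> e \<subseteq> subtree v}"
      using finE by (rule card_filter)
    also have "{e \<in> ?E. e \<inter> subtree v \<noteq> {} \<and> \<not> e \<subseteq> subtree v}
        = (\<lambda>(x, y). {x, y}) ` (subtree v \<times> (V - subtree v))"
    proof (intro set_eqI iffI)
      fix e assume e: "e \<in> {e \<in> ?E. e \<inter> subtree v \<noteq> {} \<and> \<not> e \<subseteq> subtree v}"
      then obtain x y where "e = {x, y}" by (auto simp: card_2_iff)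
      then show "e \<in> (\<lambda>(x, y). {x, y}) ` (subtree v \<times> (V - subtree v))"
        using e by (cases "x \<in> subtree v") (auto simp: insert_commute image_iff)
    next
      fix e assume "e \<in> (\<lambda>(x, y). {x, y}) ` (subtree v \<times> (V - subtree v))"
      then show "e \<in> {e \<in> ?E. e \<inter> subtree v \<noteq> {} \<and> \<not> e \<subseteq> subtree v}"
        using subV by (auto simp: card_2_iff)
    qed
    also have "card \<dots> = card (subtree v \<times> (V - subtree v))"
      by (intro card_image) (auto simp: inj_on_def doubleton_eq_iff)
    also have "\<dots> = card (subtree v) * (n - card (subtree v))"
      using subV finite_subset[OF subV finite_V] by (simp add: card_cartesian_product card_Diff_subset)
    finally show "(\<Sum>e\<in>?E. if e \<inter> subtree v \<noteq> {} \<and> \<not> e \<subseteq> subtree v then 1 else 0)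
      = card (subtree v) * (n - card (subtree v))" .
  qed
  finally have "int (wiener_index G) = (\<Sum>v\<in>V - {c}. int (card (subtree v) * (n - card (subtree v))))"
    by simp
  also have "\<dots> = (\<Sum>v\<in>V - {c}. edge_weight n (card (subtree v)))"
  proof (intro sum.cong refl)
    fix v assume "v \<in> V - {c}"
    then have "card (subtree v) \<le> n" using sub_in_V finite_V by (intro card_mono) auto
    then show "int (card (subtree v) * (n - card (subtree v))) = edge_weight n (card (subtree v))"
      by (simp add: edge_weight_def of_nat_diff)
  qed
  finally show ?thesis .
qed

end

declare multiset.map_cong [fundef_cong]

function (in rooted_tree) shape :: "'a \<Rightarrow> shape" where
  "shape v = Node (image_mset shape (mset_set (children v)))"
  by auto

termination (in rooted_tree) shape
proof (relation "measure (\<lambda>v. Suc (Max (dep ` V)) - dep v)")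
  fix v w assume "w \<in># mset_set (children v)"
  then have "w \<in> children v" by simp
  then have w: "w \<in> V" "w \<noteq> c" "par w = v" by (auto simp: children_def)
  then have "dep v < dep w" using dep_par by blast
  moreover have "dep w \<le> Max (dep ` V)" using w finite_V by simp
  ultimately show "(w, v) \<in> measure (\<lambda>v. Suc (Max (dep ` V)) - dep v)" by auto
qed simp

declare (in rooted_tree) shape.simps [simp del]

section \<open>Graph invariants from shapes\<close>

context rooted_tree
begin

lemma kids_shape: "kids (shape v) = image_mset shape (mset_set (children v))"
  by (subst shape.simps) simp

lemma child_in_V: "w \<in> children v \<Longrightarrow> w \<in> V"
  by (simp add: children_def)

lemma vol_shape: "v \<in> V \<Longrightarrow> vol (shape v) = card (subtree v)"
proof (induction v rule: shape.induct)
  case (1 v)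
  have "vol (shape v) = Suc (\<Sum>w\<in>children v. vol (shape w))"
    by (subst shape.simps) (simp add: sum_unfold_sum_mset multiset.map_comp comp_def)
  also have "(\<Sum>w\<in>children v. vol (shape w)) = (\<Sum>w\<in>children v. card (subtree w))"
    using 1 child_in_V by (intro sum.cong) auto
  finally show ?case using sum_sub[OF 1(2), of "\<lambda>_. 1 :: nat"] by simp
qed

lemma wien_shape:
  "v \<in> V \<Longrightarrow> edge_weight m (card (subtree v)) + wien m (shape v) = (\<Sum>w\<in>subtree v. edge_weight m (card (subtree w)))"
proof (induction v rule: shape.induct)
  case (1 v)
  have "wien m (shape v) = (\<Sum>w\<in>children v. edge_weight m (vol (shape w)) + wien m (shape w))"
    by (subst shape.simps) (simp add: sum_unfold_sum_mset multiset.map_comp comp_def)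
  also have "\<dots> = (\<Sum>w\<in>children v. \<Sum>x\<in>subtree w. edge_weight m (card (subtree x)))"
    using 1(1) child_in_V vol_shape by (intro sum.cong) auto
  finally show ?case using sum_sub[OF 1(2), of "\<lambda>w. edge_weight m (card (subtree w))"] by simp
qed

lemma wiener_shape: "int (wiener_index G) = wien n (shape c)"
proof -
  have "wien n (shape c) = (\<Sum>w\<in>V. edge_weight n (card (subtree w))) - edge_weight n (card (subtree c))"
    using wien_shape[OF root_in, of n] by (simp add: sub_root)
  also have "\<dots> = (\<Sum>w\<in>V - {c}. edge_weight n (card (subtree w)))"
    using finite_V root_in by (simp add: sum_diff1)
  finally show ?thesis using wiener_eq by simp
qed

lemma offsets_shape:
  "v \<in> V \<Longrightarrow> offsets n (shape v) (int (transmission G v))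
    = image_mset (\<lambda>w. int (transmission G w)) (mset_set (subtree v))"
proof (induction v rule: shape.induct)
  case (1 v)
  let ?T = "\<lambda>w. int (transmission G w)"
  have "offsets n (shape v) (?T v)
      = add_mset (?T v) (\<Sum>w\<in>children v. offsets n (shape w) (?T v + int n - 2 * int (vol (shape w))))"
    by (subst shape.simps) (simp add: sum_unfold_sum_mset multiset.map_comp comp_def)
  also have "(\<Sum>w\<in>children v. offsets n (shape w) (?T v + int n - 2 * int (vol (shape w))))
      = (\<Sum>w\<in>children v. offsets n (shape w) (?T w))"
    using vol_shape transmission_step by (intro sum.cong) (auto simp: children_def)
  also have "\<dots> = (\<Sum>w\<in>children v. \<Sum>x\<in>subtree w. {#?T x#})"
    using 1(1) child_in_V by (intro sum.cong) (auto simp: sum_singletons)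
  finally have "offsets n (shape v) (?T v) = {#?T v#} + (\<Sum>w\<in>children v. \<Sum>x\<in>subtree w. {#?T x#})" by simp
  also have "\<dots> = (\<Sum>x\<in>subtree v. {#?T x#})"
    using sum_sub[OF 1(2), of "\<lambda>x. {#?T x#}"] by simp
  finally show ?case by (simp add: sum_singletons)
qed

end

text \<open>
  Only differences of transmissions matter, so the value at the root may be normalised to 0.
\<close>

lemma offsets_shift: "offsets n t (a + d) = image_mset (\<lambda>x. x + d) (offsets n t a)"
proof (induction t arbitrary: a)
  case (Node M)
  have "offsets n t (a + d + int n - 2 * int (vol t)) = image_mset (\<lambda>x. x + d) (offsets n t (a + int n - 2 * int (vol t)))"
    if "t \<in># M" for t
    using Node[OF that, of "a + int n - 2 * int (vol t)"] by (simp add: algebra_simps)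
  then have "(\<Sum>t\<in>#M. offsets n t (a + d + int n - 2 * int (vol t)))
      = (\<Sum>t\<in>#M. image_mset (\<lambda>x. x + d) (offsets n t (a + int n - 2 * int (vol t))))"
    by (intro arg_cong[of _ _ sum_mset] image_mset_cong)
  also have "\<dots> = image_mset (\<lambda>x. x + d) (\<Sum>t\<in>#M. offsets n t (a + int n - 2 * int (vol t)))"
    by (induction M) auto
  finally show ?case by simp
qed

lemma no_repeats_image_mset_inj: "inj f \<Longrightarrow> no_repeats (image_mset f N) \<longleftrightarrow> no_repeats N"
  by (induction N) (auto simp: no_repeats_add_mset dest: injD)

lemma no_repeats_offsets_shift: "no_repeats (offsets n t a) \<longleftrightarrow> no_repeats (offsets n t 0)"
  using offsets_shift[of n t 0 a] no_repeats_image_mset_inj[of "\<lambda>x. x + a" "offsets n t 0"] by (simp add: inj_def)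

section \<open>Equal shapes give isomorphic trees\<close>

text \<open>
  Children of vertices of equal shape can be matched so that matched children have equal shapes.
\<close>

lemma bij_betw_image_mset_eq:
  assumes "finite A" "finite B" "image_mset f (mset_set A) = image_mset g (mset_set B)"
  shows "\<exists>\<pi>. bij_betw \<pi> A B \<and> (\<forall>a\<in>A. g (\<pi> a) = f a)"
  using assms
proof (induction A arbitrary: B rule: finite_induct)
  case empty
  then have "B = {}" by (simp add: mset_set_empty_iff)
  then show ?case by (simp add: bij_betw_def)
next
  case (insert a A)
  have "f a \<in># image_mset g (mset_set B)" using insert.prems(2)[symmetric] insert.hyps by simp
  then obtain b where b: "b \<in> B" "g b = f a" using insert.prems(1) by auto
  have "mset_set B = add_mset b (mset_set (B - {b}))"
    using b insert.prems(1) mset_set.remove by fastforce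
  then have "image_mset f (mset_set A) = image_mset g (mset_set (B - {b}))"
    using insert b by simp
  then obtain \<pi> where \<pi>: "bij_betw \<pi> A (B - {b})" "\<forall>x\<in>A. g (\<pi> x) = f x"
    using insert.IH[of "B - {b}"] insert.prems(1) by auto
  have "bij_betw (\<pi>(a := b)) A (B - {b})"
    using \<pi>(1) insert.hyps(2) by (subst bij_betw_cong[of A _ \<pi>]) auto
  then have "bij_betw (\<pi>(a := b)) (insert a A) (insert b (B - {b}))"
    using notIn_Un_bij_betw[of a A "\<pi>(a := b)" "B - {b}"] insert.hyps(2) by simp
  moreover have "insert b (B - {b}) = B" using b by auto
  moreover have "\<forall>x\<in>insert a A. g ((\<pi>(a := b)) x) = f x" using \<pi>(2) b insert.hyps(2) by auto
  ultimately show ?case by metis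
qed

text \<open>
  By induction on the shape: match the children of \<open>v\<close> and \<open>v'\<close> and glue
  the bijections of the disjoint subtrees below them.
\<close>

lemma shape_eq_imp_bij:
  assumes "rooted_tree V c par dep" "rooted_tree V' c' par' dep'"
    and "v \<in> V" "v' \<in> V'" "rooted_tree.shape V c par v = rooted_tree.shape V' c' par' v'"
  shows "\<exists>\<phi>. bij_betw \<phi> (rooted_tree.subtree V c par v) (rooted_tree.subtree V' c' par' v') \<and> \<phi> v = v' \<and>
    (\<forall>w\<in>rooted_tree.subtree V c par v. w \<noteq> v \<longrightarrow> par' (\<phi> w) = \<phi> (par w))"
proof -
  interpret A: rooted_tree V c par dep by fact
  interpret B: rooted_tree V' c' par' dep' by fact
  have "\<exists>\<phi>. bij_betw \<phi> (A.subtree v) (B.subtree v') \<and> \<phi> v = v' \<and>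
      (\<forall>w\<in>A.subtree v. w \<noteq> v \<longrightarrow> par' (\<phi> w) = \<phi> (par w))"
    if "v \<in> V" "v' \<in> V'" "A.shape v = B.shape v'" for v v'
    using that
  proof (induction v arbitrary: v' rule: A.shape.induct)
    case (1 v)
    have "kids (A.shape v) = kids (B.shape v')" using 1(4) by simp
    then obtain \<pi> where \<pi>: "bij_betw \<pi> (A.children v) (B.children v')"
      "\<forall>w\<in>A.children v. B.shape (\<pi> w) = A.shape w"
      unfolding A.kids_shape B.kids_shape
      using bij_betw_image_mset_eq[of "A.children v" "B.children v'" A.shape B.shape] by auto
    have ch: "w \<in> V" "w \<noteq> c" "par w = v" "\<pi> w \<in> V'" "\<pi> w \<noteq> c'" "par' (\<pi> w) = v'" if "w \<in> A.children v" for w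
      using that bij_betwE[OF \<pi>(1)] by (auto simp: A.children_def B.children_def)
    have "\<forall>w\<in>A.children v. \<exists>\<phi>. bij_betw \<phi> (A.subtree w) (B.subtree (\<pi> w)) \<and> \<phi> w = \<pi> w \<and>
        (\<forall>x\<in>A.subtree w. x \<noteq> w \<longrightarrow> par' (\<phi> x) = \<phi> (par x))"
      using 1(1) ch \<pi>(2) by auto
    then obtain \<phi> where \<phi>: "\<And>w. w \<in> A.children v \<Longrightarrow> bij_betw (\<phi> w) (A.subtree w) (B.subtree (\<pi> w))"
      "\<And>w. w \<in> A.children v \<Longrightarrow> \<phi> w w = \<pi> w"
      "\<And>w x. w \<in> A.children v \<Longrightarrow> x \<in> A.subtree w \<Longrightarrow> x \<noteq> w \<Longrightarrow> par' (\<phi> w x) = \<phi> w (par x)"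
      by metis
    \<comment> \<open>On the subtree below the child \<open>w\<close> the glued map is \<open>\<phi> w\<close>.\<close>
    define \<Phi> where "\<Phi> x = (if x = v then v' else \<phi> (THE w. w \<in> A.children v \<and> x \<in> A.subtree w) x)" for x
    have \<Phi>_child: "\<Phi> x = \<phi> w x" if w: "w \<in> A.children v" and x: "x \<in> A.subtree w" for w x
    proof -
      have "(THE w. w \<in> A.children v \<and> x \<in> A.subtree w) = w"
        using A.sub_children_disjoint w x by (intro the_equality) blast+
      moreover have "x \<noteq> v" using A.parent_notin_sub_child[OF w] x by auto
      ultimately show ?thesis by (simp add: \<Phi>_def)
    qed
    have inj: "\<pi> w1 \<noteq> \<pi> w2" if "w1 \<in> A.children v" "w2 \<in> A.children v" "w1 \<noteq> w2" for w1 w2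
      using that \<pi>(1) by (auto simp: bij_betw_def inj_on_def)
    have "bij_betw \<Phi> (\<Union>w\<in>A.children v. A.subtree w) (\<Union>w\<in>A.children v. B.subtree (\<pi> w))"
    proof (rule bij_betw_UNION_disjoint)
      show "disjoint_family_on (\<lambda>w. B.subtree (\<pi> w)) (A.children v)"
        unfolding disjoint_family_on_def
        using B.sub_children_disjoint bij_betwE[OF \<pi>(1)] inj by blast
      show "bij_betw \<Phi> (A.subtree w) (B.subtree (\<pi> w))" if "w \<in> A.children v" for w
        using \<phi>(1)[OF that] \<Phi>_child[OF that] by (subst bij_betw_cong[of _ _ "\<phi> w"]) auto
    qed
    moreover have "(\<Union>w\<in>A.children v. B.subtree (\<pi> w)) = (\<Union>w\<in>B.children v'. B.subtree w)"
      using bij_betw_imp_surj_on[OF \<pi>(1)] by (metis image_image)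
    ultimately have bij: "bij_betw \<Phi> (\<Union>w\<in>A.children v. A.subtree w) (\<Union>w\<in>B.children v'. B.subtree w)" by simp
    have v: "\<Phi> v = v'" by (simp add: \<Phi>_def)
    have "v \<notin> (\<Union>w\<in>A.children v. A.subtree w)" "v' \<notin> (\<Union>w\<in>B.children v'. B.subtree w)"
      using A.parent_notin_sub_child B.parent_notin_sub_child by auto
    then have "bij_betw \<Phi> (A.subtree v) (B.subtree v')"
      using notIn_Un_bij_betw[of v "\<Union>w\<in>A.children v. A.subtree w" \<Phi> "\<Union>w\<in>B.children v'. B.subtree w"] bij
      unfolding v A.sub_unfold[of v] B.sub_unfold[of v'] by simp
    moreover have "par' (\<Phi> x) = \<Phi> (par x)" if x: "x \<in> A.subtree v" "x \<noteq> v" for x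
    proof -
      obtain w where w: "w \<in> A.children v" "x \<in> A.subtree w" using x A.sub_unfold[of v] by auto
      show ?thesis
      proof (cases "x = w")
        case True
        then show ?thesis using \<Phi>_child[OF w] \<phi>(2)[OF w(1)] ch[OF w(1)] v by simp
      next
        case False
        have "x \<in> V" using A.sub_in_V w ch by blast
        moreover have "x \<noteq> c" using A.dep_sub[OF w(2)] A.sub_root A.dep_sub[of w c] ch[OF w(1)] False by fastforce
        ultimately have "par x \<in> A.subtree w" using A.par_in_sub_iff[of x w] w False by blast
        then show ?thesis using \<Phi>_child w \<phi>(3)[OF w False] by simp
      qed
    qed
    ultimately show ?case using v by blast
  qed
  then show ?thesis using assms by blast
qed

lemma graph_isoI:
  assumes "pair_graph G" "bij_betw \<phi> (pverts G) (pverts H)"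
    and "parcs H = (\<lambda>(x, y). (\<phi> x, \<phi> y)) ` parcs G"
  shows "graph_iso G H"
proof -
  interpret pair_graph G by fact
  define hom where "hom = \<lparr>iso_verts = \<phi>, iso_arcs = (\<lambda>(x, y). (\<phi> x, \<phi> y)),
    iso_head = (snd :: 'b \<times> 'b \<Rightarrow> 'b), iso_tail = fst\<rparr>"
  have inj: "inj_on \<phi> (pverts G)" using assms(2) by (simp add: bij_betw_def)
  have "inj_on (\<lambda>(x, y). (\<phi> x, \<phi> y)) (parcs G)"
    using inj by (auto simp: inj_on_def dest: in_arcsD1 in_arcsD2)
  then have "pre_digraph.digraph_isomorphism (with_proj G) hom"
    using inj wf_digraph_axioms
    by (auto simp: pre_digraph.digraph_isomorphism_def hom_def)
  moreover have "with_proj H = app_iso hom (with_proj G)"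
    using assms(2,3) by (simp add: with_proj_def app_iso_def hom_def bij_betw_def)
  ultimately show ?thesis unfolding graph_iso_def digraph_iso_def by blast
qed

lemma shape_eq_imp_graph_iso:
  assumes "rooted_tree V c par dep" "rooted_tree V' c' par' dep'"
    and "rooted_tree.shape V c par c = rooted_tree.shape V' c' par' c'"
  shows "graph_iso (tree_graph V c par) (tree_graph V' c' par')"
proof -
  interpret A: rooted_tree V c par dep by fact
  interpret B: rooted_tree V' c' par' dep' by fact
  obtain \<phi> where \<phi>: "bij_betw \<phi> V V'" "\<phi> c = c'" "\<And>w. w \<in> V \<Longrightarrow> w \<noteq> c \<Longrightarrow> par' (\<phi> w) = \<phi> (par w)"
    using shape_eq_imp_bij[OF assms(1,2) A.root_in B.root_in assms(3)] A.sub_root B.sub_root by auto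
  have \<phi>c: "\<phi> w = c' \<longleftrightarrow> w = c" if "w \<in> V" for w
    using \<phi>(1,2) that A.root_in by (auto simp: bij_betw_def inj_on_def)
  have V': "V' = \<phi> ` V" using \<phi>(1) by (simp add: bij_betw_def)
  have "{(par' v, v) | v. v \<in> V' \<and> v \<noteq> c'} = (\<lambda>(x, y). (\<phi> x, \<phi> y)) ` {(par v, v) | v. v \<in> V \<and> v \<noteq> c}"
  proof (intro set_eqI iffI)
    fix e assume "e \<in> {(par' v, v) | v. v \<in> V' \<and> v \<noteq> c'}"
    then obtain w where "w \<in> V" "w \<noteq> c" "e = (par' (\<phi> w), \<phi> w)" using V' \<phi>(2) by auto
    then show "e \<in> (\<lambda>(x, y). (\<phi> x, \<phi> y)) ` {(par v, v) | v. v \<in> V \<and> v \<noteq> c}"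
      using \<phi>(3) by (intro image_eqI[of _ _ "(par w, w)"]) auto
  next
    fix e assume "e \<in> (\<lambda>(x, y). (\<phi> x, \<phi> y)) ` {(par v, v) | v. v \<in> V \<and> v \<noteq> c}"
    then obtain w where "w \<in> V" "w \<noteq> c" "e = (\<phi> (par w), \<phi> w)" by auto
    then show "e \<in> {(par' v, v) | v. v \<in> V' \<and> v \<noteq> c'}" using \<phi>(3) \<phi>c V' by auto
  qed
  then have "parcs (tree_graph V' c' par') = (\<lambda>(x, y). (\<phi> x, \<phi> y)) ` parcs (tree_graph V c par)"
    by (auto simp: tree_graph_def sym_graph_def)
  then show ?thesis
    using graph_isoI[OF A.graph, of \<phi> B.G] \<phi>(1) A.verts_G B.verts_G by simp
qed

text \<open>
  Every finite tree has a copy with vertices in any type that is large enough; this is used to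
  realise the extremal trees on natural numbers.
\<close>

lemma tree_graph_transport:
  fixes V :: "'a set" and f :: "'a \<Rightarrow> 'b"
  assumes "rooted_tree V c par dep" "inj_on f V"
  shows "\<exists>V' c' par' dep'. rooted_tree V' (c' :: 'b) par' dep' \<and>
    rooted_tree.shape V' c' par' c' = rooted_tree.shape V c par c"
proof -
  interpret A: rooted_tree V c par dep by fact
  let ?g = "the_inv_into V f"
  let ?par = "\<lambda>x. f (par (?g x))"
  have g: "?g (f v) = v" if "v \<in> V" for v using assms(2) that by (simp add: the_inv_into_f_f)
  have f_eq: "f v = f w \<longleftrightarrow> v = w" if "v \<in> V" "w \<in> V" for v w
    using assms(2) that by (auto simp: inj_on_def)
  have R: "rooted_tree (f ` V) (f c) ?par (dep \<circ> ?g)"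
  proof -
    have "par v \<in> V" "dep (par v) < dep v" if "v \<in> V" "f v \<noteq> f c" for v
      using that A.par_in A.dep_par by auto
    then show ?thesis using A.finite_V A.root_in g by unfold_locales auto
  qed
  interpret B: rooted_tree "f ` V" "f c" ?par "dep \<circ> ?g" by (fact R)
  have "B.shape (f v) = A.shape v" if "v \<in> V" for v
    using that
  proof (induction v rule: A.shape.induct)
    case (1 v)
    have ch: "B.children (f v) = f ` A.children v"
      unfolding B.children_def A.children_def using g f_eq A.root_in A.par_in 1(2) by (auto simp: image_iff)
    have "inj_on f (A.children v)"
      using assms(2) by (rule inj_on_subset) (auto simp: A.children_def)
    then have "mset_set (B.children (f v)) = image_mset f (mset_set (A.children v))"
      unfolding ch by (simp add: image_mset_mset_set)
    then have "image_mset B.shape (mset_set (B.children (f v))) = image_mset A.shape (mset_set (A.children v))"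
      using 1(1) A.child_in_V by (auto simp: multiset.map_comp comp_def intro!: image_mset_cong)
    then show ?case by (subst A.shape.simps, subst B.shape.simps) simp
  qed
  then show ?thesis using R A.root_in by blast
qed

section \<open>Undirected trees are the trees given by parent functions\<close>

text \<open>
  In terms of arcs: the vertices of a closed walk other than its starting point are the heads of
  its arcs.
\<close>

lemma cycle_iff:
  "pre_digraph.cycle (with_proj G) p \<longleftrightarrow> (\<exists>u. walk G u p u \<and> distinct (map snd p) \<and> p \<noteq> [])"
proof -
  have "tl (pre_digraph.awalk_verts (with_proj G) u p) = map snd p" if "walk G u p u" "p \<noteq> []" for u
    using that pre_digraph.awalk_verts_conv'[of "with_proj G" u p u]
    by (auto simp: pre_digraph.awalk_def)
  then show ?thesis unfolding pre_digraph.cycle_def by metis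
qed

lemma (in wf_digraph) awalk_split:
  "awalk u (p @ e # q) v \<Longrightarrow> awalk u p (tail G e) \<and> e \<in> arcs G \<and> awalk (head G e) q v"
proof (induction p arbitrary: u)
  case Nil
  then show ?case by (auto simp: awalk_Cons_iff awalk_Nil_iff wellformed)
qed (auto simp: awalk_Cons_iff)

lemma (in wf_digraph) awalk_last_head: "awalk u p v \<Longrightarrow> p \<noteq> [] \<Longrightarrow> head G (last p) = v"
proof (induction p arbitrary: u)
  case (Cons e p)
  then show ?case by (cases "p = []") (auto simp: awalk_Cons_iff awalk_Nil_iff)
qed simp

context rooted_tree
begin

text \<open>
  The first arc \<open>(x, y)\<close> of a closed walk crosses the cut of the edge it belongs to,
  so the walk has to return through \<open>(y, x)\<close>. In a cycle the heads of the arcs are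
  distinct, which leaves no room for further arcs.
\<close>

lemma undirected: "undirected_tree G"
proof -
  have "Digraph_Component.connected (with_proj G)"
  proof (rule connectedI)
    show "pverts G \<noteq> {}" using root_in verts_G by auto
    fix u v assume "u \<in> pverts G" "v \<in> pverts G"
    then have "u \<in> V" "v \<in> V" using verts_G by auto
    then obtain p where "walk G u p v" using walk_ex by blast
    then have "u \<rightarrow>\<^sup>*\<^bsub>with_proj G\<^esub> v" by (rule reachable_awalkI)
    then show "u \<rightarrow>\<^sup>*\<^bsub>with_proj (mk_symmetric (with_proj G))\<^esub> v"
      by (rule reachable_mk_symmetricI)
  qed
  moreover have False if cyc: "pre_digraph.cycle (with_proj G) p" and len: "3 \<le> length p" for p
  proof -
    from cyc[unfolded cycle_iff]
    obtain x where p: "walk G x p x" "distinct (map snd p)" "p \<noteq> []" by blast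
    obtain e q where pe: "p = e # q" using p(3) by (cases p) auto
    obtain y where e: "e = (x, y)" "(x, y) \<in> parcs G" "walk G y q x"
      using p(1) unfolding pe awalk_Cons_iff by (metis prod.collapse)
    have q: "p = (x, y) # q" "(x, y) \<in> parcs G" "walk G y q x" using pe e by auto
    have rev_arc: "(y, x) \<in> set q"
    proof -
      consider "y \<in> V" "y \<noteq> c" "x = par y" | "x \<in> V" "x \<noteq> c" "y = par x"
        using q(2) arcs_G by blast
      then show ?thesis
      proof cases
        case 1
        then show ?thesis
          using crossing[of "- subtree y" y x y q x] cut_down[of _ _ y] arcs_G_sym q(3) par_notin_sub[of y] sub_self[of y]
          by blast
      next
        case 2
        then show ?thesis
          using crossing[of "subtree x" y x y q x] cut_down[of _ _ x] q(3) par_notin_sub[of x] sub_self[of x]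
          by blast
      qed
    qed
    then obtain q1 q2 where qs: "q = q1 @ (y, x) # q2" by (meson split_list)
    have w: "walk G y q1 y" "walk G x q2 x"
      using awalk_split[of y q1 "(y, x)" q2 x] q(3) unfolding qs by auto
    have "q2 = []"
    proof (rule ccontr)
      assume "q2 \<noteq> []"
      then have "x \<in> snd ` set q2" using awalk_last_head[OF w(2)] by (metis image_eqI last_in_set)
      then show False using p(2) unfolding q(1) qs by auto
    qed
    moreover have "q1 = []"
    proof (rule ccontr)
      assume "q1 \<noteq> []"
      then have "y \<in> snd ` set q1" using awalk_last_head[OF w(1)] by (metis image_eqI last_in_set)
      then show False using p(2) unfolding q(1) qs by auto
    qed
    ultimately show False using len unfolding q(1) qs by simp
  qed
  ultimately show ?thesis using graph unfolding undirected_tree_def by blast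
qed

lemma TI_iff: "transmission_irregular G \<longleftrightarrow> 1 < n \<and> no_repeats (offsets n (shape c) 0)"
proof -
  have "no_repeats (offsets n (shape c) 0) \<longleftrightarrow> no_repeats (offsets n (shape c) (int (transmission G c)))"
    by (rule no_repeats_offsets_shift[symmetric])
  also have "\<dots> \<longleftrightarrow> no_repeats (image_mset (\<lambda>w. int (transmission G w)) (mset_set V))"
    unfolding offsets_shape[OF root_in] sub_root ..
  also have "\<dots> \<longleftrightarrow> inj_on (transmission G) V"
    using no_repeats_image_mset_set[OF finite_V, of "\<lambda>w. int (transmission G w)"] by (simp add: inj_on_def)
  finally show ?thesis by (simp add: transmission_irregular_def verts_G)
qed

lemma vol_root: "vol (shape c) = n"
  using vol_shape[OF root_in] by (simp add: sub_root)

text \<open>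
  At a vertex of minimum transmission no step into a branch decreases the transmission, so no
  branch contains more than half of the vertices.
\<close>

lemma ti_shape_if_TI:
  assumes TI: "transmission_irregular G" and n: "n = 2 * h + 1"
    and centroid: "\<forall>v\<in>V. transmission G c \<le> transmission G v"
  shows "ti_shape h (shape c)"
proof -
  have "vol u \<le> h" if u: "u \<in># kids (shape c)" for u
  proof -
    obtain w where w: "w \<in> V" "w \<noteq> c" "par w = c" "u = shape w"
    proof -
      have "u \<in> shape ` children c" using u unfolding kids_shape by simp
      then show thesis using that by (auto simp: children_def)
    qed
    then have "0 \<le> int n - 2 * int (card (subtree w))"
      using transmission_step[of w] centroid by fastforce
    then show ?thesis using vol_shape w n by simp
  qed
  then show ?thesis using TI TI_iff vol_root n by (simp add: ti_shape_def)
qed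

lemma TI_tree_if_ti_shape: "ti_shape h (shape c) \<Longrightarrow> 1 \<le> h \<Longrightarrow> TI_tree (2 * h + 1) G"
  using TI_iff vol_root undirected by (simp add: TI_tree_def ti_shape_def verts_G)

end

text \<open>
  Take the distance to \<open>c\<close> as depth. Two different neighbours \<open>u\<close> and
  \<open>w\<close> of \<open>v\<close> that are not further from \<open>c\<close> than
  \<open>v\<close> would be joined by a path through shortest walks to \<open>c\<close>, which
  avoid \<open>v\<close>; together with \<open>v\<close> this path would close to a cycle. So each
  vertex other than \<open>c\<close> has exactly one such neighbour, its parent, and every edge
  joins a vertex to its parent.
\<close>

lemma undirected_tree_rooted:
  assumes T: "undirected_tree G" and c: "c \<in> pverts G"
  shows "\<exists>par dep. rooted_tree (pverts G) c par dep \<and> tree_graph (pverts G) c par = G"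
proof -
  interpret pair_graph G using T by (simp add: undirected_tree_def)
  have sc: "strongly_connected (with_proj G)"
    using T symmetric_connected_imp_strongly_connected pair_sym_arcs by (simp add: undirected_tree_def)
  have walk_ex: "\<exists>p. walk G c p v" if "v \<in> pverts G" for v
    using sc c that by (auto simp: strongly_connected_def reachable_awalk)
  have le: "gdist G c v \<le> length p" if "walk G c p v" for p v
    unfolding gdist_def using that by (intro cINF_lower) auto
  have shortest: "\<exists>p. walk G c p v \<and> length p = gdist G c v" if "v \<in> pverts G" for v
  proof -
    have "gdist G c v \<in> length ` {p. walk G c p v}"
      unfolding gdist_def using walk_ex[OF that] by (intro Inf_nat_def1) auto
    then show ?thesis by auto
  qed
  have ex_par: "\<exists>u. (u, v) \<in> parcs G \<and> gdist G c u < gdist G c v" if v: "v \<in> pverts G" "v \<noteq> c" for v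
  proof -
    obtain p where p: "walk G c p v" "length p = gdist G c v" using shortest v by blast
    then have "p \<noteq> []" using v by (auto simp: awalk_Nil_iff)
    then obtain q e where q: "p = q @ [e]" by (metis append_butlast_last_id)
    then have "walk G c q (fst e)" "snd e = v" "e \<in> parcs G"
      using p(1) by (auto simp: awalk_simps)
    then show ?thesis using le[of q "fst e"] p(2) q by (intro exI[of _ "fst e"]) auto
  qed
  have avoid: "\<exists>p. walk G c p u \<and> (\<forall>e\<in>set p. fst e \<noteq> v \<and> snd e \<noteq> v)"
    if u: "u \<in> pverts G" "u \<noteq> v" "gdist G c u \<le> gdist G c v" for u v
  proof -
    obtain p where p: "walk G c p u" "length p = gdist G c u" using shortest u by blast
    have long: "False" if "p = q @ r" "r \<noteq> []" "walk G c q v" for q r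
      using le[OF that(3)] that(1,2) p(2) u(3) by (cases r) auto
    have "fst e \<noteq> v \<and> snd e \<noteq> v" if e: "e \<in> set p" for e
    proof -
      obtain q r where qr: "p = q @ e # r" using e by (meson split_list)
      have w: "walk G c q (fst e)" "walk G (snd e) r u" "e \<in> parcs G"
        using awalk_split[of c q e r u] p(1) unfolding qr by auto
      then have w2: "walk G c (q @ [e]) (snd e)"
        using awalk_appendI[OF w(1), of "[e]" "snd e"] by (auto simp: awalk_simps dest: in_arcsD2)
      have "fst e \<noteq> v" using long[of q "e # r"] w qr by auto
      moreover have "snd e \<noteq> v"
      proof
        assume s: "snd e = v"
        show False
        proof (cases "r = []")
          case True
          then show False using w(2) s u(2) by (auto simp: awalk_Nil_iff)
        next
          case False
          then show False using long[of "q @ [e]" r] w2 qr s by auto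
        qed
      qed
      ultimately show ?thesis by blast
    qed
    then show ?thesis using p by blast
  qed
  have one_lower: "u = w"
    if uw: "(u, v) \<in> parcs G" "(w, v) \<in> parcs G" "gdist G c u \<le> gdist G c v" "gdist G c w \<le> gdist G c v" for u v w
  proof (rule ccontr)
    assume neq: "u \<noteq> w"
    have ne: "u \<noteq> v" "w \<noteq> v" using uw no_loops' by auto
    have inV: "u \<in> pverts G" "w \<in> pverts G" "v \<in> pverts G" using uw in_arcsD1 in_arcsD2 by auto
    obtain p where p: "walk G c p u" "\<forall>e\<in>set p. fst e \<noteq> v \<and> snd e \<noteq> v"
      using avoid[OF inV(1) ne(1) uw(3)] by blast
    obtain q where q: "walk G c q w" "\<forall>e\<in>set q. fst e \<noteq> v \<and> snd e \<noteq> v"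
      using avoid[OF inV(2) ne(2) uw(4)] by blast
    have rev: "\<forall>e\<in>set (rev_path p). fst e \<noteq> v \<and> snd e \<noteq> v"
      using p(2) by (induction p) auto
    have "walk G u (rev_path p @ q) w" using awalk_appendI p(1) q(1) awalk_rev_path by blast
    define r where "r = awalk_to_apath (rev_path p @ q)"
    have r: "apath u r w" "set r \<subseteq> set (rev_path p @ q)"
      unfolding r_def using apath_awalk_to_apath awalk_to_apath_subset \<open>walk G u (rev_path p @ q) w\<close>
      by blast+
    have rv: "\<forall>e\<in>set r. fst e \<noteq> v \<and> snd e \<noteq> v" using r(2) rev q(2) by auto
    have walk_r: "walk G u r w" using r(1) by (simp add: apath_def)
    have "r \<noteq> []" using walk_r neq by (auto simp: awalk_Nil_iff)
    have "pcas u r w"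
      using walk_r unfolding pre_digraph.awalk_def by (simp add: cas_with_proj_eq)
    then have "pawalk_verts u r = u # map snd r"
      using awalk_verts_conv'[of u r w] \<open>r \<noteq> []\<close> by (cases r) auto
    then have "distinct (u # map snd r)"
      using r(1) by (simp add: apath_def)
    moreover have "v \<notin> set (u # map snd r)" using ne rv by auto
    ultimately have "distinct (map snd ((v, u) # r @ [(w, v)]))" by auto
    moreover have "walk G v ((v, u) # r @ [(w, v)]) v"
      using awalk_appendI[OF walk_r, of "[(w, v)]" v] uw arcs_symmetric inV
      by (auto simp: awalk_simps)
    ultimately have "pre_digraph.cycle (with_proj G) ((v, u) # r @ [(w, v)])"
      unfolding cycle_iff by blast
    moreover have "3 \<le> length ((v, u) # r @ [(w, v)])" using \<open>r \<noteq> []\<close> by (cases r) auto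
    ultimately show False using T unfolding undirected_tree_def by blast
  qed
  define par where "par v = (SOME u. (u, v) \<in> parcs G \<and> gdist G c u < gdist G c v)" for v
  have par: "(par v, v) \<in> parcs G \<and> gdist G c (par v) < gdist G c v" if "v \<in> pverts G" "v \<noteq> c" for v
    unfolding par_def using someI_ex[OF ex_par[OF that]] .
  have R: "rooted_tree (pverts G) c par (gdist G c)"
    using c par in_arcsD1 pair_finite_verts by unfold_locales auto
  have arc: "(y \<noteq> c \<and> x = par y) \<or> (x \<noteq> c \<and> y = par x)" if xy: "(x, y) \<in> parcs G" for x y
  proof -
    have c0: "gdist G c c = 0" using le[of "[]" c] c by (simp add: awalk_Nil_iff)
    have V: "x \<in> pverts G" "y \<in> pverts G" using xy in_arcsD1 in_arcsD2 by auto
    have lower: "b \<noteq> c \<and> a = par b"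
      if ab: "(a, b) \<in> parcs G" "gdist G c a \<le> gdist G c b" "a \<in> pverts G" "b \<in> pverts G" for a b
    proof -
      have "b \<noteq> c"
      proof
        assume "b = c"
        then have "gdist G c a = 0" using ab c0 by simp
        then have "a = c" using ex_par[OF ab(3)] by force
        then show False using ab(1) \<open>b = c\<close> no_loops' by blast
      qed
      then show ?thesis using one_lower[OF ab(1), of "par b"] par[OF ab(4)] ab(2) by auto
    qed
    show ?thesis
      using lower[of x y] lower[of y x] xy arcs_symmetric V by (meson le_cases)
  qed
  have "parcs (tree_graph (pverts G) c par) = parcs G"
  proof (intro set_eqI iffI)
    fix e assume "e \<in> parcs (tree_graph (pverts G) c par)"
    then show "e \<in> parcs G"
      using par arcs_symmetric by (auto simp: tree_graph_def sym_graph_def)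
  next
    fix e assume e: "e \<in> parcs G"
    then show "e \<in> parcs (tree_graph (pverts G) c par)"
      using arc[of "fst e" "snd e"] in_arcsD1[of "fst e" "snd e"] in_arcsD2[of "fst e" "snd e"]
      by (cases e) (auto simp: tree_graph_def sym_graph_def)
  qed
  then have "tree_graph (pverts G) c par = G"
    by (simp add: tree_graph_def sym_graph_def)
  then show ?thesis using R by blast
qed

section \<open>Starlike trees and paths with leaves\<close>

fun star_parent :: "(nat \<times> nat) option \<Rightarrow> (nat \<times> nat) option" where
  "star_parent None = None"
| "star_parent (Some (i, j)) = (if j = 1 then None else Some (i, j - 1))"

fun star_depth :: "(nat \<times> nat) option \<Rightarrow> nat" where
  "star_depth None = 0"
| "star_depth (Some (i, j)) = j"

lemma starlike_verts:
  "pverts (starlike as) = insert None {Some (i, j) | i j. i < length as \<and> 1 \<le> j \<and> j \<le> as ! i}"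
  by (simp add: starlike_def sym_graph_def)

lemma starlike_rooted: "rooted_tree (pverts (starlike as)) None star_parent star_depth"
proof
  have "pverts (starlike as) \<subseteq> insert None (Some ` ({..<length as} \<times> {..Max (insert 0 (set as))}))"
  proof
    fix x assume "x \<in> pverts (starlike as)"
    then consider "x = None" | i j where "i < length as" "j \<le> as ! i" "x = Some (i, j)"
      unfolding starlike_verts by blast
    then show "x \<in> insert None (Some ` ({..<length as} \<times> {..Max (insert 0 (set as))}))"
    proof cases
      case (2 i j)
      have "as ! i \<le> Max (insert 0 (set as))" using 2(1) by (intro Max_ge) auto
      then have "j \<le> Max (insert 0 (set as))" using 2(2) by (rule order_trans[rotated])
      then show ?thesis using 2(1) unfolding 2(3)
        by (intro insertI2 imageI SigmaI) (simp_all only: lessThan_iff atMost_iff)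
    qed simp
  qed
  then show "finite (pverts (starlike as))" by (rule finite_subset) auto
next
  fix v assume "v \<in> pverts (starlike as)" "v \<noteq> None"
  then obtain i j where "v = Some (i, j)" "i < length as" "1 \<le> j" "j \<le> as ! i"
    unfolding starlike_verts by blast
  then show "star_parent v \<in> pverts (starlike as)" "star_depth (star_parent v) < star_depth v"
    by (cases "j = 1"; auto simp: starlike_verts)+
qed (simp add: starlike_verts)

lemma starlike_tree_graph: "tree_graph (pverts (starlike as)) None star_parent = starlike as"
proof -
  have "{(star_parent v, v) | v. v \<in> pverts (starlike as) \<and> v \<noteq> None} =
      {(None, Some (i, 1)) | i. i < length as \<and> 1 \<le> as ! i} \<union>
      {(Some (i, j), Some (i, Suc j)) | i j. i < length as \<and> 1 \<le> j \<and> j < as ! i}" (is "?L = ?R")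
  proof (intro set_eqI iffI)
    fix e assume "e \<in> ?L"
    then obtain i j where "i < length as" "1 \<le> j" "j \<le> as ! i" "e = (star_parent (Some (i, j)), Some (i, j))"
      unfolding starlike_verts by auto
    then show "e \<in> ?R" by (cases j) auto
  next
    fix e assume "e \<in> ?R"
    then show "e \<in> ?L" unfolding starlike_verts by force
  qed
  then show ?thesis
    unfolding tree_graph_def by (simp add: starlike_def sym_graph_def)
qed

lemma starlike_shape:
  assumes "1 \<le> a" "1 \<le> b" "1 \<le> d"
  shows "rooted_tree.shape (pverts (starlike [a, b, d])) None star_parent None
    = Node {#path_shape a, path_shape b, path_shape d#}"
proof -
  let ?as = "[a, b, d]"
  interpret rooted_tree "pverts (starlike ?as)" None star_parent star_depth
    by (rule starlike_rooted)
  have ch: "children (Some (i, j)) = (if j < ?as ! i then {Some (i, Suc j)} else {})"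
    if ij: "i < length ?as" "1 \<le> j" "j \<le> ?as ! i" for i j
  proof -
    have "w \<in> children (Some (i, j)) \<longleftrightarrow> j < ?as ! i \<and> w = Some (i, Suc j)" for w
      unfolding children_def
      using ij by (cases w rule: star_parent.cases) (auto simp: starlike_verts)
    then show ?thesis by auto
  qed
  have leg: "shape (Some (i, j)) = path_shape (?as ! i - j + 1)"
    if "i < length ?as" "1 \<le> j" "j \<le> ?as ! i" for i j
    using that
  proof (induction "?as ! i - j" arbitrary: j)
    case 0
    then show ?case using ch[of i j] by (subst shape.simps) simp
  next
    case (Suc m)
    then have "shape (Some (i, Suc j)) = path_shape (?as ! i - Suc j + 1)" by simp
    then have "shape (Some (i, j)) = Node {#path_shape (?as ! i - j)#}"
      using ch[of i j] Suc by (subst shape.simps) (simp add: Suc_diff_Suc)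
    then show ?case using path_shape_Suc[of "?as ! i - j"] Suc.hyps(2) by simp
  qed
  have "children None = {Some (0, 1), Some (1, 1), Some (2, 1)}"
  proof -
    have "w \<in> children None \<longleftrightarrow> w \<in> {Some (0, 1), Some (1, 1), Some (2, 1)}" for w
    proof (cases w rule: star_parent.cases)
      case (2 i j)
      have "i < length ?as \<longleftrightarrow> i = 0 \<or> i = 1 \<or> i = 2" by auto
      then show ?thesis unfolding children_def using assms 2 by (auto simp: starlike_verts)
    qed (simp add: children_def)
    then show ?thesis by blast
  qed
  then have "shape None = Node {#shape (Some (0, 1)), shape (Some (1, 1)), shape (Some (2, 1))#}"
    by (subst shape.simps) simp
  then show ?thesis using leg[of 0 1] leg[of 1 1] leg[of 2 1] assms by simp
qed

text \<open>
  The path is rooted at its vertex \<open>a\<close>, so the numbers increase towards the root on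
  one side and decrease on the other.
\<close>

fun leafed_parent :: "nat \<Rightarrow> nat \<Rightarrow> nat + nat \<Rightarrow> nat + nat" where
  "leafed_parent a b (Inl j) = Inl (if j < a then Suc j else j - 1)"
| "leafed_parent a b (Inr i) = Inl (if i = 0 then a else b)"

fun leafed_depth :: "nat \<Rightarrow> nat \<Rightarrow> nat + nat \<Rightarrow> nat" where
  "leafed_depth a b (Inl j) = (if j < a then a - j else j - a)"
| "leafed_depth a b (Inr i) = (if i = 0 then 1 else b - a + 1)"

lemma leafed_path_verts:
  "pverts (leafed_path m [a, b]) = Inl ` {1..m} \<union> {Inr 0, Inr 1}"
  by (auto simp: leafed_path_def sym_graph_def)

lemma leafed_path_rooted:
  assumes "1 \<le> a" "a < b" "b \<le> m"
  shows "rooted_tree (pverts (leafed_path m [a, b])) (Inl a) (leafed_parent a b) (leafed_depth a b)"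
proof
  fix v assume "v \<in> pverts (leafed_path m [a, b])" "v \<noteq> Inl a"
  then show "leafed_parent a b v \<in> pverts (leafed_path m [a, b])"
    "leafed_depth a b (leafed_parent a b v) < leafed_depth a b v"
    using assms by (cases v; auto simp: leafed_path_verts image_iff)+
qed (use assms in \<open>auto simp: leafed_path_verts\<close>)

lemma leafed_path_tree_graph:
  assumes "1 \<le> a" "a < b" "b \<le> m"
  shows "tree_graph (pverts (leafed_path m [a, b])) (Inl a) (leafed_parent a b) = leafed_path m [a, b]"
proof -
  let ?E = "{(Inl j, Inl (Suc j)) | j. 1 \<le> j \<and> j < m} \<union>
      {(Inl ([a, b] ! i), Inr i) | i. i < length [a, b]} :: ((nat + nat) \<times> (nat + nat)) set"
  let ?F = "{(leafed_parent a b v, v) | v. v \<in> pverts (leafed_path m [a, b]) \<and> v \<noteq> Inl a}"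
  define D where "D = ({(Inl (Suc j), Inl j) | j. 1 \<le> j \<and> j < a} :: ((nat + nat) \<times> (nat + nat)) set)"
  define U where "U = ({(Inl j, Inl (Suc j)) | j. a \<le> j \<and> j < m} :: ((nat + nat) \<times> (nat + nat)) set)"
  define L where "L = ({(Inl a, Inr 0), (Inl b, Inr 1)} :: ((nat + nat) \<times> (nat + nat)) set)"
  have "?F = D \<union> U \<union> L"
  proof (intro set_eqI iffI)
    fix e assume "e \<in> ?F"
    then show "e \<in> D \<union> U \<union> L" unfolding leafed_path_verts D_def U_def L_def using assms
      by (auto split: if_splits)
  next
    have F: "(leafed_parent a b v, v) \<in> ?F" if "v \<in> pverts (leafed_path m [a, b])" "v \<noteq> Inl a" for v
      using that by blast
    have "(Inl (Suc j), Inl j) \<in> ?F" if "1 \<le> j" "j < a" for j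
      using F[of "Inl j"] that assms by (simp add: leafed_path_verts image_iff)
    then have "D \<subseteq> ?F" unfolding D_def by blast
    moreover have "(Inl j, Inl (Suc j)) \<in> ?F" if "a \<le> j" "j < m" for j
      using F[of "Inl (Suc j)"] that assms by (simp add: leafed_path_verts image_iff)
    then have "U \<subseteq> ?F" unfolding U_def by blast
    moreover have "(Inl a, Inr 0) \<in> ?F" "(Inl b, Inr 1) \<in> ?F"
      using F[of "Inr 0"] F[of "Inr 1"] by (simp_all add: leafed_path_verts)
    then have "L \<subseteq> ?F" unfolding L_def by blast
    ultimately show "e \<in> ?F" if "e \<in> D \<union> U \<union> L" for e using that by blast
  qed
  moreover have "?E = D\<inverse> \<union> U \<union> L"
  proof -
    have "{(Inl j, Inl (Suc j)) | j. 1 \<le> j \<and> j < m} = D\<inverse> \<union> U"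
    proof (intro set_eqI iffI)
      fix e :: "(nat + nat) \<times> (nat + nat)"
      assume "e \<in> {(Inl j, Inl (Suc j)) | j. 1 \<le> j \<and> j < m}"
      then obtain j where "1 \<le> j" "j < m" "e = (Inl j, Inl (Suc j))" by blast
      then show "e \<in> D\<inverse> \<union> U" unfolding D_def U_def by (cases "j < a") auto
    qed (use assms in \<open>auto simp: D_def U_def\<close>)
    moreover have "{(Inl ([a, b] ! i), Inr i) | i. i < length [a, b]} = L"
      unfolding L_def by (auto simp: less_Suc_eq)
    ultimately show ?thesis by simp
  qed
  ultimately have "?F \<union> ?F\<inverse> = ?E \<union> ?E\<inverse>" by (simp only: converse_Un converse_converse) blast
  then show ?thesis
    unfolding tree_graph_def by (simp only: leafed_path_def sym_graph_def) simp
qed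

lemma leafed_path_shape:
  assumes "2 \<le> a" "a < b" "b < m"
  shows "rooted_tree.shape (pverts (leafed_path m [a, b])) (Inl a) (leafed_parent a b) (Inl a)
    = Node {#stem (b - a - 1) (fork (m - b + 2)), path_shape (a - 1), path_shape 1#}"
proof -
  interpret rooted_tree "pverts (leafed_path m [a, b])" "Inl a" "leafed_parent a b" "leafed_depth a b"
    using assms by (intro leafed_path_rooted) auto
  have mem: "w \<in> children (Inl j) \<longleftrightarrow>
      (\<exists>i. w = Inl i \<and> 1 \<le> i \<and> i \<le> m \<and> ((i < a \<and> j = Suc i) \<or> (a < i \<and> i = Suc j)))
      \<or> (w = Inr 0 \<and> j = a) \<or> (w = Inr 1 \<and> j = b)" for w j
    unfolding children_def by (cases w) (auto simp: leafed_path_verts)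
  have leaf: "shape (Inr i) = Node {#}" if "i = 0 \<or> i = 1" for i
  proof -
    have "children (Inr i) = {}"
    proof -
      have "w \<notin> children (Inr i)" for w
        by (cases w) (auto simp: children_def)
      then show ?thesis by blast
    qed
    then show ?thesis by (subst shape.simps) simp
  qed
  have left: "shape (Inl j) = path_shape j" if "1 \<le> j" "j < a" for j
    using that
  proof (induction j)
    case (Suc j)
    show ?case
    proof (cases "j = 0")
      case True
      have "children (Inl (Suc j)) = {}" using mem[of _ "Suc j"] Suc.prems assms True by fastforce
      then show ?thesis using True by (subst shape.simps) simp
    next
      case False
      have "children (Inl (Suc j)) = {Inl j}" using mem[of _ "Suc j"] Suc.prems assms False by fastforce
      then have "shape (Inl (Suc j)) = Node {#path_shape j#}"
        using Suc False by (subst shape.simps) simp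
      then show ?thesis using False path_shape_Suc[of j] by simp
    qed
  qed simp
  have right: "shape (Inl j) = path_shape (m - j + 1)" if "b < j" "j \<le> m" for j
    using that
  proof (induction "m - j" arbitrary: j)
    case 0
    then have "children (Inl j) = {}" using mem[of _ j] assms by fastforce
    then show ?case using 0 by (subst shape.simps) simp
  next
    case (Suc d)
    have "children (Inl j) = {Inl (Suc j)}" using mem[of _ j] Suc assms by fastforce
    moreover have "shape (Inl (Suc j)) = path_shape (m - Suc j + 1)" using Suc by simp
    ultimately have "shape (Inl j) = Node {#path_shape (m - j)#}"
      using Suc by (subst shape.simps) (simp add: Suc_diff_Suc)
    then show ?case using path_shape_Suc[of "m - j"] Suc.hyps(2) by simp
  qed
  have b: "shape (Inl b) = fork (m - b + 2)"
  proof -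
    have "children (Inl b) = {Inl (Suc b), Inr 1}" using mem[of _ b] assms by fastforce
    then have "shape (Inl b) = Node {#shape (Inl (Suc b)), shape (Inr 1)#}"
      by (subst shape.simps) simp
    then show ?thesis using right[of "Suc b"] leaf[of 1] assms by (simp add: Suc_diff_Suc)
  qed
  have middle: "shape (Inl j) = stem (b - j) (fork (m - b + 2))" if "a < j" "j \<le> b" for j
    using that
  proof (induction "b - j" arbitrary: j)
    case 0
    then show ?case using b by simp
  next
    case (Suc d)
    have "children (Inl j) = {Inl (Suc j)}" using mem[of _ j] Suc assms by fastforce
    moreover have "shape (Inl (Suc j)) = stem (b - Suc j) (fork (m - b + 2))" using Suc by simp
    ultimately have "shape (Inl j) = stem (Suc (b - Suc j)) (fork (m - b + 2))"
      by (subst shape.simps) simp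
    moreover have "Suc (b - Suc j) = b - j" using Suc.hyps(2) by simp
    ultimately show ?case by simp
  qed
  have "children (Inl a) = {Inl (Suc a), Inl (a - 1), Inr 0}"
    using mem[of _ a] assms by fastforce
  moreover have "Inl (Suc a) \<noteq> (Inl (a - 1) :: nat + nat)" by simp
  ultimately have "shape (Inl a) = Node {#shape (Inl (Suc a)), shape (Inl (a - 1)), shape (Inr 0)#}"
    by (subst shape.simps) simp
  then show ?thesis using middle[of "Suc a"] left[of "a - 1"] leaf[of 0] assms by simp
qed

section \<open>The extremal transmission irregular trees\<close>

text \<open>
  Transfer from shapes to graphs: if a shape \<open>K\<close> is the unique maximiser among shapes
  and some rooted tree has shape \<open>K\<close>, then a copy of this tree on natural numbers is
  the required \<open>T\<close>.
\<close>

lemma extremal_TI_tree: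
  fixes R :: "'b pair_pre_digraph"
  assumes h: "1 \<le> h"
    and K: "ti_shape h K"
    and max: "\<forall>t. ti_shape h t \<longrightarrow> wien (2 * h + 1) t \<le> wien (2 * h + 1) K \<and>
      (wien (2 * h + 1) t = wien (2 * h + 1) K \<longrightarrow> t = K)"
    and R: "rooted_tree V c par dep" "rooted_tree.shape V c par c = K" "tree_graph V c par = R"
  shows "\<exists>T :: nat pair_pre_digraph. TI_tree (2 * h + 1) T \<and>
    (\<forall>H :: 'a pair_pre_digraph. TI_tree (2 * h + 1) H \<longrightarrow> wiener_index H \<le> wiener_index T) \<and>
    (\<forall>H :: 'a pair_pre_digraph.
       TI_tree (2 * h + 1) H \<and> wiener_index H = wiener_index T \<longrightarrow> graph_iso H T) \<and>
    graph_iso T R"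
proof -
  obtain f :: "'b \<Rightarrow> nat" where "inj_on f V"
    using rooted_tree.finite_V[OF R(1)] finite_imp_inj_to_nat_seg by metis
  from tree_graph_transport[OF R(1) this]
  obtain V' par' dep' and c' :: nat where R': "rooted_tree V' c' par' dep'"
    and K': "rooted_tree.shape V' c' par' c' = K" using R(2) by auto
  interpret B: rooted_tree V' c' par' dep' by (rule R')
  let ?T = "tree_graph V' c' par'"
  have nT: "card V' = 2 * h + 1" using B.vol_root K' K by (simp add: ti_shape_def)
  have WT: "int (wiener_index ?T) = wien (2 * h + 1) K" using B.wiener_shape K' nT by simp
  have H: "wiener_index H \<le> wiener_index ?T \<and> (wiener_index H = wiener_index ?T \<longrightarrow> graph_iso H ?T)"
    if H: "TI_tree (2 * h + 1) H" for H :: "'a pair_pre_digraph"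
  proof -
    have U: "undirected_tree H" "transmission_irregular H" "card (pverts H) = 2 * h + 1"
      using H by (auto simp: TI_tree_def)
    have "finite (pverts H)" "pverts H \<noteq> {}" using U(3) card_gt_0_iff by fastforce+
    then obtain c0 where c0: "c0 \<in> pverts H" "\<forall>v\<in>pverts H. transmission H c0 \<le> transmission H v"
      using ex_min_if_finite[of "transmission H ` pverts H"] by (auto simp: not_less)
    obtain par0 dep0 where A: "rooted_tree (pverts H) c0 par0 dep0" and eq: "tree_graph (pverts H) c0 par0 = H"
      using undirected_tree_rooted[OF U(1) c0(1)] by blast
    interpret A: rooted_tree "pverts H" c0 par0 dep0 by (rule A)
    have ti_shape: "ti_shape h (A.shape c0)" using A.ti_shape_if_TI U c0 unfolding eq by auto
    have WH: "int (wiener_index H) = wien (2 * h + 1) (A.shape c0)"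
      using A.wiener_shape U(3) unfolding eq by simp
    have "graph_iso H ?T" if "wiener_index H = wiener_index ?T"
      using shape_eq_imp_graph_iso[OF A R'] max ti_shape WH WT K' that unfolding eq by simp
    moreover have "wien (2 * h + 1) (A.shape c0) \<le> wien (2 * h + 1) K" using max ti_shape by blast
    ultimately show ?thesis using WH WT by linarith
  qed
  have "TI_tree (2 * h + 1) ?T" using B.TI_tree_if_ti_shape K' K h by simp
  moreover have "graph_iso ?T R" using shape_eq_imp_graph_iso[OF R' R(1)] K' R(2,3) by simp
  ultimately show ?thesis using H by blast
qed

lemma PS_iff: "m \<in> PS \<longleftrightarrow> (\<exists>k. m = k * k)"
  by (simp add: PS_def is_nth_power_def power2_eq_square)

theorem theorem3p1:
  fixes n :: nat
  assumes "odd n" and "n \<ge> 7"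
  shows "\<exists>T :: nat pair_pre_digraph.
    TI_tree n T \<and>
    (\<forall>H :: 'a pair_pre_digraph. TI_tree n H \<longrightarrow> wiener_index H \<le> wiener_index T) \<and>
    (\<forall>H :: 'a pair_pre_digraph.
       TI_tree n H \<and> wiener_index H = wiener_index T \<longrightarrow> graph_iso H T) \<and>
    ({n - 2, n - 1} \<inter> PS = {} \<longrightarrow>
       graph_iso T (starlike [(n - 1) div 2, (n - 3) div 2, 1])) \<and>
    ({n - 2, n - 1} \<inter> PS \<noteq> {} \<and> {2 * n - 6, 2 * n - 2} \<inter> PS = {} \<longrightarrow>
       graph_iso T (starlike [(n - 1) div 2, (n - 5) div 2, 2])) \<and>
    (n - 2 \<in> PS \<and> {2 * n - 6, 2 * n - 2} \<inter> PS \<noteq> {} \<longrightarrow>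
       graph_iso T (leafed_path (n - 2) [(n - 1) div 2, (n - 3) div 2 + floor_sqrt (n - 2)])) \<and>
    (n - 1 \<in> PS \<and> 2 * n - 6 \<in> PS \<longrightarrow>
       graph_iso T (leafed_path (n - 2) [(n + 1) div 2, (n - 3) div 2 + floor_sqrt (n - 1)]))"
proof -
  obtain h where n: "n = 2 * h + 1" using assms(1) by (elim oddE)
  have h3: "3 \<le> h" using assms(2) n by simp
  have arith: "n - 2 = 2 * h - 1" "n - 1 = 2 * h" "2 * n - 6 = 4 * h - 4" "2 * n - 2 = 4 * h"
    "(n - 1) div 2 = h" "(n - 3) div 2 = h - 1" "(n - 5) div 2 = h - 2" "(n + 1) div 2 = h + 1"
    using h3 unfolding n by auto
  have sq: "(int q)\<^sup>2 = int m \<longleftrightarrow> m = q * q" for q m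
    by (metis of_nat_eq_iff of_nat_mult power2_eq_square)
  have c1: "2 * int h - 1 = int (2 * h - 1)" "2 * int h = int (2 * h)"
    "4 * int h - 4 = int (4 * h - 4)" "4 * int h = int (4 * h)" using h3 by auto
  have nonsq: "2 * h - 1 \<notin> PS \<Longrightarrow> (int q)\<^sup>2 \<noteq> 2 * int h - 1" "2 * h \<notin> PS \<Longrightarrow> (int q)\<^sup>2 \<noteq> 2 * int h"
    "4 * h - 4 \<notin> PS \<Longrightarrow> (int q)\<^sup>2 \<noteq> 4 * int h - 4" "4 * h \<notin> PS \<Longrightarrow> (int q)\<^sup>2 \<noteq> 4 * int h" for q
    unfolding PS_iff using sq[of q "2 * h - 1"] sq[of q "2 * h"] sq[of q "4 * h - 4"] sq[of q "4 * h"] c1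
    by metis+
  have issq: "q * q = 2 * h - 1 \<Longrightarrow> (int q)\<^sup>2 = 2 * int h - 1" "q * q = 2 * h \<Longrightarrow> (int q)\<^sup>2 = 2 * int h" for q
    using sq[of q "2 * h - 1"] sq[of q "2 * h"] c1 by metis+
  \<comment> \<open>Consecutive positive integers are not both squares, so the cases below exclude each other.\<close>
  have disj: "\<not> (2 * h - 1 \<in> PS \<and> 2 * h \<in> PS)"
  proof
    assume "2 * h - 1 \<in> PS \<and> 2 * h \<in> PS"
    then obtain i j where "2 * h - 1 = i * i" "2 * h = j * j" unfolding PS_iff by blast
    then have ij: "(int i)\<^sup>2 = 2 * int h - 1" "(int j)\<^sup>2 = 2 * int h"
      using issq by simp_all
    then have "(int i)\<^sup>2 + 2 * int i + 1 \<le> (int j)\<^sup>2" by (intro square_gap) auto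
    then have "i = 0" using ij by simp
    then show False using ij h3 by simp
  qed
  \<comment> \<open>There is no square between 5 and 8, so \<open>h = 3\<close> and \<open>h = 4\<close> belong to the first case.\<close>
  have large: "5 \<le> h \<and> 3 \<le> k" if "k * k = 2 * h - 1 \<or> k * k = 2 * h" for k
  proof -
    have "3 \<le> k"
    proof (rule ccontr)
      assume "\<not> 3 \<le> k"
      then have "k * k \<le> 2 * 2" by (intro mult_mono) auto
      then show False using that h3 by linarith
    qed
    moreover from this have "3 * 3 \<le> k * k" by (intro mult_mono) auto
    ultimately show ?thesis using that by linarith
  qed
  let ?star1 = "starlike [h, h - 1, 1]" and ?star2 = "starlike [h, h - 2, 2]"
  consider (i) "2 * h - 1 \<notin> PS" "2 * h \<notin> PS"
    | (ii) "2 * h - 1 \<in> PS \<or> 2 * h \<in> PS" "4 * h - 4 \<notin> PS" "4 * h \<notin> PS"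
    | (iii) "2 * h - 1 \<in> PS" "2 * h \<notin> PS" "4 * h - 4 \<in> PS \<or> 4 * h \<in> PS"
    | (iv) "2 * h - 1 \<notin> PS" "2 * h \<in> PS" "4 * h - 4 \<in> PS \<or> 4 * h \<in> PS"
    using disj by blast
  then show ?thesis
  proof cases
    case i
    have ti_shape: "ti_shape h (spider1 h)"
      using ti_shape_spider1[OF h3] nonsq(1,2) i by blast
    have shape: "rooted_tree.shape (pverts ?star1) None star_parent None = spider1 h"
      using starlike_shape[of h "h - 1" 1] h3 by (simp add: spider1_def)
    have max: "\<forall>t. ti_shape h t \<longrightarrow> wien (2 * h + 1) t \<le> wien (2 * h + 1) (spider1 h) \<and>
        (wien (2 * h + 1) t = wien (2 * h + 1) (spider1 h) \<longrightarrow> t = spider1 h)"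
      using ti_wien_le_spider1[OF _ h3] wien_spider1[OF h3] by simp
    have "1 \<le> h" using h3 by simp
    from extremal_TI_tree[OF this ti_shape max starlike_rooted shape starlike_tree_graph, where 'a = 'a]
    obtain T :: "nat pair_pre_digraph" where T: "TI_tree n T"
      "\<forall>H :: 'a pair_pre_digraph. TI_tree n H \<longrightarrow> wiener_index H \<le> wiener_index T"
      "\<forall>H :: 'a pair_pre_digraph. TI_tree n H \<and> wiener_index H = wiener_index T \<longrightarrow> graph_iso H T"
      "graph_iso T ?star1"
      unfolding n by (elim exE conjE)
    show ?thesis unfolding arith by (intro exI[of _ T] conjI T(1-3)) (use T(4) i in auto)
  next
    case ii
    then obtain k where k: "k * k = 2 * h - 1 \<or> k * k = 2 * h" unfolding PS_iff by metis
    have h5: "5 \<le> h" using large[OF k] by simp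
    have ik: "(int k)\<^sup>2 = 2 * int h - 1 \<or> (int k)\<^sup>2 = 2 * int h"
      using k issq by blast
    have ti_shape: "ti_shape h (spider2 h)"
      using ti_shape_spider2[OF h5 ik] nonsq(3,4) ii by blast
    have shape: "rooted_tree.shape (pverts ?star2) None star_parent None = spider2 h"
      using starlike_shape[of h "h - 2" 2] h5 by (simp add: spider2_def)
    have max: "\<forall>t. ti_shape h t \<longrightarrow> wien (2 * h + 1) t \<le> wien (2 * h + 1) (spider2 h) \<and>
        (wien (2 * h + 1) t = wien (2 * h + 1) (spider2 h) \<longrightarrow> t = spider2 h)"
      using ti_wien_le_spider2[OF _ h5 k] wien_spider2[of h] h5 by simp
    have "1 \<le> h" using h3 by simp
    from extremal_TI_tree[OF this ti_shape max starlike_rooted shape starlike_tree_graph, where 'a = 'a]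
    obtain T :: "nat pair_pre_digraph" where T: "TI_tree n T"
      "\<forall>H :: 'a pair_pre_digraph. TI_tree n H \<longrightarrow> wiener_index H \<le> wiener_index T"
      "\<forall>H :: 'a pair_pre_digraph. TI_tree n H \<and> wiener_index H = wiener_index T \<longrightarrow> graph_iso H T"
      "graph_iso T ?star2"
      unfolding n by (elim exE conjE)
    show ?thesis unfolding arith by (intro exI[of _ T] conjI T(1-3)) (use T(4) ii in auto)
  next
    case iii
    then obtain k where k: "k * k = 2 * h - 1" unfolding PS_iff by metis
    then have k': "k * k = 2 * h - 1 \<or> k * k = 2 * h" by simp
    obtain q where q: "q * q = 4 * h - 4 \<or> q * q = 4 * h" using iii(3) unfolding PS_iff by metis
    have h5: "5 \<le> h" and k3: "3 \<le> k" using large[OF k'] by auto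
    have kh: "k + 2 \<le> h" using sqrt_bound[of k h] k h5 by simp
    have root: "floor_sqrt (2 * h - 1) = k"
      using floor_sqrt_inverse_power2[of k] k by (simp add: power2_eq_square)
    let ?R = "leafed_path (2 * h - 1) [h, h - 1 + k]"
    have ti_shape: "ti_shape h (forked_odd h k)"
      using ti_shape_forked_odd[OF h5 issq(1)[OF k]] .
    have ab: "2 \<le> h" "h < h - 1 + k" "h - 1 + k < 2 * h - 1" using k3 kh by auto
    have shape: "rooted_tree.shape (pverts ?R) (Inl h) (leafed_parent h (h - 1 + k)) (Inl h) = forked_odd h k"
    proof -
      have "h - 1 + k - h - 1 = k - 2" "2 * h - 1 - (h - 1 + k) + 2 = h - k + 2" using k3 kh by auto
      then show ?thesis using leafed_path_shape[OF ab] by (simp add: forked_odd_def)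
    qed
    have "k * k \<noteq> 2 * h" using k h3 by simp
    then have max: "\<forall>t. ti_shape h t \<longrightarrow> wien (2 * h + 1) t \<le> wien (2 * h + 1) (forked_odd h k) \<and>
        (wien (2 * h + 1) t = wien (2 * h + 1) (forked_odd h k) \<longrightarrow> t = forked_odd h k)"
      using ti_wien_le_forked[OF _ h5 k' q] wien_forked_odd[of k h] k3 kh h5 by simp
    have h1: "1 \<le> h" using h3 by simp
    have rooted: "rooted_tree (pverts ?R) (Inl h) (leafed_parent h (h - 1 + k)) (leafed_depth h (h - 1 + k))"
      and tree: "tree_graph (pverts ?R) (Inl h) (leafed_parent h (h - 1 + k)) = ?R"
      using ab by (auto intro!: leafed_path_rooted leafed_path_tree_graph)
    from extremal_TI_tree[OF h1 ti_shape max rooted shape tree, where 'a = 'a]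
    obtain T :: "nat pair_pre_digraph" where T: "TI_tree n T"
      "\<forall>H :: 'a pair_pre_digraph. TI_tree n H \<longrightarrow> wiener_index H \<le> wiener_index T"
      "\<forall>H :: 'a pair_pre_digraph. TI_tree n H \<and> wiener_index H = wiener_index T \<longrightarrow> graph_iso H T"
      "graph_iso T ?R"
      unfolding n by (elim exE conjE)
    show ?thesis unfolding arith root by (intro exI[of _ T] conjI T(1-3)) (use T(4) iii in auto)
  next
    case iv
    then obtain k where k: "k * k = 2 * h" unfolding PS_iff by metis
    then have k': "k * k = 2 * h - 1 \<or> k * k = 2 * h" by simp
    obtain q where q: "q * q = 4 * h - 4 \<or> q * q = 4 * h" using iv(3) unfolding PS_iff by metis
    have h5: "5 \<le> h" and k3: "3 \<le> k" using large[OF k'] by auto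
    have kh: "k + 2 \<le> h" using sqrt_bound[of k h] k h5 by simp
    have root: "floor_sqrt (2 * h) = k"
      using floor_sqrt_inverse_power2[of k] k by (simp add: power2_eq_square)
    let ?R = "leafed_path (2 * h - 1) [h + 1, h - 1 + k]"
    have ti_shape: "ti_shape h (forked_even h k)"
      using ti_shape_forked_even[OF h5 issq(2)[OF k]] .
    have ab: "2 \<le> h + 1" "h + 1 < h - 1 + k" "h - 1 + k < 2 * h - 1" using k3 kh by auto
    have shape: "rooted_tree.shape (pverts ?R) (Inl (h + 1)) (leafed_parent (h + 1) (h - 1 + k)) (Inl (h + 1)) = forked_even h k"
    proof -
      have "h - 1 + k - (h + 1) - 1 = k - 3" "2 * h - 1 - (h - 1 + k) + 2 = h - k + 2" "h + 1 - 1 = h"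
        using k3 kh by auto
      then show ?thesis using leafed_path_shape[OF ab] by (simp only: forked_even_def) (simp add: add_mset_commute)
    qed
    have max: "\<forall>t. ti_shape h t \<longrightarrow> wien (2 * h + 1) t \<le> wien (2 * h + 1) (forked_even h k) \<and>
        (wien (2 * h + 1) t = wien (2 * h + 1) (forked_even h k) \<longrightarrow> t = forked_even h k)"
      using ti_wien_le_forked[OF _ h5 k' q] wien_forked_even[of k h] k k3 kh h5 by simp
    have h1: "1 \<le> h" using h3 by simp
    have rooted: "rooted_tree (pverts ?R) (Inl (h + 1)) (leafed_parent (h + 1) (h - 1 + k)) (leafed_depth (h + 1) (h - 1 + k))"
      and tree: "tree_graph (pverts ?R) (Inl (h + 1)) (leafed_parent (h + 1) (h - 1 + k)) = ?R"
      using ab by (auto intro!: leafed_path_rooted leafed_path_tree_graph)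
    from extremal_TI_tree[OF h1 ti_shape max rooted shape tree, where 'a = 'a]
    obtain T :: "nat pair_pre_digraph" where T: "TI_tree n T"
      "\<forall>H :: 'a pair_pre_digraph. TI_tree n H \<longrightarrow> wiener_index H \<le> wiener_index T"
      "\<forall>H :: 'a pair_pre_digraph. TI_tree n H \<and> wiener_index H = wiener_index T \<longrightarrow> graph_iso H T"
      "graph_iso T ?R"
      unfolding n by (elim exE conjE)
    show ?thesis unfolding arith root by (intro exI[of _ T] conjI T(1-3)) (use T(4) iv in auto)
  qed
qed

end
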